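(* Let $f\in\mathbb{C}\{x,y\}$ be irreducible with $m(f)>1$, with value semigroup $\Gamma(f)$ minimally generated by $v_0<v_1<\dots<v_g$, in coordinates such that $\nu_f(x)=v_0=m(f)<v_1=\nu_f(y)$ and $v_0\nmid v_1$. Let $f_0=x$, $f_1=y$, and $f_i\in\mathbb{C}\{x,y\}$ with $\nu_f(f_i)=v_i$ for $0\le i\le g$. Let $\mathcal{B}=\{\overline{\eta}_1,\dots,\overline{\eta}_s\}$ be the Standard basis of $\Omega^1/S(f)$ produced by Algorithm 1 (described in the context), with representatives $\eta_i\in\Omega^1$. For each $1\le j,k\le s$, let $s_l(\overline{\eta}_j,\overline{\eta}_k)$, $1\le l\le n(j,k)$, be the minimal $S$-processes of the pair, and write the reduction to zero of each modulo $\mathcal{B}$ as $$s_l(\overline{\eta}_j,\overline{\eta}_k)=\Big(a\prod_{r=0}^g\overline{f}_r^{\,\alpha_{jklr}}\Big)\overline{\eta}_j-\Big(b\prod_{r=0}^g\overline{f}_r^{\,\beta_{jklr}}\Big)\overline{\eta}_k=\sum_{i=1}^s\overline{Q}_{ijkl}\,\overline{\eta}_i,\qquad Q_{ijkl}\in\mathbb{C}\{f_0,\dots,f_g\}.$$ Set $\overline{E}_{jjkl}=\overline{Q}_{jjkl}-a\prod_r\overline{f}_r^{\,\alpha_{jklr}}$, $\overline{E}_{kjkl}=\overline{Q}_{kjkl}+b\prod_r\overline{f}_r^{\,\beta_{jklr}}$, and $\overline{E}_{ijkl}=\overline{Q}_{ijkl}$ for $i\ne j,k$, and let $E_{ijkl}\in\mathbb{C}\{x,y\}$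 be representatives. Then $$G=\Big\{\sum_{i=1}^sE_{ijkl}\eta_i:\ 1\le j,k\le s,\ 1\le l\le n(j,k)\Big\}$$ is a generating set of the $\mathbb{C}\{x,y\}$-module $S(f)$, and there are $\omega_1,\omega_2\in G$ with $\omega_1\wedge\omega_2=uf\,dx\wedge dy$ for a unit $u\in\mathbb{C}\{x,y\}$, so that $\{\omega_1,\omega_2\}$ is a Saito basis for $S(f)$.
   Context: $\Omega^1=\mathbb{C}\{x,y\}dx+\mathbb{C}\{x,y\}dy$ (germs of holomorphic 1-forms at $0\in\mathbb{C}^2$), $F(f)=\{p\,df+f\eta:\ p\in\mathbb{C}\{x,y\},\eta\in\Omega^1\}$, and the Saito module is $S(f)=\{\omega\in\Omega^1:\ g\omega\in F(f)\text{ for some }g\text{ with }\gcd(g,f)=1\}$; equivalently $\omega\wedge df\in f\,\mathbb{C}\{x,y\}\,dx\wedge dy$. It is free of rank 2, and $\omega_1,\omega_2\in S(f)$ form a basis (a "Saito basis") iff $\omega_1\wedge\omega_2=uf\,dx\wedge dy$ with $u$ a unit (Saito's criterion). $m(f)$ is the multiplicity (order) of $f$. $\mathcal{O}_f=\mathbb{C}\{x,y\}/\langle f\rangle$. Valuations: let $(x(t),y(t))$ be a primitive parametrization of the branch $f=0$. For $h\in\mathbb{C}\{x,y\}$, $\nu_f(h)=\mathrm{ord}_t\,h(x(t),y(t))$; $\Gamma(f)=\nu_f(\mathcal{O}_f)$ (ignoring $\infty$) is a numerical semigroup with minimal generators $v_0<\dots<v_g$. $\Omega^1/S(f)$ is an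 $\mathcal{O}_f$-module, embedded in $\mathbb{C}\{t\}$ by $\overline{A\,dx+B\,dy}\mapsto t\,(A(x(t),y(t))x'(t)+B(x(t),y(t))y'(t))$, and $\nu_f(\overline{\omega})$ is the $t$-order of the image. A Standard basis of $\Omega^1/S(f)$ is a finite subset $\mathcal{B}$ such that each nonzero $\overline{\eta}$ satisfies $\nu_f(\overline{\eta})=\nu_f(\overline{h})+\nu_f(\overline{\omega})$ for some $\overline{\omega}\in\mathcal{B}$, $\overline{h}\in\mathcal{O}_f$. Reduction: for $Q\subset\Omega^1/S(f)$ nonempty, a reduction of $\overline{\omega}\ne0$ modulo $Q$ is $r=\overline{\omega}-c\prod_{i=0}^g\overline{f}_i^{\,\alpha_i}q$ with $c\in\mathbb{C}$, $\alpha_i\in\mathbb{N}$, $q\in Q$ and $\nu_f(r)>\nu_f(\overline{\omega})$. A final reduction is obtained by a (possibly infinite) chain of reductions and cannot be reduced further. If the final reduction is $0$, summing the subtracted terms $c\prod\overline{f}_i^{\,\alpha_i}q$ for each $q$ expresses the element as $\sum_i\overline{Q}_i\overline{\eta}_i$ when $Q=\{\overline{\eta}_1,\dots,\overline{\eta}_s\}$; the $Q_{ijkl}$ in the claim are obtained this way. Minimal $S$-process of $\overline{\omega},\overline{\eta}$: an element $a\prod\overline{f}_i^{\,\alpha_i}\overline{\omega}-b\prod\overline{f}_i^{\,\beta_i}\overline{\eta}$, where $(\alpha,\beta)\in\mathbb{N}^{2(g+1)}$ is a minimal (for the componentwise order) solution of $\sum\alpha_iv_i+\nu_f(\overline{\omega})=\sum\beta_iv_i+\nu_f(\overline{\eta})$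 and $a,b\in\mathbb{C}\setminus\{0\}$ are such that the element is zero or has value strictly greater than $\nu_f(\prod\overline{f}_i^{\,\alpha_i}\overline{\omega})$. There are finitely many minimal solutions for each pair; $n(j,k)$ is their number for the pair $\overline{\eta}_j,\overline{\eta}_k$. Algorithm 1: start with $Q_0=\{\overline{df_0},\dots,\overline{df_g}\}$; given $Q_k$, let $R$ be the set of nonzero final reductions modulo $Q_k$ of all minimal $S$-processes of pairs of elements of $Q_k$, and put $Q_{k+1}=Q_k\cup R$; stop when $Q_{k+1}=Q_k$ and output $\mathcal{B}=Q_k$. It is known that this terminates, that the output is a Standard basis, and that every minimal $S$-process of a pair in $\mathcal{B}$ has zero final reduction modulo $\mathcal{B}$. *)

theory Defs
  imports
    "HOL-Analysis.FPS_Convergence"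
    "HOL-Analysis.Infinite_Sum"
    "HOL-Library.Set_Algebras"
begin

unbundle no vec_syntax
unbundle fps_syntax

section \<open>The ring of convergent power series in two variables\<close>

text \<open>
  An element \<open>H\<close> of \<open>complex fps fps\<close> stands for the formal series
  \<open>\<Sum>\<^sub>i\<^sub>j (H $ i $ j) x\<^sup>i y\<^sup>j\<close>. It is convergent if it converges absolutely on some polydisc.
\<close>

definition convergent2 :: "complex fps fps \<Rightarrow> bool" where
  "convergent2 H \<longleftrightarrow>
     (\<exists>r>0. (\<lambda>(i, j). (H $ i $ j) * of_real (r ^ (i + j))) abs_summable_on UNIV)"

lemma convergent2_iff_bound:
  "convergent2 H \<longleftrightarrow> (\<exists>C\<ge>0. \<exists>R\<ge>1. \<forall>i j. norm (H $ i $ j) \<le> C * R ^ (i + j))"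
proof
  assume "convergent2 H"
  then obtain r where r: "r > 0"
    and s: "(\<lambda>(i, j). (H $ i $ j) * of_real (r ^ (i + j))) abs_summable_on UNIV"
    unfolding convergent2_def by blast
  define C where "C = infsum (\<lambda>p. norm (case p of (i, j) \<Rightarrow> (H $ i $ j) * of_real (r ^ (i + j)))) UNIV"
  have C: "norm (H $ i $ j) * r ^ (i + j) \<le> C" for i j
  proof -
    have "sum (\<lambda>p. norm (case p of (i, j) \<Rightarrow> (H $ i $ j) * of_real (r ^ (i + j)))) {(i, j)} \<le> C"
      unfolding C_def by (rule finite_sum_le_infsum[OF s]) auto
    then show ?thesis using r by (simp add: norm_mult norm_power)
  qed
  define R where "R = max 1 (1 / r)"
  have C0: "C \<ge> 0"
    unfolding C_def by (rule infsum_nonneg) auto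
  have "norm (H $ i $ j) \<le> C * R ^ (i + j)" for i j
  proof -
    have "norm (H $ i $ j) \<le> C * (1 / r) ^ (i + j)"
      using C[of i j] r by (simp add: field_simps power_divide)
    also have "\<dots> \<le> C * R ^ (i + j)"
      using C0 r by (intro mult_left_mono power_mono) (auto simp: R_def)
    finally show ?thesis .
  qed
  then show "\<exists>C\<ge>0. \<exists>R\<ge>1. \<forall>i j. norm (H $ i $ j) \<le> C * R ^ (i + j)"
    using C0 by (intro exI[of _ C] conjI exI[of _ R]) (auto simp: R_def)
next
  assume "\<exists>C\<ge>0. \<exists>R\<ge>1. \<forall>i j. norm (H $ i $ j) \<le> C * R ^ (i + j)"
  then obtain C R where CR: "C \<ge> 0" "R \<ge> 1" "\<And>i j. norm (H $ i $ j) \<le> C * R ^ (i + j)"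
    by blast
  define r where "r = 1 / (2 * R)"
  have r: "r > 0" using CR by (simp add: r_def)
  have geo: "(\<lambda>j::nat. (1 / 2 :: real) ^ j) summable_on UNIV"
    by (subst summable_on_UNIV_nonneg_real_iff) (auto intro: summable_geometric)
  have geo2: "(\<lambda>(i::nat, j::nat). C * (1 / 2 :: real) ^ (i + j)) abs_summable_on UNIV \<times> UNIV"
  proof (subst abs_summable_on_Sigma_iff, intro conjI ballI)
    fix i :: nat
    show "(\<lambda>y. case (i, y) of (i, j) \<Rightarrow> C * (1 / 2) ^ (i + j)) abs_summable_on UNIV"
      using summable_on_cmult_right[OF geo, of "C * (1/2)^i"] CR(1)
      by (simp add: power_add abs_mult mult.assoc)
  next
    have "infsum (\<lambda>y. norm (case (i, y) of (i, j) \<Rightarrow> C * (1 / 2 :: real) ^ (i + j))) UNIV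
        = (C * infsum (\<lambda>j::nat. (1/2 :: real) ^ j) UNIV) * (1 / 2) ^ i" for i :: nat
    proof -
      have "infsum (\<lambda>y. norm (case (i, y) of (i, j) \<Rightarrow> C * (1 / 2 :: real) ^ (i + j))) UNIV
          = infsum (\<lambda>j. (C * (1/2)^i) * (1/2 :: real) ^ j) UNIV"
        using CR(1) by (simp add: power_add abs_mult mult.assoc)
      also have "\<dots> = (C * (1/2)^i) * infsum (\<lambda>j. (1/2 :: real) ^ j) UNIV"
        by (rule infsum_cmult_right) (use geo in auto)
      finally show ?thesis by simp
    qed
    moreover have "(\<lambda>i::nat. (C * infsum (\<lambda>j::nat. (1/2 :: real) ^ j) UNIV) * (1 / 2) ^ i) abs_summable_on UNIV"
      using summable_on_cmult_right[OF geo, of "\<bar>C * infsum (\<lambda>j::nat. (1/2 :: real) ^ j) UNIV\<bar>"]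
      by (simp add: abs_mult)
    ultimately show "(\<lambda>i. infsum (\<lambda>y. norm (case (i, y) of (i, j) \<Rightarrow> C * (1 / 2 :: real) ^ (i + j))) UNIV) abs_summable_on (UNIV :: nat set)"
      by simp
  qed
  have "(\<lambda>(i, j). (H $ i $ j) * of_real (r ^ (i + j))) abs_summable_on UNIV \<times> UNIV"
  proof (rule abs_summable_on_comparison_test[OF geo2])
    fix p :: "nat \<times> nat"
    obtain i j where p: "p = (i, j)" by force
    have "norm (H $ i $ j) * r ^ (i + j) \<le> (C * R ^ (i + j)) * r ^ (i + j)"
      using CR r by (intro mult_right_mono) auto
    also have "\<dots> = C * (R * r) ^ (i + j)" by (simp add: power_mult_distrib)
    also have "R * r = 1 / 2" using CR by (simp add: r_def)
    finally show "norm (case p of (i, j) \<Rightarrow> (H $ i $ j) * of_real (r ^ (i + j)))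
        \<le> norm (case p of (i, j) \<Rightarrow> C * (1 / 2 :: real) ^ (i + j))"
      using r CR(1) by (simp add: p norm_mult norm_power abs_mult)
  qed
  then show "convergent2 H" unfolding convergent2_def using r by auto
qed

lemma convergent2I:
  assumes "C \<ge> 0" "R \<ge> 1" "\<And>i j. norm (H $ i $ j) \<le> C * R ^ (i + j)"
  shows "convergent2 H"
  using assms unfolding convergent2_iff_bound by blast

lemma convergent2E:
  assumes "convergent2 H"
  obtains C R where "C \<ge> 0" "R \<ge> 1" "\<And>i j. norm (H $ i $ j) \<le> C * R ^ (i + j)"
  using assms unfolding convergent2_iff_bound by blast

lemma convergent2_const [simp]: "convergent2 (fps_const (fps_const c))"
  by (rule convergent2I[of "norm c" 1]) auto

lemma convergent2_0 [simp]: "convergent2 0"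
  by (rule convergent2I[of 0 1]) auto

lemma convergent2_1 [simp]: "convergent2 1"
  by (rule convergent2I[of 1 1]) auto

lemma convergent2_X [simp]: "convergent2 fps_X"
  by (rule convergent2I[of 1 1]) (auto simp: fps_X_def)

lemma convergent2_Y [simp]: "convergent2 (fps_const fps_X)"
  by (rule convergent2I[of 1 1]) (auto simp: fps_X_def)

lemma convergent2_uminus [simp]: "convergent2 H \<Longrightarrow> convergent2 (- H)"
  unfolding convergent2_def by (simp add: case_prod_unfold)

lemma convergent2_add [simp]:
  assumes "convergent2 H" "convergent2 K"
  shows "convergent2 (H + K)"
proof -
  from assms(1) obtain C R where 1: "C \<ge> 0" "R \<ge> 1" "\<And>i j. norm (H $ i $ j) \<le> C * R ^ (i + j)"
    by (rule convergent2E) blast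
  from assms(2) obtain D S where 2: "D \<ge> 0" "S \<ge> 1" "\<And>i j. norm (K $ i $ j) \<le> D * S ^ (i + j)"
    by (rule convergent2E) blast
  show ?thesis
  proof (rule convergent2I[of "C + D" "max R S"])
    fix i j
    have "norm ((H + K) $ i $ j) \<le> norm (H $ i $ j) + norm (K $ i $ j)"
      by (simp add: norm_triangle_ineq)
    also have "\<dots> \<le> C * R ^ (i + j) + D * S ^ (i + j)" using 1 2 by (intro add_mono) auto
    also have "\<dots> \<le> C * max R S ^ (i + j) + D * max R S ^ (i + j)"
      using 1 2 by (intro add_mono mult_left_mono power_mono) auto
    finally show "norm ((H + K) $ i $ j) \<le> (C + D) * max R S ^ (i + j)"
      by (simp add: algebra_simps)
  qed (use 1 2 in auto)
qed

lemma convergent2_diff [simp]: "convergent2 H \<Longrightarrow> convergent2 K \<Longrightarrow> convergent2 (H - K)"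
  using convergent2_add[of H "- K"] by simp

lemma convergent2_mult [simp]:
  assumes "convergent2 H" "convergent2 K"
  shows "convergent2 (H * K)"
proof -
  from assms(1) obtain C R where 1: "C \<ge> 0" "R \<ge> 1" "\<And>i j. norm (H $ i $ j) \<le> C * R ^ (i + j)"
    by (rule convergent2E) blast
  from assms(2) obtain D S where 2: "D \<ge> 0" "S \<ge> 1" "\<And>i j. norm (K $ i $ j) \<le> D * S ^ (i + j)"
    by (rule convergent2E) blast
  define M where "M = max R S"
  have M: "M \<ge> 1" "M \<ge> R" "M \<ge> S" using 1 by (auto simp: M_def)
  have le: "real (Suc n) \<le> 2 ^ n" for n
  proof (induction n)
    case (Suc n)
    have "real (Suc (Suc n)) \<le> 2 * real (Suc n)" by simp
    also have "\<dots> \<le> 2 * 2 ^ n" using Suc by (intro mult_left_mono) auto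
    finally show ?case by simp
  qed simp
  show ?thesis
  proof (rule convergent2I[of "C * D" "2 * M"])
    fix i j
    have "norm ((H * K) $ i $ j)
        = norm (\<Sum>p=0..i. \<Sum>q=0..j. H $ p $ q * K $ (i - p) $ (j - q))"
      by (simp add: fps_mult_nth fps_sum_nth)
    also have "\<dots> \<le> (\<Sum>p=0..i. \<Sum>q=0..j. norm (H $ p $ q * K $ (i - p) $ (j - q)))"
      by (rule order_trans[OF norm_sum sum_mono]) (rule norm_sum)
    also have "\<dots> \<le> (\<Sum>p=0..i. \<Sum>q=0..j. C * D * M ^ (i + j))"
    proof (intro sum_mono)
      fix p q assume pq: "p \<in> {0..i}" "q \<in> {0..j}"
      have "norm (H $ p $ q * K $ (i - p) $ (j - q))
          \<le> (C * R ^ (p + q)) * (D * S ^ ((i - p) + (j - q)))"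
        unfolding norm_mult using 1 2 by (intro mult_mono) auto
      also have "\<dots> \<le> (C * M ^ (p + q)) * (D * M ^ ((i - p) + (j - q)))"
        using 1 2 M by (intro mult_mono power_mono mult_nonneg_nonneg) auto
      also have "\<dots> = C * D * M ^ ((p + q) + ((i - p) + (j - q)))"
        by (simp only: power_add) (simp add: mult_ac)
      also have "(p + q) + ((i - p) + (j - q)) = i + j" using pq by auto
      finally show "norm (H $ p $ q * K $ (i - p) $ (j - q)) \<le> C * D * M ^ (i + j)" .
    qed
    also have "\<dots> = (real (Suc i) * real (Suc j)) * (C * D * M ^ (i + j))" by simp
    also have "\<dots> \<le> (2 ^ i * 2 ^ j) * (C * D * M ^ (i + j))"
      using 1 2 M le[of i] le[of j] by (intro mult_right_mono mult_mono) auto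
    also have "\<dots> = C * D * (2 * M) ^ (i + j)"
      by (simp add: power_add power_mult_distrib)
    finally show "norm ((H * K) $ i $ j) \<le> C * D * (2 * M) ^ (i + j)" .
  qed (use 1 2 M in auto)
qed

lemma convergent2_shift_bound:
  assumes "convergent2 H" "di + dj \<le> 1"
    and "\<And>i j. norm (K $ i $ j) \<le> real (Suc (i + j)) * norm (H $ (i + di) $ (j + dj))"
  shows "convergent2 K"
proof -
  from assms(1) obtain C R where 1: "C \<ge> 0" "R \<ge> 1" "\<And>i j. norm (H $ i $ j) \<le> C * R ^ (i + j)"
    by (rule convergent2E) blast
  have le: "real (Suc n) \<le> 2 ^ n" for n
  proof (induction n)
    case (Suc n)
    have "real (Suc (Suc n)) \<le> 2 * real (Suc n)" by simp
    also have "\<dots> \<le> 2 * 2 ^ n" using Suc by (intro mult_left_mono) auto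
    finally show ?case by simp
  qed simp
  show ?thesis
  proof (rule convergent2I[of "C * R" "2 * R"])
    fix i j
    have "norm (K $ i $ j) \<le> real (Suc (i + j)) * norm (H $ (i + di) $ (j + dj))"
      by (rule assms(3))
    also have "\<dots> \<le> 2 ^ (i + j) * (C * R ^ ((i + di) + (j + dj)))"
      using 1 le[of "i + j"] by (intro mult_mono) auto
    also have "\<dots> \<le> 2 ^ (i + j) * (C * R ^ Suc (i + j))"
      using 1 assms(2) by (intro mult_left_mono power_increasing) auto
    also have "\<dots> = C * R * (2 * R) ^ (i + j)" by (simp add: power_mult_distrib)
    finally show "norm (K $ i $ j) \<le> C * R * (2 * R) ^ (i + j)" .
  qed (use 1 in auto)
qed

lemma convergent2_deriv_outer [simp]:
  assumes "convergent2 H" shows "convergent2 (fps_deriv H)"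
proof (rule convergent2_shift_bound[OF assms, of 1 0])
  fix i j
  have "fps_deriv H $ i $ j = of_nat (Suc i) * H $ Suc i $ j"
    by (simp flip: fps_of_nat del: of_nat_Suc)
  then have "norm (fps_deriv H $ i $ j) = real (Suc i) * norm (H $ Suc i $ j)"
    by (simp add: norm_mult del: of_nat_Suc)
  also have "\<dots> \<le> real (Suc (i + j)) * norm (H $ Suc i $ j)"
    by (intro mult_right_mono) auto
  finally show "norm (fps_deriv H $ i $ j) \<le> real (Suc (i + j)) * norm (H $ (i + 1) $ (j + 0))"
    by simp
qed simp

lemma convergent2_deriv_inner [simp]:
  assumes "convergent2 H" shows "convergent2 (Abs_fps (\<lambda>i. fps_deriv (H $ i)))"
proof (rule convergent2_shift_bound[OF assms, of 0 1])
  fix i j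
  have "norm (Abs_fps (\<lambda>i. fps_deriv (H $ i)) $ i $ j) = real (Suc j) * norm (H $ i $ Suc j)"
    by (simp add: norm_mult del: of_nat_Suc)
  also have "\<dots> \<le> real (Suc (i + j)) * norm (H $ i $ Suc j)"
    by (intro mult_right_mono) auto
  finally show "norm (Abs_fps (\<lambda>i. fps_deriv (H $ i)) $ i $ j)
      \<le> real (Suc (i + j)) * norm (H $ (i + 0) $ (j + 1))" by simp
qed simp

typedef germ = "{H :: complex fps fps. convergent2 H}"
  morphisms fps_of_germ germ_of_fps
  by (rule exI[of _ 0]) simp

setup_lifting type_definition_germ

instantiation germ :: comm_ring_1
begin

lift_definition zero_germ :: germ is 0 by simp
lift_definition one_germ :: germ is 1 by simp
lift_definition plus_germ :: "germ \<Rightarrow> germ \<Rightarrow> germ" is "(+)" by simp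
lift_definition minus_germ :: "germ \<Rightarrow> germ \<Rightarrow> germ" is "(-)" by simp
lift_definition uminus_germ :: "germ \<Rightarrow> germ" is uminus by simp
lift_definition times_germ :: "germ \<Rightarrow> germ \<Rightarrow> germ" is "(*)" by simp

instance
proof
  fix a b c :: germ
  show "a * b * c = a * (b * c)" by transfer (simp add: mult.assoc)
  show "a * b = b * a" by transfer (simp add: mult.commute)
  show "1 * a = a" by transfer simp
  show "a + b + c = a + (b + c)" by transfer (simp add: add.assoc)
  show "a + b = b + a" by transfer (simp add: add.commute)
  show "0 + a = a" by transfer simp
  show "- a + a = 0" by transfer simp
  show "a - b = a + - b" by transfer simp
  show "(a + b) * c = a * c + b * c" by transfer (simp add: distrib_right)
  show "(0::germ) \<noteq> 1" by transfer simp
qed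

end

instance germ :: idom
proof
  fix a b :: germ
  show "a \<noteq> 0 \<Longrightarrow> b \<noteq> 0 \<Longrightarrow> a * b \<noteq> 0" by transfer simp
qed

text \<open>Exact division; it is only there to make \<^const>\<open>coprime\<close> available.\<close>

instantiation germ :: idom_divide
begin

definition divide_germ :: "germ \<Rightarrow> germ \<Rightarrow> germ" where
  "divide_germ a b = (if b \<noteq> 0 \<and> b dvd a then THE q. a = q * b else 0)"

instance
proof
  fix a b :: germ
  have canc: "q = r" if "q * b = r * b" "b \<noteq> 0" for q r :: germ
    using that by simp
  show "b \<noteq> 0 \<Longrightarrow> a * b div b = a"
  proof -
    assume b: "b \<noteq> 0"
    have "b dvd a * b" unfolding dvd_def by (rule exI[of _ a]) (rule mult.commute)
    moreover have "(THE q. a * b = q * b) = a"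
      by (rule the_equality) (use canc b in auto)
    ultimately show ?thesis using b by (simp add: divide_germ_def)
  qed
  show "a div 0 = 0" by (simp add: divide_germ_def)
qed

end

instance germ :: algebraic_semidom ..

lift_definition germ_const :: "complex \<Rightarrow> germ" is "\<lambda>c. fps_const (fps_const c)" by simp
lift_definition germ_x :: germ is "fps_X" by simp
lift_definition germ_y :: germ is "fps_const fps_X" by simp

lift_definition coeff2 :: "germ \<Rightarrow> nat \<Rightarrow> nat \<Rightarrow> complex" is "\<lambda>H i j. H $ i $ j" .

lift_definition partial_x :: "germ \<Rightarrow> germ" is "fps_deriv" by simp
lift_definition partial_y :: "germ \<Rightarrow> germ" is "\<lambda>H. Abs_fps (\<lambda>i. fps_deriv (H $ i))" by simp

definition multiplicity_at_0 :: "germ \<Rightarrow> nat" where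
  "multiplicity_at_0 f = (LEAST n. \<exists>i j. i + j = n \<and> coeff2 f i j \<noteq> 0)"


section \<open>Germs of 1-forms and the Saito module\<close>

text \<open>The pair \<open>(A, B)\<close> stands for the 1-form \<open>A dx + B dy\<close>.\<close>

type_synonym form = "germ \<times> germ"

definition form_scale :: "germ \<Rightarrow> form \<Rightarrow> form" (infixr \<open>*\<^sub>\<Omega>\<close> 75) where
  "h *\<^sub>\<Omega> \<omega> = (h * fst \<omega>, h * snd \<omega>)"

global_interpretation Omega: module form_scale
  by standard (auto simp: form_scale_def algebra_simps)

definition d_germ :: "germ \<Rightarrow> form" where
  "d_germ h = (partial_x h, partial_y h)"

text \<open>The coefficient of \<open>dx \<and> dy\<close> in \<open>\<omega> \<and> \<eta>\<close>.\<close>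

definition wedge :: "form \<Rightarrow> form \<Rightarrow> germ" where
  "wedge \<omega> \<eta> = fst \<omega> * snd \<eta> - snd \<omega> * fst \<eta>"

definition F_module :: "germ \<Rightarrow> form set" where
  "F_module f = {p *\<^sub>\<Omega> d_germ f + f *\<^sub>\<Omega> \<eta> | p \<eta>. True}"

definition saito_module :: "germ \<Rightarrow> form set" where
  "saito_module f = {\<omega>. \<exists>g. coprime g f \<and> g *\<^sub>\<Omega> \<omega> \<in> F_module f}"

definition saito_basis :: "germ \<Rightarrow> form \<Rightarrow> form \<Rightarrow> bool" where
  "saito_basis f \<omega>\<^sub>1 \<omega>\<^sub>2 \<longleftrightarrow>
     \<omega>\<^sub>1 \<noteq> \<omega>\<^sub>2 \<and> Omega.independent {\<omega>\<^sub>1, \<omega>\<^sub>2} \<and> Omega.span {\<omega>\<^sub>1, \<omega>\<^sub>2} = saito_module f"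


section \<open>Parametrization, values and the value semigroup\<close>

type_synonym param = "complex fps \<times> complex fps"

text \<open>
  The series \<open>h(x(t), y(t))\<close>. For \<open>x(0) = y(0) = 0\<close> only the monomials \<open>x\<^sup>i y\<^sup>j\<close> with
  \<open>i, j \<le> n\<close> contribute to the coefficient of \<open>t\<^sup>n\<close>.
\<close>

definition pullback :: "param \<Rightarrow> germ \<Rightarrow> complex fps" where
  "pullback \<phi> h =
     Abs_fps (\<lambda>n. \<Sum>i\<le>n. \<Sum>j\<le>n. coeff2 h i j * ((fst \<phi> ^ i * snd \<phi> ^ j) $ n))"

text \<open>
  Primitivity: \<open>\<phi>\<close> does not factor through a series \<open>\<sigma>(t)\<close> of order at least two.
\<close>

definition primitive_parametrization :: "germ \<Rightarrow> param \<Rightarrow> bool" where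
  "primitive_parametrization f \<phi> \<longleftrightarrow>
     fps_conv_radius (fst \<phi>) > 0 \<and> fps_conv_radius (snd \<phi>) > 0 \<and>
     fst \<phi> $ 0 = 0 \<and> snd \<phi> $ 0 = 0 \<and> \<phi> \<noteq> (0, 0) \<and>
     pullback \<phi> f = 0 \<and>
     \<not> (\<exists>\<sigma> \<xi> \<zeta>. fps_conv_radius \<sigma> > 0 \<and> fps_conv_radius \<xi> > 0 \<and> fps_conv_radius \<zeta> > 0 \<and>
            \<sigma> $ 0 = 0 \<and> \<sigma> $ 1 = 0 \<and> \<phi> = (\<xi> oo \<sigma>, \<zeta> oo \<sigma>))"

definition t_order :: "complex fps \<Rightarrow> enat" where
  "t_order p = (if p = 0 then \<infinity> else enat (subdegree p))"

definition germ_val :: "param \<Rightarrow> germ \<Rightarrow> enat" where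
  "germ_val \<phi> h = t_order (pullback \<phi> h)"

definition value_semigroup :: "param \<Rightarrow> nat set" where
  "value_semigroup \<phi> = {n. \<exists>h. germ_val \<phi> h = enat n}"

definition submonoid_gen :: "nat set \<Rightarrow> nat set" where
  "submonoid_gen V = {\<Sum>w\<in>V. a w * w | a. True}"

definition minimally_generated :: "nat set \<Rightarrow> nat set \<Rightarrow> bool" where
  "minimally_generated V \<Gamma> \<longleftrightarrow>
     finite V \<and> submonoid_gen V = \<Gamma> \<and> (\<forall>W. W \<subset> V \<longrightarrow> submonoid_gen W \<noteq> \<Gamma>)"

definition form_val :: "param \<Rightarrow> form \<Rightarrow> enat" where
  "form_val \<phi> \<omega> = t_order (fps_X * (pullback \<phi> (fst \<omega>) * fps_deriv (fst \<phi>)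
                                  + pullback \<phi> (snd \<omega>) * fps_deriv (snd \<phi>)))"


section \<open>The quotient of the 1-forms by the Saito module\<close>

text \<open>
  Elements of the quotient are cosets; the operations and the value are obtained by applying
  the operations of 1-forms to all representatives. The zero element is \<^term>\<open>saito_module f\<close>.
  The value does not depend on the representative, since \<^term>\<open>saito_module f\<close> is the kernel of
  \<open>A dx + B dy \<mapsto> t (A x' + B y')\<close>. The action of \<open>h\<close> depends only on \<open>h\<close> modulo \<open>f\<close>.
\<close>

type_synonym form_class = "form set"

definition form_class :: "germ \<Rightarrow> form \<Rightarrow> form_class" where
  "form_class f \<omega> = \<omega> +o saito_module f"

definition class_scale :: "germ \<Rightarrow> germ \<Rightarrow> form_class \<Rightarrow> form_class" where
  "class_scale f h W = (\<Union>\<omega>\<in>W. form_class f (h *\<^sub>\<Omega> \<omega>))"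

definition class_diff :: "germ \<Rightarrow> form_class \<Rightarrow> form_class \<Rightarrow> form_class" where
  "class_diff f W W' = (\<Union>\<omega>\<in>W. \<Union>\<eta>\<in>W'. form_class f (\<omega> - \<eta>))"

definition class_val :: "param \<Rightarrow> form_class \<Rightarrow> enat" where
  "class_val \<phi> W = the_elem (form_val \<phi> ` W)"


section \<open>Reductions, S-processes and the algorithm\<close>

definition f_monomial :: "nat \<Rightarrow> (nat \<Rightarrow> germ) \<Rightarrow> (nat \<Rightarrow> nat) \<Rightarrow> germ" where
  "f_monomial g F \<alpha> = (\<Prod>i\<le>g. F i ^ \<alpha> i)"

definition reduction_step ::
  "germ \<Rightarrow> param \<Rightarrow> nat \<Rightarrow> (nat \<Rightarrow> germ) \<Rightarrow> form_class set \<Rightarrow>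
   form_class \<Rightarrow> complex \<Rightarrow> (nat \<Rightarrow> nat) \<Rightarrow> form_class \<Rightarrow> form_class \<Rightarrow> bool" where
  "reduction_step f \<phi> g F Q W c \<alpha> q W' \<longleftrightarrow>
     W \<noteq> saito_module f \<and> q \<in> Q \<and>
     W' = class_diff f W (class_scale f (germ_const c * f_monomial g F \<alpha>) q) \<and>
     class_val \<phi> W < class_val \<phi> W'"

text \<open>
  A chain of \<open>len\<close> reductions \<open>R 0, R 1, \<dots>\<close>. The values in an infinite chain are strictly
  increasing, so the final reduction is zero.
\<close>

definition reduction_chain ::
  "germ \<Rightarrow> param \<Rightarrow> nat \<Rightarrow> (nat \<Rightarrow> germ) \<Rightarrow> form_class set \<Rightarrow> enat \<Rightarrow>
   (nat \<Rightarrow> complex) \<Rightarrow> (nat \<Rightarrow> nat \<Rightarrow> nat) \<Rightarrow> (nat \<Rightarrow> form_class) \<Rightarrow> (nat \<Rightarrow> form_class) \<Rightarrow> bool" where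
  "reduction_chain f \<phi> g F Q len c \<alpha> q R \<longleftrightarrow>
     (\<forall>n. enat n < len \<longrightarrow> reduction_step f \<phi> g F Q (R n) (c n) (\<alpha> n) (q n) (R (Suc n)))"

definition chain_result :: "germ \<Rightarrow> enat \<Rightarrow> (nat \<Rightarrow> form_class) \<Rightarrow> form_class" where
  "chain_result f len R = (case len of enat N \<Rightarrow> R N | \<infinity> \<Rightarrow> saito_module f)"

definition final_reduction ::
  "germ \<Rightarrow> param \<Rightarrow> nat \<Rightarrow> (nat \<Rightarrow> germ) \<Rightarrow> form_class set \<Rightarrow> form_class \<Rightarrow> form_class \<Rightarrow> bool" where
  "final_reduction f \<phi> g F Q W Z \<longleftrightarrow>
     (\<exists>len c \<alpha> q R. reduction_chain f \<phi> g F Q len c \<alpha> q R \<and> R 0 = W \<and> chain_result f len R = Z) \<and>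
     \<not> (\<exists>c \<alpha> q Z'. reduction_step f \<phi> g F Q Z c \<alpha> q Z')"

definition value_solutions ::
  "nat \<Rightarrow> (nat \<Rightarrow> nat) \<Rightarrow> enat \<Rightarrow> enat \<Rightarrow> ((nat \<Rightarrow> nat) \<times> (nat \<Rightarrow> nat)) set" where
  "value_solutions g v m n =
     {(\<alpha>, \<beta>). (\<forall>i>g. \<alpha> i = 0 \<and> \<beta> i = 0) \<and>
        enat (\<Sum>i\<le>g. \<alpha> i * v i) + m = enat (\<Sum>i\<le>g. \<beta> i * v i) + n}"

definition minimal_solutions ::
  "nat \<Rightarrow> (nat \<Rightarrow> nat) \<Rightarrow> enat \<Rightarrow> enat \<Rightarrow> ((nat \<Rightarrow> nat) \<times> (nat \<Rightarrow> nat)) set" where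
  "minimal_solutions g v m n =
     {(\<alpha>, \<beta>) \<in> value_solutions g v m n.
        \<forall>(\<alpha>', \<beta>') \<in> value_solutions g v m n. \<alpha>' \<le> \<alpha> \<and> \<beta>' \<le> \<beta> \<longrightarrow> \<alpha>' = \<alpha> \<and> \<beta>' = \<beta>}"

definition S_element ::
  "germ \<Rightarrow> nat \<Rightarrow> (nat \<Rightarrow> germ) \<Rightarrow> complex \<Rightarrow> (nat \<Rightarrow> nat) \<Rightarrow> form_class \<Rightarrow>
   complex \<Rightarrow> (nat \<Rightarrow> nat) \<Rightarrow> form_class \<Rightarrow> form_class" where
  "S_element f g F a \<alpha> W b \<beta> W' =
     class_diff f (class_scale f (germ_const a * f_monomial g F \<alpha>) W)
                  (class_scale f (germ_const b * f_monomial g F \<beta>) W')"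

definition minimal_S_process ::
  "germ \<Rightarrow> param \<Rightarrow> nat \<Rightarrow> (nat \<Rightarrow> nat) \<Rightarrow> (nat \<Rightarrow> germ) \<Rightarrow> complex \<Rightarrow> (nat \<Rightarrow> nat) \<Rightarrow> form_class \<Rightarrow>
   complex \<Rightarrow> (nat \<Rightarrow> nat) \<Rightarrow> form_class \<Rightarrow> bool" where
  "minimal_S_process f \<phi> g v F a \<alpha> W b \<beta> W' \<longleftrightarrow>
     (\<alpha>, \<beta>) \<in> minimal_solutions g v (class_val \<phi> W) (class_val \<phi> W') \<and> a \<noteq> 0 \<and> b \<noteq> 0 \<and>
     (S_element f g F a \<alpha> W b \<beta> W' = saito_module f \<or>
      class_val \<phi> (class_scale f (f_monomial g F \<alpha>) W) < class_val \<phi> (S_element f g F a \<alpha> W b \<beta> W'))"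

text \<open>
  One round of the algorithm. The constants of an S-process are determined only up to a common
  factor and final reductions are not unique; a round fixes, for every pair and every minimal
  solution, one S-process and one final reduction \<open>r W W' \<alpha> \<beta>\<close> of it.
\<close>

definition algorithm_round ::
  "germ \<Rightarrow> param \<Rightarrow> nat \<Rightarrow> (nat \<Rightarrow> nat) \<Rightarrow> (nat \<Rightarrow> germ) \<Rightarrow> form_class set \<Rightarrow> form_class set \<Rightarrow> bool" where
  "algorithm_round f \<phi> g v F Q Q' \<longleftrightarrow>
     (\<exists>r. (\<forall>W\<in>Q. \<forall>W'\<in>Q. \<forall>(\<alpha>, \<beta>) \<in> minimal_solutions g v (class_val \<phi> W) (class_val \<phi> W').
             \<exists>a b. minimal_S_process f \<phi> g v F a \<alpha> W b \<beta> W' \<and>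
                   final_reduction f \<phi> g F Q (S_element f g F a \<alpha> W b \<beta> W') (r W W' \<alpha> \<beta>)) \<and>
          Q' = Q \<union> {r W W' \<alpha> \<beta> | W W' \<alpha> \<beta>. W \<in> Q \<and> W' \<in> Q \<and>
                      (\<alpha>, \<beta>) \<in> minimal_solutions g v (class_val \<phi> W) (class_val \<phi> W') \<and>
                      r W W' \<alpha> \<beta> \<noteq> saito_module f})"

inductive algorithm_state ::
  "germ \<Rightarrow> param \<Rightarrow> nat \<Rightarrow> (nat \<Rightarrow> nat) \<Rightarrow> (nat \<Rightarrow> germ) \<Rightarrow> form_class set \<Rightarrow> bool"
  for f \<phi> g v F where
  start: "algorithm_state f \<phi> g v F {form_class f (d_germ (F i)) | i. i \<le> g}"
| round: "algorithm_state f \<phi> g v F Q \<Longrightarrow> algorithm_round f \<phi> g v F Q Q' \<Longrightarrow> Q' \<noteq> Q \<Longrightarrow>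
          algorithm_state f \<phi> g v F Q'"

definition algorithm_output ::
  "germ \<Rightarrow> param \<Rightarrow> nat \<Rightarrow> (nat \<Rightarrow> nat) \<Rightarrow> (nat \<Rightarrow> germ) \<Rightarrow> form_class set \<Rightarrow> bool" where
  "algorithm_output f \<phi> g v F B \<longleftrightarrow> algorithm_state f \<phi> g v F B \<and> algorithm_round f \<phi> g v F B B"

text \<open>
  \<open>P i\<close>, for \<open>i\<close> in \<open>{1..s}\<close>, is a convergent series whose class modulo \<open>f\<close> is the (possibly infinite)
  sum of the coefficients \<open>c F\<^sup>\<alpha>\<close> of the terms \<open>c F\<^sup>\<alpha> q\<close>, with \<open>q\<close> the class of \<open>\<eta> i\<close>, that are
  subtracted along a chain reducing \<open>W\<close> to zero modulo the classes of \<open>\<eta> 1, \<dots>, \<eta> s\<close>. The sum is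
  taken in the \<open>t\<close>-adic topology of \<^typ>\<open>complex fps\<close>, after the embedding
  \<open>h \<mapsto> h(x(t), y(t))\<close> of the local ring of the branch.
\<close>

definition zero_reduction_coefficients ::
  "germ \<Rightarrow> param \<Rightarrow> nat \<Rightarrow> (nat \<Rightarrow> germ) \<Rightarrow> nat \<Rightarrow> (nat \<Rightarrow> form) \<Rightarrow> form_class \<Rightarrow> (nat \<Rightarrow> germ) \<Rightarrow> bool" where
  "zero_reduction_coefficients f \<phi> g F s \<eta> W P \<longleftrightarrow>
     (\<exists>len c \<alpha> q R.
        reduction_chain f \<phi> g F ((\<lambda>i. form_class f (\<eta> i)) ` {1..s}) len c \<alpha> q R \<and>
        R 0 = W \<and> chain_result f len R = saito_module f \<and>
        (\<forall>i\<in>{1..s}.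
           (\<lambda>n. if enat n < len \<and> q n = form_class f (\<eta> i)
                then pullback \<phi> (germ_const (c n) * f_monomial g F (\<alpha> n)) else 0) sums pullback \<phi> (P i)))"

end

(*
  Idea. The pullback along the branch identifies the Saito module S(f) with the kernel of
  A dx + B dy |-> A(x(t),y(t)) x'(t) + B(x(t),y(t)) y'(t); the kernel of the pullback on functions
  is (f), since it is principal by a Krull-type argument and f is irreducible. S(f) is free of
  rank 2 because S(f)/x S(f) embeds into C{y}^2, and a pair of elements is a basis as soon as its
  wedge product is a unit times f.

  A form in S(f) is a relation between the values of the standard basis. Cancelling leading terms
  with the syzygies of the minimal S-processes raises the t-order of the coefficients of a relation
  arbitrarily. By primitivity the branch has a conductor, so coefficients of large order are
  divisible by x modulo f; hence S(f) = span G + x S(f) + f Omega. As v_0 does not divide v_1,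
  S(f) lies in the maximal ideal times Omega, so forms from x S(f) and f Omega wedge with S(f)
  into f times the maximal ideal. If all pairs from G did so too, all pairs from S(f) would,
  contradicting freeness.
*)

theory Submission
  imports Defs "HOL-Complex_Analysis.Laurent_Convergence"
begin

unbundle no vec_syntax

section \<open>Substitution of power series\<close>

text \<open>All divisions have to stay inside convergent series, and neither Weierstrass preparation
  nor Noetherian arguments are used. One device takes their place. On the slice x = 0 the germs form
  a discrete valuation ring in y, so an element of least order there divides the others modulo x.
  Since x(t) is not 0, the factor x can be cancelled from the remainder and the division repeated.
  The x-adic limit of the quotients converges, because the recursion for a quotient by a series with
  nonzero slice obeys a geometric bound. This device gives both the generator of the kernel and the
  free basis of S(f). The conductor is explicit: for a parameter with x = t^m it is the product of
  Y(t) - Y(zt) over the m-th roots of unity z other than 1, the factor that clears the denominators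
  of Lagrange interpolation. Nakayama's lemma is replaced by the alternating pairing wedge / f at
  the origin. Accordingly, that G generates S(f) comes last, from a basis found inside G.\<close>

lemma X_power_dvd_iff: "fps_X ^ N dvd (p :: 'a::comm_ring_1 fps) \<longleftrightarrow> (\<forall>m<N. p $ m = 0)"
proof
  assume "fps_X ^ N dvd p"
  then show "\<forall>m<N. p $ m = 0" by (auto simp: dvd_def fps_X_power_mult_nth)
next
  assume "\<forall>m<N. p $ m = 0"
  then have "p = fps_X ^ N * fps_shift N p"
    by (intro fps_ext) (auto simp: fps_X_power_mult_nth)
  then show "fps_X ^ N dvd p" by (metis dvd_triv_left)
qed

lemma X_dvd_iff: "fps_X dvd (p :: 'a::comm_ring_1 fps) \<longleftrightarrow> p $ 0 = 0"
  using X_power_dvd_iff[of 1 p] by simp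

lemma power_nth_eq_0:
  assumes "(p :: 'a::comm_ring_1 fps) $ 0 = 0" "n < i"
  shows "(r * p ^ i) $ n = 0"
proof -
  have "fps_X ^ i dvd r * p ^ i"
    using assms(1) by (intro dvd_mult dvd_power_same) (simp add: X_dvd_iff)
  with assms(2) show ?thesis by (simp add: X_power_dvd_iff)
qed

lemma fps_mult_nth_cong:
  assumes "\<And>m. m \<le> n \<Longrightarrow> p $ m = p' $ m" "\<And>m. m \<le> n \<Longrightarrow> q $ m = q' $ m"
  shows "(p * q) $ n = (p' * q') $ n"
  using assms by (auto simp: fps_mult_nth intro!: sum.cong)

text \<open>The coefficients of K are series in t, and the outer variable is replaced by x(t). When
  x has no constant term, powers beyond n do not reach coefficient n.\<close>

definition fps_eval_outer :: "complex fps \<Rightarrow> complex fps fps \<Rightarrow> complex fps" where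
  "fps_eval_outer x K = Abs_fps (\<lambda>n. \<Sum>i\<le>n. (K $ i * x ^ i) $ n)"

lemma fps_eval_outer_nth:
  assumes "x $ 0 = 0" "n \<le> M"
  shows "fps_eval_outer x K $ n = (\<Sum>i\<le>M. K $ i * x ^ i) $ n"
proof -
  have "(\<Sum>i\<le>n. (K $ i * x ^ i) $ n) = (\<Sum>i\<le>M. (K $ i * x ^ i) $ n)"
    using assms by (intro sum.mono_neutral_left) (auto intro!: power_nth_eq_0)
  then show ?thesis by (simp add: fps_eval_outer_def fps_sum_nth)
qed

lemma fps_eval_outer_mult:
  assumes x: "x $ 0 = 0"
  shows "fps_eval_outer x (K * L) = fps_eval_outer x K * fps_eval_outer x L"
proof (rule fps_ext)
  fix n
  let ?t = "\<lambda>i j. (K $ i * L $ j * x ^ (i + j)) $ n"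
  have "(fps_eval_outer x K * fps_eval_outer x L) $ n
      = ((\<Sum>i\<le>n. K $ i * x ^ i) * (\<Sum>j\<le>n. L $ j * x ^ j)) $ n"
    by (intro fps_mult_nth_cong fps_eval_outer_nth x)
  also have "\<dots> = (\<Sum>i\<le>n. \<Sum>j\<le>n. ?t i j)"
    by (simp add: sum_product fps_sum_nth power_add mult_ac)
  also have "\<dots> = (\<Sum>(i, j)\<in>{..n} \<times> {..n}. ?t i j)"
    by (simp add: sum.cartesian_product)
  \<comment> \<open>Pairs with i + j > n drop out because x has no constant term; this turns the
    square of indices into the triangle of the Cauchy product.\<close>
  also have "\<dots> = (\<Sum>(i, j)\<in>{(i, j). i + j \<le> n}. ?t i j)"
    by (intro sum.mono_neutral_right) (auto intro!: power_nth_eq_0 x)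
  also have "\<dots> = (\<Sum>k\<le>n. \<Sum>i\<le>k. ?t i (k - i))"
    by (rule sum.triangle_reindex_eq)
  also have "\<dots> = (\<Sum>k\<le>n. ((K * L) $ k * x ^ k) $ n)"
    by (intro sum.cong refl) (simp add: fps_mult_nth[of K L] sum_distrib_right fps_sum_nth atLeast0AtMost)
  finally show "fps_eval_outer x (K * L) $ n = (fps_eval_outer x K * fps_eval_outer x L) $ n"
    by (simp add: fps_eval_outer_def)
qed

lemma fps_eval_outer_deriv:
  assumes x: "x $ 0 = 0"
  shows "fps_deriv (fps_eval_outer x K)
       = fps_eval_outer x (Abs_fps (\<lambda>i. fps_deriv (K $ i))) + fps_eval_outer x (fps_deriv K) * fps_deriv x"
proof (rule fps_ext)
  fix n
  \<comment> \<open>Coefficient n of a derivative needs coefficient n + 1, hence the truncation at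
    \<open>Suc n\<close>.\<close>
  let ?S = "\<Sum>i\<le>Suc n. K $ i * x ^ i"
  have "fps_deriv (fps_eval_outer x K) $ n = fps_deriv ?S $ n"
    using fps_eval_outer_nth[OF x, of "n + 1" "Suc n" K] by (simp del: sum.atMost_Suc)
  also have "fps_deriv ?S = (\<Sum>i\<le>Suc n. fps_deriv (K $ i) * x ^ i)
      + (\<Sum>i\<le>Suc n. of_nat i * K $ i * x ^ (i - 1)) * fps_deriv x"
  proof -
    have "fps_deriv (K $ i * x ^ i) = fps_deriv (K $ i) * x ^ i + of_nat i * K $ i * x ^ (i - 1) * fps_deriv x" for i
      by (simp add: fps_deriv_power algebra_simps fps_of_nat)
    then show ?thesis by (simp only: fps_deriv_sum sum.distrib sum_distrib_right)
  qed
  also have "(\<Sum>i\<le>Suc n. of_nat i * K $ i * x ^ (i - 1)) = (\<Sum>i\<le>n. fps_deriv K $ i * x ^ i)"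
    by (subst sum.atMost_Suc_shift) (simp add: algebra_simps)
  also have "((\<Sum>i\<le>Suc n. fps_deriv (K $ i) * x ^ i) + (\<Sum>i\<le>n. fps_deriv K $ i * x ^ i) * fps_deriv x) $ n
    = (fps_eval_outer x (Abs_fps (\<lambda>i. fps_deriv (K $ i))) + fps_eval_outer x (fps_deriv K) * fps_deriv x) $ n"
    using fps_eval_outer_nth[OF x, of n "Suc n" "Abs_fps (\<lambda>i. fps_deriv (K $ i))"]
      fps_mult_nth_cong[of n "fps_eval_outer x (fps_deriv K)" "\<Sum>i\<le>n. fps_deriv K $ i * x ^ i" "fps_deriv x" "fps_deriv x"]
      fps_eval_outer_nth[OF x, of _ n "fps_deriv K"]
    by simp
  finally show "fps_deriv (fps_eval_outer x K) $ n
    = (fps_eval_outer x (Abs_fps (\<lambda>i. fps_deriv (K $ i))) + fps_eval_outer x (fps_deriv K) * fps_deriv x) $ n" .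
qed

section \<open>The pullback as a ring homomorphism that obeys the chain rule\<close>

definition centered :: "param \<Rightarrow> bool" where
  "centered \<phi> \<longleftrightarrow> fst \<phi> $ 0 = 0 \<and> snd \<phi> $ 0 = 0"

text \<open>Larger bounds only add zero terms. The freedom is needed for the coordinate germs, whose
  exponent 1 lies outside the defining range when n = 0, and to use one bound for all coefficients
  up to n.\<close>

lemma pullback_nth:
  assumes "centered \<phi>" "n \<le> M" "n \<le> L"
  shows "pullback \<phi> h $ n = (\<Sum>i\<le>M. \<Sum>j\<le>L. coeff2 h i j * (fst \<phi> ^ i * snd \<phi> ^ j) $ n)"
proof -
  let ?t = "\<lambda>i j. coeff2 h i j * (fst \<phi> ^ i * snd \<phi> ^ j) $ n"
  have z: "(fst \<phi> ^ i * snd \<phi> ^ j) $ n = 0" if "n < i \<or> n < j" for i j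
    using that assms(1) power_nth_eq_0[of "snd \<phi>" n j "fst \<phi> ^ i"] power_nth_eq_0[of "fst \<phi>" n i "snd \<phi> ^ j"]
    by (auto simp: centered_def mult.commute)
  have "(\<Sum>i\<le>n. \<Sum>j\<le>n. ?t i j) = (\<Sum>i\<le>M. \<Sum>j\<le>n. ?t i j)"
    using assms by (intro sum.mono_neutral_left) (auto simp: z)
  also have "\<dots> = (\<Sum>i\<le>M. \<Sum>j\<le>L. ?t i j)"
    using assms by (intro sum.cong refl sum.mono_neutral_left) (auto simp: z)
  finally show ?thesis by (simp add: pullback_def)
qed

text \<open>Splits the double sum: y(t) is composed into each slice, then x(t) is substituted for
  the outer variable. Multiplicativity and the chain rule thereby reduce to substitutions in one
  variable.\<close>

lemma pullback_eq_eval_outer: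
  assumes "centered \<phi>"
  shows "pullback \<phi> h = fps_eval_outer (fst \<phi>) (Abs_fps (\<lambda>i. fps_of_germ h $ i oo snd \<phi>))"
proof (rule fps_ext)
  fix n
  have "((fps_of_germ h $ i oo snd \<phi>) * fst \<phi> ^ i) $ n
      = (\<Sum>j\<le>n. coeff2 h i j * (fst \<phi> ^ i * snd \<phi> ^ j) $ n)" for i
  proof -
    have "(fps_of_germ h $ i oo snd \<phi>) $ m = (\<Sum>j\<le>n. fps_const (coeff2 h i j) * snd \<phi> ^ j) $ m" if "m \<le> n" for m
    proof -
      have "(\<Sum>j=0..m. coeff2 h i j * (snd \<phi> ^ j) $ m) = (\<Sum>j\<le>n. coeff2 h i j * (snd \<phi> ^ j) $ m)"
        using that assms power_nth_eq_0[of "snd \<phi>" m _ 1]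
        by (intro sum.mono_neutral_left) (auto simp: centered_def)
      then show ?thesis by (simp add: fps_compose_nth coeff2.rep_eq fps_sum_nth)
    qed
    then have "((fps_of_germ h $ i oo snd \<phi>) * fst \<phi> ^ i) $ n
        = ((\<Sum>j\<le>n. fps_const (coeff2 h i j) * snd \<phi> ^ j) * fst \<phi> ^ i) $ n"
      by (intro fps_mult_nth_cong) auto
    then show ?thesis by (simp add: sum_distrib_right fps_sum_nth mult.assoc mult.commute[of "fst \<phi> ^ i"])
  qed
  then show "pullback \<phi> h $ n = fps_eval_outer (fst \<phi>) (Abs_fps (\<lambda>i. fps_of_germ h $ i oo snd \<phi>)) $ n"
    by (simp add: pullback_def fps_eval_outer_def)
qed

lemma pullback_add: "pullback \<phi> (h + k) = pullback \<phi> h + pullback \<phi> k"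
  by (rule fps_ext)
    (simp add: pullback_def coeff2.rep_eq plus_germ.rep_eq distrib_right sum.distrib)

lemma pullback_uminus: "pullback \<phi> (- h) = - pullback \<phi> h"
  by (rule fps_ext) (simp add: pullback_def coeff2.rep_eq uminus_germ.rep_eq sum_negf)

lemma pullback_diff: "pullback \<phi> (h - k) = pullback \<phi> h - pullback \<phi> k"
  using pullback_add[of \<phi> h "- k"] by (simp add: pullback_uminus)

lemma pullback_mult:
  assumes "centered \<phi>"
  shows "pullback \<phi> (h * k) = pullback \<phi> h * pullback \<phi> k"
proof -
  have "Abs_fps (\<lambda>i. fps_of_germ (h * k) $ i oo snd \<phi>)
      = Abs_fps (\<lambda>i. fps_of_germ h $ i oo snd \<phi>) * Abs_fps (\<lambda>i. fps_of_germ k $ i oo snd \<phi>)"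
    using assms by (intro fps_ext[where 'a = "complex fps"])
      (simp add: times_germ.rep_eq fps_mult_nth[of "fps_of_germ h"] fps_compose_sum_distrib
        fps_compose_mult_distrib centered_def fps_mult_nth[of "Abs_fps (\<lambda>i. fps_of_germ h $ i oo snd \<phi>)"])
  then show ?thesis
    using assms by (simp add: pullback_eq_eval_outer fps_eval_outer_mult centered_def)
qed

lemma pullback_deriv:
  assumes "centered \<phi>"
  shows "fps_deriv (pullback \<phi> h)
       = pullback \<phi> (partial_x h) * fps_deriv (fst \<phi>) + pullback \<phi> (partial_y h) * fps_deriv (snd \<phi>)"
proof -
  have 1: "Abs_fps (\<lambda>i. fps_of_germ (partial_x h) $ i oo snd \<phi>) = fps_deriv (Abs_fps (\<lambda>i. fps_of_germ h $ i oo snd \<phi>))"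
  proof (rule fps_ext[where 'a = "complex fps"])
    fix i
    have "(of_nat (Suc i) :: complex fps) oo snd \<phi> = of_nat (Suc i)"
      by (metis fps_const_compose fps_of_nat)
    then show "Abs_fps (\<lambda>i. fps_of_germ (partial_x h) $ i oo snd \<phi>) $ i
        = fps_deriv (Abs_fps (\<lambda>i. fps_of_germ h $ i oo snd \<phi>)) $ i"
      using assms by (simp add: partial_x.rep_eq fps_compose_mult_distrib centered_def del: of_nat_Suc)
  qed
  have 2: "Abs_fps (\<lambda>i. fps_deriv (fps_of_germ h $ i oo snd \<phi>))
     = Abs_fps (\<lambda>i. fps_of_germ (partial_y h) $ i oo snd \<phi>) * fps_const (fps_deriv (snd \<phi>))"
    using assms by (intro fps_ext[where 'a = "complex fps"])
      (simp add: partial_y.rep_eq fps_compose_deriv centered_def)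
  have 3: "fps_eval_outer (fst \<phi>) (fps_const c) = c" for c
  proof (rule fps_ext)
    show "fps_eval_outer (fst \<phi>) (fps_const c) $ n = c $ n" for n
      using assms fps_eval_outer_nth[of "fst \<phi>" n n "fps_const c"]
        sum.mono_neutral_right[of "{..n}" "{0}" "\<lambda>i. fps_const c $ i * fst \<phi> ^ i"]
      by (simp add: centered_def)
  qed
  show ?thesis
    using assms by (simp add: pullback_eq_eval_outer fps_eval_outer_deriv fps_eval_outer_mult centered_def 1 2 3)
qed

lemma pullback_const: "pullback \<phi> (germ_const c) = fps_const c"
proof (rule fps_ext)
  fix n
  have "pullback \<phi> (germ_const c) $ n = (\<Sum>i\<le>n. \<Sum>j\<le>n. if j = 0 then if i = 0 then c * 1 $ n else 0 else 0)"
    unfolding pullback_def fps_nth_Abs_fps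
    by (intro sum.cong refl) (auto simp: coeff2.rep_eq germ_const.rep_eq)
  then show "pullback \<phi> (germ_const c) $ n = fps_const c $ n" by simp
qed

lemma pullback_0 [simp]: "pullback \<phi> 0 = 0"
  by (rule fps_ext) (simp add: pullback_def coeff2.rep_eq zero_germ.rep_eq)

lemma germ_const_1: "germ_const 1 = 1"
  by transfer simp

lemma pullback_1 [simp]: "pullback \<phi> 1 = 1"
  using pullback_const[of \<phi> 1] by (simp add: germ_const_1)

lemma pullback_power: "centered \<phi> \<Longrightarrow> pullback \<phi> (h ^ n) = pullback \<phi> h ^ n"
  by (induction n) (simp_all add: pullback_mult)

lemma pullback_prod: "centered \<phi> \<Longrightarrow> pullback \<phi> (\<Prod>i\<in>A. h i) = (\<Prod>i\<in>A. pullback \<phi> (h i))"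
  by (induction A rule: infinite_finite_induct) (simp_all add: pullback_mult)

lemma pullback_x:
  assumes "centered \<phi>"
  shows "pullback \<phi> germ_x = fst \<phi>"
proof (rule fps_ext)
  fix n
  have "coeff2 germ_x i j * r = (if j = 0 then if i = 1 then r else 0 else 0)" for i j r
    by (simp add: coeff2.rep_eq germ_x.rep_eq fps_X_def)
  then have "pullback \<phi> germ_x $ n = (\<Sum>i\<le>Suc n. if i = 1 then (fst \<phi> ^ i * snd \<phi> ^ 0) $ n else 0)"
    using assms by (subst pullback_nth[of _ n "Suc n" "Suc n"]) (simp_all del: sum.atMost_Suc)
  then show "pullback \<phi> germ_x $ n = fst \<phi> $ n" by (simp del: sum.atMost_Suc)
qed

lemma pullback_y:
  assumes "centered \<phi>"
  shows "pullback \<phi> germ_y = snd \<phi>"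
proof (rule fps_ext)
  fix n
  have "coeff2 germ_y i j * r = (if j = 1 then if i = 0 then r else 0 else 0)" for i j r
    by (simp add: coeff2.rep_eq germ_y.rep_eq fps_X_def)
  then have "pullback \<phi> germ_y $ n = (\<Sum>i\<le>Suc n. if i = 0 then (fst \<phi> ^ i * snd \<phi> ^ 1) $ n else 0)"
    using assms by (subst pullback_nth[of _ n "Suc n" "Suc n"]) (simp_all del: sum.atMost_Suc)
  then show "pullback \<phi> germ_y $ n = snd \<phi> $ n" by (simp del: sum.atMost_Suc)
qed

section \<open>Weighted norms and convergence\<close>

text \<open>For \<rho> >= 0 this bounds the weighted l1 norm of radius \<rho>. Bounding partial sums
  keeps summability out of the arguments.\<close>

definition norm_bound :: "real \<Rightarrow> complex fps \<Rightarrow> real \<Rightarrow> bool" where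
  "norm_bound \<rho> p C \<longleftrightarrow> (\<forall>n. (\<Sum>j\<le>n. norm (p $ j) * \<rho> ^ j) \<le> C)"

lemma norm_bound_nonneg: "norm_bound \<rho> p C \<Longrightarrow> C \<ge> 0"
  by (drule norm_bound_def[THEN iffD1], drule spec[of _ 0]) (use norm_ge_zero[of "p $ 0"] in \<open>simp del: norm_ge_zero\<close>)

lemma norm_bound_0 [simp]: "norm_bound \<rho> 0 0"
  by (simp add: norm_bound_def)

lemma norm_bound_1 [simp]: "norm_bound \<rho> 1 1"
  by (simp add: norm_bound_def sum.atMost_shift)

lemma norm_bound_mono: "norm_bound \<rho> p C \<Longrightarrow> C \<le> D \<Longrightarrow> norm_bound \<rho> p D"
  unfolding norm_bound_def by (meson order_trans)

lemma norm_bound_add: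
  assumes "\<rho> \<ge> 0" "norm_bound \<rho> p C" "norm_bound \<rho> q D"
  shows "norm_bound \<rho> (p + q) (C + D)"
  unfolding norm_bound_def
proof
  fix n
  have "(\<Sum>j\<le>n. norm ((p + q) $ j) * \<rho> ^ j) \<le> (\<Sum>j\<le>n. norm (p $ j) * \<rho> ^ j + norm (q $ j) * \<rho> ^ j)"
    using assms(1) by (intro sum_mono) (simp add: norm_triangle_ineq mult_right_mono flip: distrib_right)
  also have "\<dots> \<le> C + D"
    using assms(2,3) by (simp add: sum.distrib norm_bound_def add_mono)
  finally show "(\<Sum>j\<le>n. norm ((p + q) $ j) * \<rho> ^ j) \<le> C + D" .
qed

lemma norm_bound_uminus [simp]: "norm_bound \<rho> (- p) C \<longleftrightarrow> norm_bound \<rho> p C"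
  by (simp add: norm_bound_def)

lemma norm_bound_sum:
  assumes "\<rho> \<ge> 0" "\<And>i. i \<in> A \<Longrightarrow> norm_bound \<rho> (p i) (C i)"
  shows "norm_bound \<rho> (\<Sum>i\<in>A. p i) (\<Sum>i\<in>A. C i)"
  using assms(2) by (induction A rule: infinite_finite_induct) (simp_all add: norm_bound_add assms(1))

text \<open>The Cauchy product sums over a triangle of nonnegative terms; the enclosing square
  factors.\<close>

lemma norm_bound_mult:
  assumes "\<rho> \<ge> 0" "norm_bound \<rho> p C" "norm_bound \<rho> q D"
  shows "norm_bound \<rho> (p * q) (C * D)"
  unfolding norm_bound_def
proof
  fix n
  let ?p = "\<lambda>j. norm (p $ j) * \<rho> ^ j" and ?q = "\<lambda>j. norm (q $ j) * \<rho> ^ j"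
  have "(\<Sum>j\<le>n. norm ((p * q) $ j) * \<rho> ^ j) \<le> (\<Sum>j\<le>n. \<Sum>i\<le>j. ?p i * ?q (j - i))"
  proof (intro sum_mono)
    fix j
    have "norm ((p * q) $ j) * \<rho> ^ j \<le> (\<Sum>i=0..j. norm (p $ i * q $ (j - i))) * \<rho> ^ j"
      using assms(1) by (intro mult_right_mono) (auto simp: fps_mult_nth intro: norm_sum)
    also have "\<dots> = (\<Sum>i\<le>j. ?p i * ?q (j - i))"
      unfolding sum_distrib_right atLeast0AtMost
      by (intro sum.cong refl) (simp add: norm_mult power_add[symmetric] mult_ac)
    finally show "norm ((p * q) $ j) * \<rho> ^ j \<le> (\<Sum>i\<le>j. ?p i * ?q (j - i))" .
  qed
  also have "\<dots> = (\<Sum>(i, j)\<in>{(i, j). i + j \<le> n}. ?p i * ?q j)"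
    by (rule sum.triangle_reindex_eq[symmetric])
  also have "\<dots> \<le> (\<Sum>(i, j)\<in>{..n} \<times> {..n}. ?p i * ?q j)"
    using assms(1) by (intro sum_mono2) auto
  also have "\<dots> = (\<Sum>i\<le>n. ?p i) * (\<Sum>j\<le>n. ?q j)"
    by (simp add: sum_product sum.cartesian_product)
  also have "\<dots> \<le> C * D"
    using assms norm_bound_nonneg[OF assms(2)]
    by (intro mult_mono) (auto simp: norm_bound_def intro!: sum_nonneg)
  finally show "(\<Sum>j\<le>n. norm ((p * q) $ j) * \<rho> ^ j) \<le> C * D" .
qed

lemma norm_bound_power:
  assumes "\<rho> \<ge> 0" "norm_bound \<rho> p C"
  shows "norm_bound \<rho> (p ^ n) (C ^ n)"
  by (induction n) (simp_all add: norm_bound_mult assms)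

text \<open>Dividing by a power of the variable costs a constant factor, which is the price of each
  step in the quotient recursion.\<close>

lemma norm_bound_shift:
  assumes "\<rho> > 0" "norm_bound \<rho> p C"
  shows "norm_bound \<rho> (fps_shift e p) (C / \<rho> ^ e)"
  unfolding norm_bound_def
proof
  fix n
  have "(\<Sum>j\<le>n. norm (p $ (j + e)) * \<rho> ^ (j + e)) = (\<Sum>j\<in>(\<lambda>j. j + e) ` {..n}. norm (p $ j) * \<rho> ^ j)"
    by (subst sum.reindex) auto
  also have "\<dots> \<le> (\<Sum>j\<le>n + e. norm (p $ j) * \<rho> ^ j)"
    using assms(1) by (intro sum_mono2) auto
  also have "\<dots> \<le> C" using assms(2) by (simp add: norm_bound_def)
  finally have "(\<Sum>j\<le>n. norm (fps_shift e p $ j) * \<rho> ^ j) * \<rho> ^ e \<le> C"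
    by (simp add: sum_distrib_right power_add mult.assoc)
  then show "(\<Sum>j\<le>n. norm (fps_shift e p $ j) * \<rho> ^ j) \<le> C / \<rho> ^ e"
    using assms(1) by (simp add: field_simps)
qed

lemma norm_bound_nth:
  assumes "\<rho> > 0" "norm_bound \<rho> p C"
  shows "norm (p $ n) \<le> C * (1 / \<rho>) ^ n"
proof -
  have "norm (p $ n) * \<rho> ^ n \<le> (\<Sum>j\<le>n. norm (p $ j) * \<rho> ^ j)"
    using assms(1) by (intro member_le_sum) auto
  also have "\<dots> \<le> C" using assms(2) by (simp add: norm_bound_def)
  finally show ?thesis using assms(1) by (simp add: field_simps power_divide)
qed

lemma half_geometric: "(\<Sum>j\<le>n. (1 / 2 :: real) ^ j) = 2 - (1 / 2) ^ n"
  by (induction n) auto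

lemma norm_bound_geometric:
  assumes "\<rho> \<ge> 0" "R \<ge> 0" "R * \<rho> \<le> 1 / 2" "C \<ge> 0" "\<And>n. norm (p $ n) \<le> C * R ^ n"
  shows "norm_bound \<rho> p (2 * C)"
  unfolding norm_bound_def
proof
  fix n
  have "(\<Sum>j\<le>n. norm (p $ j) * \<rho> ^ j) \<le> (\<Sum>j\<le>n. C * (1 / 2) ^ j)"
  proof (intro sum_mono)
    fix j
    have "norm (p $ j) * \<rho> ^ j \<le> (C * R ^ j) * \<rho> ^ j"
      using assms by (intro mult_right_mono) auto
    also have "\<dots> = C * (R * \<rho>) ^ j" by (simp add: power_mult_distrib)
    also have "\<dots> \<le> C * (1 / 2) ^ j"
      using assms by (intro mult_left_mono power_mono) auto
    finally show "norm (p $ j) * \<rho> ^ j \<le> C * (1 / 2) ^ j" .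
  qed
  also have "\<dots> = C * (2 - (1 / 2) ^ n)"
    by (simp add: half_geometric flip: sum_distrib_left)
  also have "\<dots> \<le> 2 * C" using assms(4) by (simp add: algebra_simps)
  finally show "(\<Sum>j\<le>n. norm (p $ j) * \<rho> ^ j) \<le> 2 * C" .
qed

text \<open>Without a constant term the norm carries a factor \<rho> and can be made as small as
  desired, which makes substitution converge.\<close>

lemma norm_bound_small:
  assumes "\<rho> \<ge> 0" "R \<ge> 0" "R * \<rho> \<le> 1 / 2" "C \<ge> 0" "\<And>n. norm (p $ n) \<le> C * R ^ n" "p $ 0 = 0"
  shows "norm_bound \<rho> p (\<rho> * (2 * (C * R)))"
proof -
  have "norm_bound \<rho> (fps_shift 1 p) (2 * (C * R))"
  proof (rule norm_bound_geometric[OF assms(1-3)])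
    show "norm (fps_shift 1 p $ n) \<le> C * R * R ^ n" for n
      using assms(5)[of "n + 1"] by (simp add: mult_ac)
  qed (use assms in auto)
  moreover have "(\<Sum>j\<le>n. norm (p $ j) * \<rho> ^ j) \<le> \<rho> * (\<Sum>j\<le>n. norm (fps_shift 1 p $ j) * \<rho> ^ j)" for n
  proof -
    have "(\<Sum>j\<le>n. norm (p $ j) * \<rho> ^ j) \<le> (\<Sum>j\<le>Suc n. norm (p $ j) * \<rho> ^ j)"
      using assms(1) by simp
    also have "\<dots> = \<rho> * (\<Sum>j\<le>n. norm (fps_shift 1 p $ j) * \<rho> ^ j)"
      by (subst sum.atMost_Suc_shift) (simp add: assms(6) sum_distrib_left mult_ac)
    finally show ?thesis .
  qed
  ultimately show ?thesis
    unfolding norm_bound_def using assms(1) by (meson order_trans mult_left_mono)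
qed

section \<open>Convergence expressed by geometric bounds\<close>

lemma fps_conv_radius_pos_iff:
  fixes p :: "complex fps"
  shows "fps_conv_radius p > 0 \<longleftrightarrow> (\<exists>C\<ge>0. \<exists>R\<ge>1. \<forall>n. norm (p $ n) \<le> C * R ^ n)"
proof
  assume "fps_conv_radius p > 0"
  then obtain r where r: "r > 0" "ereal r < fps_conv_radius p"
    using ereal_dense2 by (force simp: zero_ereal_def)
  have "summable (\<lambda>n. norm (p $ n * of_real r ^ n))"
    using r by (intro norm_summable_fps) auto
  then have "Bseq (\<lambda>n. norm (p $ n * of_real r ^ n))"
    by (intro convergent_imp_Bseq) (metis convergentI summable_LIMSEQ_zero)
  then obtain C where C: "C > 0" "\<And>n. norm (p $ n) * r ^ n \<le> C"
    using r by (auto simp: Bseq_def norm_mult norm_power)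
  have "norm (p $ n) \<le> C * (max 1 (1 / r)) ^ n" for n
  proof -
    have "norm (p $ n) \<le> C * (1 / r) ^ n"
      using C(2)[of n] r by (simp add: field_simps power_divide)
    also have "\<dots> \<le> C * (max 1 (1 / r)) ^ n"
      using C r by (intro mult_left_mono power_mono) auto
    finally show ?thesis .
  qed
  then show "\<exists>C\<ge>0. \<exists>R\<ge>1. \<forall>n. norm (p $ n) \<le> C * R ^ n"
    using C by (intro exI[of _ C] conjI exI[of _ "max 1 (1 / r)"]) auto
next
  assume "\<exists>C\<ge>0. \<exists>R\<ge>1. \<forall>n. norm (p $ n) \<le> C * R ^ n"
  then obtain C R where CR: "C \<ge> 0" "R \<ge> 1" "\<And>n. norm (p $ n) \<le> C * R ^ n"
    by blast
  define z :: complex where "z = of_real (1 / (2 * R))"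
  have "summable (\<lambda>n. p $ n * z ^ n)"
  proof (rule summable_comparison_test')
    show "summable (\<lambda>n. C * (1 / 2 :: real) ^ n)" by (intro summable_mult summable_geometric) auto
    show "norm (p $ n * z ^ n) \<le> C * (1 / 2) ^ n" for n
    proof -
      have "norm (p $ n * z ^ n) = norm (p $ n) * (1 / (2 * R)) ^ n"
        using CR by (simp add: z_def norm_mult norm_power norm_divide)
      also have "\<dots> \<le> (C * R ^ n) * (1 / (2 * R)) ^ n"
        using CR by (intro mult_right_mono) auto
      also have "\<dots> = C * (1 / 2) ^ n"
        using CR by (simp add: power_divide power_mult_distrib)
      finally show ?thesis .
    qed
  qed
  then have "ereal (norm z) \<le> fps_conv_radius p"
    unfolding fps_conv_radius_def by (rule conv_radius_geI)
  moreover have "norm z > 0" using CR by (simp add: z_def norm_divide)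
  ultimately show "fps_conv_radius p > 0"
    by (metis ereal_less(2) less_le_trans)
qed

lemma fps_conv_radius_posE:
  fixes p :: "complex fps"
  assumes "fps_conv_radius p > 0"
  obtains C R where "C \<ge> 0" "R \<ge> 1" "\<And>n. norm (p $ n) \<le> C * R ^ n"
  using assms unfolding fps_conv_radius_pos_iff by blast

lemma fps_conv_radius_posI:
  fixes p :: "complex fps"
  assumes "C \<ge> 0" "R \<ge> 1" "\<And>n. norm (p $ n) \<le> C * R ^ n"
  shows "fps_conv_radius p > 0"
  using assms unfolding fps_conv_radius_pos_iff by blast

text \<open>In this form, with one fixed norm for all slices, convergence can be proved by induction
  on the exponent of the outer variable.\<close>

lemma convergent2I_slices:
  assumes "\<rho> > 0" "S \<ge> 0" "C \<ge> 0" "\<And>i. norm_bound \<rho> (H $ i) (C * S ^ i)"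
  shows "convergent2 H"
proof (rule convergent2I[of C "max 1 (max S (1 / \<rho>))"])
  fix i j
  let ?M = "max 1 (max S (1 / \<rho>))"
  have "norm (H $ i $ j) \<le> C * S ^ i * (1 / \<rho>) ^ j"
    by (rule norm_bound_nth[OF assms(1) assms(4)])
  also have "\<dots> \<le> C * ?M ^ i * ?M ^ j"
    using assms by (intro mult_mono power_mono) auto
  finally show "norm (H $ i $ j) \<le> C * ?M ^ (i + j)"
    by (simp add: power_add mult.assoc)
qed (use assms in auto)

lemma convergent2_slicesE:
  assumes "convergent2 H"
  obtains C R where "C \<ge> 0" "R \<ge> 1"
    "\<And>\<rho> i. 0 \<le> \<rho> \<Longrightarrow> R * \<rho> \<le> 1 / 2 \<Longrightarrow> norm_bound \<rho> (H $ i) (C * R ^ i)"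
proof -
  obtain C R where CR: "C \<ge> 0" "R \<ge> 1" "\<And>i j. norm (H $ i $ j) \<le> C * R ^ (i + j)"
    by (rule convergent2E[OF assms]) blast
  have "norm_bound \<rho> (H $ i) (2 * C * R ^ i)" if "0 \<le> \<rho>" "R * \<rho> \<le> 1 / 2" for \<rho> i
  proof -
    have "norm (H $ i $ n) \<le> C * R ^ i * R ^ n" for n
      using CR(3)[of i n] by (simp add: power_add mult_ac)
    then show ?thesis
      using norm_bound_geometric[of \<rho> R "C * R ^ i" "H $ i"] that CR by (simp add: mult_ac)
  qed
  with CR show ?thesis by (intro that[of "2 * C" R]) auto
qed

lemma fps_conv_radius_slice:
  assumes "convergent2 H"
  shows "fps_conv_radius (H $ i) > 0"
proof -
  obtain C R where CR: "C \<ge> 0" "R \<ge> 1" "\<And>i j. norm (H $ i $ j) \<le> C * R ^ (i + j)"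
    by (rule convergent2E[OF assms]) blast
  then show ?thesis
    by (intro fps_conv_radius_posI[of "C * R ^ i" R]) (auto simp: power_add mult.assoc)
qed

text \<open>Comparing coefficients of x^i expresses q_i W_0 by (qW)_i and the earlier q_k. As W_0 is
  y^e times a unit, solving for q_i multiplies norms by a constant at most, so a geometric bound
  propagates.\<close>

lemma convergent2_quotient:
  assumes "convergent2 (q * W)" "convergent2 W" "W $ 0 \<noteq> 0"
  shows "convergent2 q"
proof -
  define e where "e = subdegree (W $ 0)"
  define w where "w = inverse (fps_shift e (W $ 0))"
  have w0: "fps_shift e (W $ 0) $ 0 \<noteq> 0"
    using assms(3) by (simp add: e_def)
  have W0: "W $ 0 = fps_shift e (W $ 0) * fps_X ^ e"
    unfolding e_def by (rule subdegree_decompose)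
  have rec: "q $ i = fps_shift e (w * ((q * W) $ i - (\<Sum>k<i. q $ k * W $ (i - k))))" for i
  proof -
    have "(q * W) $ i = (\<Sum>k\<le>i. q $ k * W $ (i - k))" by (simp add: fps_mult_nth atLeast0AtMost)
    then have "(q * W) $ i - (\<Sum>k<i. q $ k * W $ (i - k)) = q $ i * W $ 0"
      by (simp flip: lessThan_Suc_atMost)
    then have "w * ((q * W) $ i - (\<Sum>k<i. q $ k * W $ (i - k))) = q $ i * fps_X ^ e"
      using inverse_mult_eq_1[OF w0] by (subst (asm) W0) (simp add: w_def mult_ac)
    then show ?thesis by simp
  qed
  have "fps_conv_radius w > 0"
    unfolding w_def using w0 fps_conv_radius_slice[OF assms(2), of 0]
    by (intro fps_conv_radius_inverse_pos) auto
  then obtain D T where D: "D \<ge> 0" "T \<ge> 1" "\<And>n. norm (w $ n) \<le> D * T ^ n"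
    by (rule fps_conv_radius_posE) blast
  obtain C1 R1 where 1: "C1 \<ge> 0" "R1 \<ge> 1"
    "\<And>\<rho> i. 0 \<le> \<rho> \<Longrightarrow> R1 * \<rho> \<le> 1 / 2 \<Longrightarrow> norm_bound \<rho> ((q * W) $ i) (C1 * R1 ^ i)"
    by (rule convergent2_slicesE[OF assms(1)]) blast
  obtain C2 R2 where 2: "C2 \<ge> 0" "R2 \<ge> 1"
    "\<And>\<rho> i. 0 \<le> \<rho> \<Longrightarrow> R2 * \<rho> \<le> 1 / 2 \<Longrightarrow> norm_bound \<rho> (W $ i) (C2 * R2 ^ i)"
    by (rule convergent2_slicesE[OF assms(2)]) blast
  \<comment> \<open>The radius has to suit the geometric bounds of \<open>w\<close>,
    \<open>q * W\<close> and \<open>W\<close> at once.\<close>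
  define \<rho> where "\<rho> = 1 / (2 * (T * R1 * R2))"
  have ge: "T * R1 * R2 \<ge> T" "T * R1 * R2 \<ge> R1" "T * R1 * R2 \<ge> R2"
    using D 1 2 mult_mono[of 1 "T * R1" 1 R2] mult_mono[of 1 T 1 R1] mult_mono[of T T 1 "R1 * R2"]
      mult_mono[of 1 "T * R2" R1 R1] mult_mono[of 1 "T * R1" R2 R2] mult_mono[of 1 T 1 R2] mult_mono[of 1 R1 1 R2]
    by (auto simp: mult_ac)
  have \<rho>: "\<rho> > 0" "T * \<rho> \<le> 1 / 2" "R1 * \<rho> \<le> 1 / 2" "R2 * \<rho> \<le> 1 / 2"
    using D 1 2 ge by (auto simp: \<rho>_def field_simps)
  define C where "C = max C1 C2"
  define R where "R = max R1 R2"
  have C: "C \<ge> 0" "R \<ge> 1" using 1 2 by (auto simp: C_def R_def)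
  have b1: "norm_bound \<rho> ((q * W) $ i) (C * R ^ i)" for i
    using 1 \<rho> by (intro norm_bound_mono[OF 1(3)] mult_mono power_mono) (auto simp: C_def R_def)
  have b2: "norm_bound \<rho> (W $ i) (C * R ^ i)" for i
    using 2 \<rho> by (intro norm_bound_mono[OF 2(3)] mult_mono power_mono) (auto simp: C_def R_def)
  have bw: "norm_bound \<rho> w (2 * D)"
    using D \<rho> by (intro norm_bound_geometric[of \<rho> T D w]) auto
  \<comment> \<open>L is the cost of multiplying by \<open>w\<close> and shifting by
    \<open>e\<close>, together with the constant C of the known series.\<close>
  define L where "L = 2 * D * C / \<rho> ^ e"
  have L: "L \<ge> 0" using D C \<rho> by (simp add: L_def)
  have "norm_bound \<rho> (q $ i) (L * (R * (1 + L)) ^ i)" for i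
  proof (induction i rule: less_induct)
    case (less i)
    have sum: "norm_bound \<rho> (\<Sum>k<i. q $ k * W $ (i - k)) (\<Sum>k<i. (L * (R * (1 + L)) ^ k) * (C * R ^ (i - k)))"
      using \<rho> less.IH b2 by (intro norm_bound_sum norm_bound_mult) auto
    have "(\<Sum>k<i. (L * (R * (1 + L)) ^ k) * (C * R ^ (i - k))) = (\<Sum>k<i. C * R ^ i * (L * (1 + L) ^ k))"
    proof (intro sum.cong refl)
      fix k assume "k \<in> {..<i}"
      then have "R ^ i = R ^ k * R ^ (i - k)" by (simp flip: power_add)
      then show "(L * (R * (1 + L)) ^ k) * (C * R ^ (i - k)) = C * R ^ i * (L * (1 + L) ^ k)"
        by (simp add: power_mult_distrib mult_ac)
    qed
    also have "\<dots> = C * R ^ i * (L * (\<Sum>k<i. (1 + L) ^ k))"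
      by (simp add: sum_distrib_left)
    \<comment> \<open>The base 1 + L is chosen for this telescoping: the -1 cancels against the
      bound C R^i of the known coefficient, so the induction closes with the same constant.\<close>
    also have "L * (\<Sum>k<i. (1 + L) ^ k) = (1 + L) ^ i - 1"
      using power_diff_1_eq[of "1 + L" i] by simp
    finally have "(\<Sum>k<i. (L * (R * (1 + L)) ^ k) * (C * R ^ (i - k))) = C * R ^ i * ((1 + L) ^ i - 1)" .
    then have eq: "C * R ^ i + (\<Sum>k<i. (L * (R * (1 + L)) ^ k) * (C * R ^ (i - k))) = C * (R * (1 + L)) ^ i"
      by (simp add: power_mult_distrib right_diff_distrib)
    have "norm_bound \<rho> ((q * W) $ i - (\<Sum>k<i. q $ k * W $ (i - k))) (C * (R * (1 + L)) ^ i)"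
      using norm_bound_add[OF less_imp_le[OF \<rho>(1)] b1[of i] norm_bound_uminus[THEN iffD2, OF sum]]
      unfolding eq by simp
    then have "norm_bound \<rho> (fps_shift e (w * ((q * W) $ i - (\<Sum>k<i. q $ k * W $ (i - k)))))
        (2 * D * (C * (R * (1 + L)) ^ i) / \<rho> ^ e)"
      using \<rho> by (intro norm_bound_shift norm_bound_mult bw) auto
    then show ?case
      using rec[of i] by (simp add: L_def mult_ac)
  qed
  then show ?thesis
    using \<rho> L C by (intro convergent2I_slices[of \<rho> "R * (1 + L)" L]) auto
qed

section \<open>Divisibility and units in the ring of germs\<close>

lemma germ_eqI: "fps_of_germ h = fps_of_germ k \<Longrightarrow> h = k"
  by (simp add: fps_of_germ_inject)

text \<open>A formal quotient suffices, since its convergence is automatic when the slice of W on x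
  = 0 is nonzero.\<close>

lemma germ_dvdI:
  assumes "fps_of_germ p = q * fps_of_germ W" "fps_of_germ W $ 0 \<noteq> 0"
  shows "W dvd p"
proof -
  have "convergent2 q"
    using assms fps_of_germ[of p] fps_of_germ[of W]
    by (intro convergent2_quotient[of q "fps_of_germ W"]) auto
  then have "p = W * germ_of_fps q"
    using assms(1) by (intro germ_eqI) (simp add: times_germ.rep_eq germ_of_fps_inverse mult.commute)
  then show ?thesis by simp
qed

lemma coeff2_mult_0_0: "coeff2 (h * k) 0 0 = coeff2 h 0 0 * coeff2 k 0 0"
  by (simp add: coeff2.rep_eq times_germ.rep_eq)

lemma germ_is_unit_iff: "is_unit h \<longleftrightarrow> coeff2 h 0 0 \<noteq> 0"
proof
  assume "is_unit h"
  then obtain k where "1 = h * k" by (auto simp: dvd_def)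
  then have "coeff2 1 0 0 = coeff2 h 0 0 * coeff2 k 0 0" by (metis coeff2_mult_0_0)
  then show "coeff2 h 0 0 \<noteq> 0" by (auto simp: coeff2.rep_eq one_germ.rep_eq)
next
  let ?H = "fps_of_germ h"
  assume h: "coeff2 h 0 0 \<noteq> 0"
  then have "?H $ 0 * inverse (?H $ 0) = 1"
    using inverse_mult_eq_1[of "?H $ 0"] by (simp add: coeff2.rep_eq mult.commute)
  \<comment> \<open>The formal inverse in the nested series ring; it converges because it is the
    quotient of 1 by h.\<close>
  then have "?H * fps_right_inverse ?H (inverse (?H $ 0)) = 1"
    by (rule fps_right_inverse)
  then show "is_unit h"
    using h by (intro germ_dvdI[of 1 "fps_right_inverse ?H (inverse (?H $ 0))" h])
      (auto simp: one_germ.rep_eq coeff2.rep_eq mult.commute)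
qed

text \<open>
  Krull's intersection theorem for \<open>\<langle>W\<rangle>\<close>: the quotients modulo \<open>x\<^sup>k\<close> stabilise to a formal
  quotient, which is convergent.
\<close>

lemma germ_dvd_if_dvd_mod_x_power:
  assumes W: "fps_of_germ W $ 0 \<noteq> 0" and p: "\<And>k. \<exists>q r. p = q * W + germ_x ^ k * r"
  shows "W dvd p"
proof -
  obtain q r where qr: "\<And>k. p = q k * W + germ_x ^ k * r k" using p by metis
  let ?q = "\<lambda>k. fps_of_germ (q k)" and ?W = "fps_of_germ W"
  have x: "fps_of_germ (germ_x ^ k * h) = fps_X ^ k * fps_of_germ h" for k h
    by (induction k) (simp_all add: times_germ.rep_eq germ_x.rep_eq one_germ.rep_eq mult_ac)
  have pq: "fps_of_germ p = ?q k * ?W + fps_X ^ k * fps_of_germ (r k)" for k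
    using arg_cong[OF qr[of k], of fps_of_germ] by (simp add: plus_germ.rep_eq times_germ.rep_eq[of "q k"] x)
  \<comment> \<open>The difference of the two quotients times W is divisible by x^(n+1). As W has a
    nonzero lowest slice, the coefficients of the difference up to n vanish one after the
    other.\<close>
  have stable: "?q k $ n = ?q l $ n" if "n < k" "n < l" for k l n
  proof -
    have dvd: "fps_X ^ Suc n dvd (?q k - ?q l) * ?W"
    proof -
      have "(?q k - ?q l) * ?W = fps_X ^ l * fps_of_germ (r l) - fps_X ^ k * fps_of_germ (r k)"
        using pq[of k] pq[of l] by (simp add: algebra_simps)
      moreover have "fps_X ^ Suc n dvd (fps_X ^ k :: complex fps fps)" "fps_X ^ Suc n dvd (fps_X ^ l :: complex fps fps)"
        using that by (auto intro!: le_imp_power_dvd simp del: power_Suc)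
      ultimately show ?thesis by (metis dvd_diff dvd_mult2)
    qed
    have "(?q k - ?q l) $ m = 0" if "m \<le> n" for m
      using that
    proof (induction m rule: less_induct)
      case (less m)
      have "0 = ((?q k - ?q l) * ?W) $ m"
        using dvd less.prems by (auto simp: X_power_dvd_iff simp del: power_Suc)
      also have "\<dots> = (\<Sum>i=0..m. (?q k - ?q l) $ i * ?W $ (m - i))" by (rule fps_mult_nth)
      also have "\<dots> = (\<Sum>i\<in>{m}. (?q k - ?q l) $ i * ?W $ (m - i))"
      proof (intro sum.mono_neutral_right ballI)
        fix i assume "i \<in> {0..m} - {m}"
        then have "(?q k - ?q l) $ i = 0" using less by simp
        then show "(?q k - ?q l) $ i * ?W $ (m - i) = 0" by simp
      qed auto
      finally show ?case using W by simp
    qed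
    then show ?thesis by simp
  qed
  define Q where "Q = Abs_fps (\<lambda>n. ?q (Suc n) $ n)"
  have "fps_of_germ p = Q * ?W"
  proof (rule fps_ext)
    fix n
    have "fps_of_germ p $ n = (?q (Suc n) * ?W) $ n"
      by (subst pq[of "Suc n"]) (simp add: fps_X_power_mult_nth del: power_Suc)
    also have "\<dots> = (Q * ?W) $ n"
      by (intro fps_mult_nth_cong) (auto simp: Q_def intro: stable)
    finally show "fps_of_germ p $ n = (Q * ?W) $ n" .
  qed
  then show ?thesis using W by (rule germ_dvdI)
qed

text \<open>Let the coefficients of h be bounded by C R^(i+j). For small \<rho> the norms of x(t)
  and y(t) are at most 1/(2R), since both have no constant term, and geometric series of ratio 1/2
  dominate the double series.\<close>

lemma fps_conv_radius_pullback:
  assumes "centered \<phi>" "fps_conv_radius (fst \<phi>) > 0" "fps_conv_radius (snd \<phi>) > 0"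
  shows "fps_conv_radius (pullback \<phi> h) > 0"
proof -
  obtain C R where CR: "C \<ge> 0" "R \<ge> 1" "\<And>i j. norm (coeff2 h i j) \<le> C * R ^ (i + j)"
    using convergent2E[of "fps_of_germ h"] fps_of_germ[of h] by (metis coeff2.rep_eq mem_Collect_eq)
  obtain C1 R1 where 1: "C1 \<ge> 0" "R1 \<ge> 1" "\<And>n. norm (fst \<phi> $ n) \<le> C1 * R1 ^ n"
    using fps_conv_radius_posE[OF assms(2)] by blast
  obtain C2 R2 where 2: "C2 \<ge> 0" "R2 \<ge> 1" "\<And>n. norm (snd \<phi> $ n) \<le> C2 * R2 ^ n"
    using fps_conv_radius_posE[OF assms(3)] by blast
  \<comment> \<open>The four summands encode the four conditions on \<rho>: both ratios
    \<open>R1 * \<rho>\<close> and \<open>R2 * \<rho>\<close> at most 1/2, both norms at most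
    1/(2R).\<close>
  define d where "d = R1 + R2 + 2 * R * C1 * R1 + 2 * R * C2 * R2"
  have d: "R1 \<le> d" "R2 \<le> d" "2 * R * C1 * R1 \<le> d" "2 * R * C2 * R2 \<le> d" "d > 0"
    unfolding d_def using CR 1 2 by (auto intro!: add_increasing add_increasing2 add_pos_nonneg)
  define \<rho> where "\<rho> = 1 / (2 * d)"
  have \<rho>: "\<rho> > 0" "R1 * \<rho> \<le> 1 / 2" "R2 * \<rho> \<le> 1 / 2"
    "\<rho> * (2 * (C1 * R1)) \<le> 1 / (2 * R)" "\<rho> * (2 * (C2 * R2)) \<le> 1 / (2 * R)"
    using d CR by (auto simp: \<rho>_def field_simps)
  have bx: "norm_bound \<rho> (fst \<phi>) (1 / (2 * R))"
    using \<rho> 1 assms(1) by (intro norm_bound_mono[OF norm_bound_small[of \<rho> R1 C1]]) (auto simp: centered_def)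
  have "by": "norm_bound \<rho> (snd \<phi>) (1 / (2 * R))"
    using \<rho> 2 assms(1) by (intro norm_bound_mono[OF norm_bound_small[of \<rho> R2 C2]]) (auto simp: centered_def)
  have geo: "(\<Sum>i\<le>n. (1 / 2 :: real) ^ i) \<le> 2" for n
    by (simp add: half_geometric)
  have "norm (pullback \<phi> h $ n) \<le> 4 * C * max 1 (1 / \<rho>) ^ n" for n
  proof -
    have "norm (pullback \<phi> h $ n) \<le> (\<Sum>i\<le>n. \<Sum>j\<le>n. norm (coeff2 h i j * (fst \<phi> ^ i * snd \<phi> ^ j) $ n))"
      unfolding pullback_def fps_nth_Abs_fps by (rule order_trans[OF norm_sum sum_mono]) (rule norm_sum)
    also have "\<dots> \<le> (\<Sum>i\<le>n. \<Sum>j\<le>n. C * (1 / 2) ^ i * (1 / 2) ^ j * (1 / \<rho>) ^ n)"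
    proof (intro sum_mono)
      fix i j
      have "norm ((fst \<phi> ^ i * snd \<phi> ^ j) $ n) \<le> (1 / (2 * R)) ^ i * (1 / (2 * R)) ^ j * (1 / \<rho>) ^ n"
        using \<rho> bx "by" by (intro norm_bound_nth norm_bound_mult norm_bound_power) auto
      then have "norm (coeff2 h i j * (fst \<phi> ^ i * snd \<phi> ^ j) $ n)
          \<le> (C * R ^ (i + j)) * ((1 / (2 * R)) ^ i * (1 / (2 * R)) ^ j * (1 / \<rho>) ^ n)"
        unfolding norm_mult using CR by (intro mult_mono) auto
      also have "\<dots> = C * (1 / 2) ^ i * (1 / 2) ^ j * (1 / \<rho>) ^ n"
        using CR by (simp add: power_divide power_mult_distrib power_add)
      finally show "norm (coeff2 h i j * (fst \<phi> ^ i * snd \<phi> ^ j) $ n) \<le> C * (1 / 2) ^ i * (1 / 2) ^ j * (1 / \<rho>) ^ n" .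
    qed
    also have "\<dots> = C * (1 / \<rho>) ^ n * ((\<Sum>i\<le>n. (1 / 2) ^ i) * (\<Sum>j\<le>n. (1 / 2) ^ j))"
      by (simp add: sum_product sum_distrib_left mult_ac)
    also have "\<dots> \<le> C * (max 1 (1 / \<rho>)) ^ n * (2 * 2)"
      using CR \<rho> geo by (intro mult_mono power_mono) (auto intro!: sum_nonneg)
    finally show ?thesis by simp
  qed
  then show ?thesis using CR by (intro fps_conv_radius_posI[of "4 * C" "max 1 (1 / \<rho>)"]) auto
qed

section \<open>The kernel of the pullback and the Saito module\<close>

lemma germ_x_dvdI:
  assumes "fps_of_germ h $ 0 = 0"
  shows "germ_x dvd h"
proof -
  have "convergent2 (fps_shift 1 (fps_of_germ h))"
  proof (rule convergent2_shift_bound[of "fps_of_germ h" 1 0])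
    show "convergent2 (fps_of_germ h)" using fps_of_germ[of h] by simp
    show "norm (fps_shift 1 (fps_of_germ h) $ i $ j) \<le> real (Suc (i + j)) * norm (fps_of_germ h $ (i + 1) $ (j + 0))" for i j
      using mult_right_mono[of 1 "real (Suc (i + j))" "norm (fps_of_germ h $ (i + 1) $ j)"] by simp
  qed simp
  then have "h = germ_x * germ_of_fps (fps_shift 1 (fps_of_germ h))"
    using assms by (intro germ_eqI fps_ext)
      (auto simp: times_germ.rep_eq germ_x.rep_eq germ_of_fps_inverse)
  then show ?thesis by (metis dvd_triv_left)
qed

lemma convergent2_fps_const:
  assumes "convergent2 H"
  shows "convergent2 (fps_const (H $ 0))"
proof -
  obtain C R where CR: "C \<ge> 0" "R \<ge> 1" "\<And>i j. norm (H $ i $ j) \<le> C * R ^ (i + j)"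
    by (rule convergent2E[OF assms]) blast
  show ?thesis
    using CR(3)[of 0] CR(1,2) by (intro convergent2I[of C R]) auto
qed

text \<open>On x = 0 order decides divisibility, as for power series in y alone. The quotient of the
  two slices, taken constant in x, leaves a remainder that vanishes on x = 0 and is therefore a
  multiple of x.\<close>

lemma germ_divide_mod_x:
  assumes W: "fps_of_germ W $ 0 \<noteq> 0"
    and p: "fps_of_germ p $ 0 \<noteq> 0 \<Longrightarrow> subdegree (fps_of_germ W $ 0) \<le> subdegree (fps_of_germ p $ 0)"
  obtains q r where "p = q * W + germ_x * r"
proof -
  let ?W = "fps_of_germ W" and ?p = "fps_of_germ p"
  have "?W $ 0 dvd ?p $ 0"
    using W p by (cases "?p $ 0 = 0") (auto simp: fps_dvd_iff)
  then obtain c where c: "?p $ 0 = c * ?W $ 0" by (auto simp: dvd_def mult.commute)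
  have "convergent2 (fps_const c)"
  proof (rule convergent2_quotient)
    show "convergent2 (fps_const (?W $ 0))"
      using fps_of_germ[of W] by (intro convergent2_fps_const) simp
    show "convergent2 (fps_const c * fps_const (?W $ 0))"
      using convergent2_fps_const[of ?p] fps_of_germ[of p] c by simp
    show "fps_const (?W $ 0) $ 0 \<noteq> 0" using W by simp
  qed
  then have "fps_of_germ (p - germ_of_fps (fps_const c) * W) $ 0 = 0"
    by (simp add: minus_germ.rep_eq times_germ.rep_eq germ_of_fps_inverse c)
  then obtain r where "p - germ_of_fps (fps_const c) * W = germ_x * r"
    using germ_x_dvdI unfolding dvd_def by blast
  then have "p = germ_of_fps (fps_const c) * W + germ_x * r" by (simp add: algebra_simps)
  then show ?thesis by (rule that)
qed

section \<open>Pullback and wedge product of 1-forms\<close>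

definition form_pullback :: "param \<Rightarrow> form \<Rightarrow> complex fps" where
  "form_pullback \<phi> \<omega> = pullback \<phi> (fst \<omega>) * fps_deriv (fst \<phi>) + pullback \<phi> (snd \<omega>) * fps_deriv (snd \<phi>)"

lemma form_val_eq: "form_val \<phi> \<omega> = t_order (fps_X * form_pullback \<phi> \<omega>)"
  by (simp add: form_val_def form_pullback_def)

lemma form_pullback_add: "form_pullback \<phi> (\<omega> + \<eta>) = form_pullback \<phi> \<omega> + form_pullback \<phi> \<eta>"
  by (simp add: form_pullback_def pullback_add algebra_simps)

lemma form_pullback_diff: "form_pullback \<phi> (\<omega> - \<eta>) = form_pullback \<phi> \<omega> - form_pullback \<phi> \<eta>"
  by (simp add: form_pullback_def pullback_diff algebra_simps)

lemma form_pullback_0 [simp]: "form_pullback \<phi> 0 = 0"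
  by (simp add: form_pullback_def)

lemma form_pullback_sum: "form_pullback \<phi> (\<Sum>i\<in>A. w i) = (\<Sum>i\<in>A. form_pullback \<phi> (w i))"
  by (induction A rule: infinite_finite_induct) (simp_all add: form_pullback_add)

lemma form_pullback_scale:
  "centered \<phi> \<Longrightarrow> form_pullback \<phi> (h *\<^sub>\<Omega> \<omega>) = pullback \<phi> h * form_pullback \<phi> \<omega>"
  by (simp add: form_pullback_def form_scale_def pullback_mult algebra_simps)

lemma form_pullback_d_germ:
  "centered \<phi> \<Longrightarrow> form_pullback \<phi> (d_germ h) = fps_deriv (pullback \<phi> h)"
  by (simp add: form_pullback_def d_germ_def pullback_deriv)

lemma pullback_unit_neq_0: "centered \<phi> \<Longrightarrow> is_unit u \<Longrightarrow> pullback \<phi> u \<noteq> 0"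
  by (metis dvdE mult_zero_left pullback_1 pullback_mult zero_neq_one)

text \<open>Cramer's rule before division: coordinates with respect to two forms are read off from
  wedge products.\<close>

lemma cramer_form: "wedge \<omega>\<^sub>1 \<omega>\<^sub>2 *\<^sub>\<Omega> \<omega> = wedge \<omega> \<omega>\<^sub>2 *\<^sub>\<Omega> \<omega>\<^sub>1 - wedge \<omega> \<omega>\<^sub>1 *\<^sub>\<Omega> \<omega>\<^sub>2"
  by (simp add: wedge_def form_scale_def prod_eq_iff algebra_simps)

lemma form_scale_cancel: "h \<noteq> 0 \<Longrightarrow> h *\<^sub>\<Omega> \<omega> = h *\<^sub>\<Omega> \<eta> \<longleftrightarrow> \<omega> = \<eta>"
  by (auto simp: form_scale_def prod_eq_iff)

lemma wedge_add_left: "wedge (\<omega> + \<omega>') \<eta> = wedge \<omega> \<eta> + wedge \<omega>' \<eta>"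
  by (simp add: wedge_def algebra_simps)

lemma wedge_scale_left: "wedge (h *\<^sub>\<Omega> \<omega>) \<eta> = h * wedge \<omega> \<eta>"
  by (simp add: wedge_def form_scale_def algebra_simps)

lemma wedge_commute: "wedge \<eta> \<omega> = - wedge \<omega> \<eta>"
  by (simp add: wedge_def algebra_simps)

lemma wedge_0_left: "wedge 0 \<eta> = 0"
  by (simp add: wedge_def)

lemma wedge_self [simp]: "wedge \<omega> \<omega> = 0"
  by (simp add: wedge_def)

text \<open>Excluding x(t) = 0 makes x cancellable along the branch, on which every descent modulo x
  rests, and makes x'(t) nonzero.\<close>

locale branch =
  fixes f :: germ and \<phi> :: param
  assumes irreducible: "irreducible f" and centered: "centered \<phi>"
    and x_neq_0: "fst \<phi> \<noteq> 0" and pullback_f: "pullback \<phi> f = 0"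
begin

lemma x_deriv_neq_0: "fps_deriv (fst \<phi>) \<noteq> 0"
  using x_neq_0 centered unfolding fps_deriv_eq_0_iff centered_def by (metis fps_const_0_eq_0)

lemma f_neq_0: "f \<noteq> 0"
  using irreducible by (auto simp: irreducible_def)

text \<open>If x divided f, the cofactor would be a unit by irreducibility, yet its pullback would
  vanish because x(t) does not.\<close>

lemma f_slice_neq_0: "fps_of_germ f $ 0 \<noteq> 0"
proof
  assume "fps_of_germ f $ 0 = 0"
  then obtain h where h: "f = germ_x * h" using germ_x_dvdI by (auto simp: dvd_def)
  have "\<not> is_unit germ_x" by (simp add: germ_is_unit_iff coeff2.rep_eq germ_x.rep_eq)
  then have "is_unit h" using irreducibleD[OF irreducible h] by simp
  moreover have "pullback \<phi> h = 0"
    using pullback_f x_neq_0 centered by (simp add: h pullback_mult pullback_x)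
  ultimately show False using pullback_unit_neq_0 centered by blast
qed

text \<open>The kernel is generated by any member W whose slice on x = 0 is nonzero of least order;
  as W is not a unit, irreducibility makes it an associate of f.\<close>

lemma pullback_eq_0_iff: "pullback \<phi> h = 0 \<longleftrightarrow> f dvd h"
proof
  show "f dvd h \<Longrightarrow> pullback \<phi> h = 0"
    by (auto simp: dvd_def pullback_mult centered pullback_f)
next
  define K where "K = {W. pullback \<phi> W = 0 \<and> fps_of_germ W $ 0 \<noteq> 0}"
  have "f \<in> K" by (simp add: K_def pullback_f f_slice_neq_0)
  then obtain W where WK: "W \<in> K"
    and min: "\<And>p. p \<in> K \<Longrightarrow> subdegree (fps_of_germ W $ 0) \<le> subdegree (fps_of_germ p $ 0)"
    using ex_has_least_nat[of "\<lambda>p. p \<in> K" f "\<lambda>p. subdegree (fps_of_germ p $ 0)"] by auto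
  \<comment> \<open>The remainder x r lies in the kernel and x(t) is not 0, so r lies in the kernel
    again and the division can be iterated.\<close>
  have step: "\<exists>q r. p = q * W + germ_x * r \<and> pullback \<phi> r = 0" if "pullback \<phi> p = 0" for p
  proof -
    have "\<exists>q r. p = q * W + germ_x * r"
      by (rule germ_divide_mod_x[of W p]) (use WK min that in \<open>auto simp: K_def\<close>)
    then obtain q r where qr: "p = q * W + germ_x * r" by blast
    have "pullback \<phi> r = 0"
      using that WK x_neq_0 by (simp add: qr pullback_add pullback_mult centered K_def pullback_x)
    with qr show ?thesis by blast
  qed
  have dvd: "W dvd p" if p: "pullback \<phi> p = 0" for p
  proof (rule germ_dvd_if_dvd_mod_x_power)
    show "fps_of_germ W $ 0 \<noteq> 0" using WK by (simp add: K_def)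
    have "\<exists>q r. p = q * W + germ_x ^ k * r \<and> pullback \<phi> r = 0" for k
    proof (induction k)
      case 0
      then show ?case using p by (intro exI[of _ 0] exI[of _ p]) simp
    next
      case (Suc k)
      then obtain q r where qr: "p = q * W + germ_x ^ k * r" "pullback \<phi> r = 0" by blast
      from step[OF qr(2)] obtain q' r' where "r = q' * W + germ_x * r'" "pullback \<phi> r' = 0" by blast
      then show ?case
        using qr by (intro exI[of _ "q + germ_x ^ k * q'"] exI[of _ r']) (simp add: algebra_simps)
    qed
    then show "\<exists>q r. p = q * W + germ_x ^ k * r" for k by blast
  qed
  obtain c where c: "f = W * c" using dvd[OF pullback_f] by (auto simp: dvd_def)
  have "\<not> is_unit W" using WK pullback_unit_neq_0[OF centered, of W] by (auto simp: K_def)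
  then have "is_unit c" using irreducibleD[OF irreducible c] by simp
  then have "f dvd W" using c by (metis dvd_refl mult_unit_dvd_iff)
  then show "f dvd h" if "pullback \<phi> h = 0" using dvd[OF that] by (rule dvd_trans)
qed

lemma coprime_iff: "coprime h f \<longleftrightarrow> \<not> f dvd h"
proof
  show "coprime h f \<Longrightarrow> \<not> f dvd h"
    using irreducible by (metis coprime_common_divisor dvd_refl irreducible_not_unit)
next
  assume h: "\<not> f dvd h"
  show "coprime h f"
  proof (rule coprimeI)
    fix c assume c: "c dvd h" "c dvd f"
    then obtain d where d: "f = c * d" by (auto simp: dvd_def)
    show "is_unit c"
    proof (rule ccontr)
      assume "\<not> is_unit c"
      then have "is_unit d" using irreducibleD[OF irreducible d] by simp
      then have "f dvd c" using d by (metis dvd_refl mult_unit_dvd_iff)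
      with c h show False using dvd_trans by blast
    qed
  qed
qed

text \<open>On x = 0 the germ f has positive order, and differentiation in y lowers it by exactly
  one, so the slice of f cannot divide its derivative.\<close>

lemma not_dvd_partial_y: "\<not> f dvd partial_y f"
proof
  let ?p = "fps_of_germ f $ 0"
  assume "f dvd partial_y f"
  then obtain c where c: "partial_y f = f * c" by (auto simp: dvd_def)
  have "fps_deriv ?p = fps_of_germ (partial_y f) $ 0" by (simp add: partial_y.rep_eq)
  then have eq: "fps_deriv ?p = ?p * fps_of_germ c $ 0" by (simp add: c times_germ.rep_eq)
  have "?p $ 0 = 0"
    using irreducible_not_unit[OF irreducible] by (simp add: germ_is_unit_iff coeff2.rep_eq)
  with f_slice_neq_0 have "subdegree ?p > 0"
    by (metis gr0I nth_subdegree_nonzero)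
  then obtain e where e: "subdegree ?p = Suc e" by (auto simp: gr0_conv_Suc)
  have "(?p * fps_of_germ c $ 0) $ e = 0"
    using e by (auto simp: fps_mult_nth intro!: sum.neutral nth_less_subdegree_zero)
  moreover have "fps_deriv ?p $ e \<noteq> 0"
    using nth_subdegree_nonzero[OF f_slice_neq_0] by (simp add: e del: of_nat_Suc)
  ultimately show False by (simp add: eq)
qed

text \<open>Both forms vanish on the tangent vector (x', y'), so their determinant vanishes along
  the branch; multiplying it by x' carries out the elimination of y'.\<close>

lemma dvd_wedge:
  assumes "form_pullback \<phi> \<omega> = 0" "form_pullback \<phi> \<eta> = 0"
  shows "f dvd wedge \<omega> \<eta>"
proof -
  have "pullback \<phi> (wedge \<omega> \<eta>) * fps_deriv (fst \<phi>)
      = pullback \<phi> (snd \<eta>) * form_pullback \<phi> \<omega> - pullback \<phi> (snd \<omega>) * form_pullback \<phi> \<eta>"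
    by (simp add: wedge_def form_pullback_def pullback_diff pullback_mult centered algebra_simps)
  then show ?thesis using assms x_deriv_neq_0 by (simp flip: pullback_eq_0_iff)
qed

lemma saito_module_eq: "saito_module f = {\<omega>. form_pullback \<phi> \<omega> = 0}"
proof (intro equalityI subsetI CollectI)
  fix \<omega> assume "\<omega> \<in> saito_module f"
  then obtain h p \<eta> where h: "\<not> f dvd h" "h *\<^sub>\<Omega> \<omega> = p *\<^sub>\<Omega> d_germ f + f *\<^sub>\<Omega> \<eta>"
    by (auto simp: saito_module_def F_module_def coprime_iff)
  from arg_cong[OF h(2), of "form_pullback \<phi>"] have "pullback \<phi> h * form_pullback \<phi> \<omega> = 0"
    by (simp add: form_pullback_scale centered form_pullback_add form_pullback_d_germ pullback_f)
  then show "form_pullback \<phi> \<omega> = 0" using h(1) by (simp add: pullback_eq_0_iff)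
next
  fix \<omega> assume "\<omega> \<in> {\<omega>. form_pullback \<phi> \<omega> = 0}"
  then have 1: "form_pullback \<phi> \<omega> = 0" by simp
  have 2: "form_pullback \<phi> (d_germ f) = 0" by (simp add: form_pullback_d_germ centered pullback_f)
  have "f dvd wedge \<omega> (d_germ f)" using dvd_wedge[OF 1 2] by simp
  then obtain h where h: "wedge \<omega> (d_germ f) = f * h" by (auto simp: dvd_def)
  \<comment> \<open>The multiplier coprime to f is its y-derivative: for \<omega> = A dx + B dy the
    form f_y \<omega> - B df has only a dx component, the coefficient of the wedge of \<omega> and
    df.\<close>
  have "partial_y f *\<^sub>\<Omega> \<omega> = snd \<omega> *\<^sub>\<Omega> d_germ f + f *\<^sub>\<Omega> (h, 0)"
    using arg_cong[OF h, of "\<lambda>k. k + snd \<omega> * partial_x f"]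
    by (simp add: wedge_def form_scale_def d_germ_def prod_eq_iff mult.commute)
  then show "\<omega> \<in> saito_module f"
    using not_dvd_partial_y by (auto simp: saito_module_def F_module_def coprime_iff)
qed

lemma dvd_wedge_saito_module:
  assumes "\<omega> \<in> saito_module f" "\<eta> \<in> saito_module f"
  shows "f dvd wedge \<omega> \<eta>"
  using assms by (simp add: saito_module_eq dvd_wedge)

lemma saito_module_module:
  "0 \<in> saito_module f"
  "\<omega> \<in> saito_module f \<Longrightarrow> \<eta> \<in> saito_module f \<Longrightarrow> \<omega> + \<eta> \<in> saito_module f"
  "\<omega> \<in> saito_module f \<Longrightarrow> \<eta> \<in> saito_module f \<Longrightarrow> \<omega> - \<eta> \<in> saito_module f"
  "\<omega> \<in> saito_module f \<Longrightarrow> h *\<^sub>\<Omega> \<omega> \<in> saito_module f"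
  "f *\<^sub>\<Omega> \<omega> \<in> saito_module f"
  "germ_x *\<^sub>\<Omega> \<omega> \<in> saito_module f \<Longrightarrow> \<omega> \<in> saito_module f"
  by (simp_all add: saito_module_eq form_pullback_add form_pullback_diff form_pullback_scale centered
      pullback_f pullback_x x_neq_0)

text \<open>The sufficient half of Saito's criterion. Wedging with one form isolates the coefficient
  of the other; for spanning, all wedge products in Cramer's rule are multiples of f, and f
  cancels.\<close>

lemma saito_basisI:
  assumes \<omega>: "\<omega>\<^sub>1 \<in> saito_module f" "\<omega>\<^sub>2 \<in> saito_module f"
    and u: "is_unit u" "wedge \<omega>\<^sub>1 \<omega>\<^sub>2 = u * f"
  shows "saito_basis f \<omega>\<^sub>1 \<omega>\<^sub>2"
proof -
  have nz: "wedge \<omega>\<^sub>1 \<omega>\<^sub>2 \<noteq> 0" using u f_neq_0 by auto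
  have ne: "\<omega>\<^sub>1 \<noteq> \<omega>\<^sub>2" using nz by auto
  have "Omega.independent {\<omega>\<^sub>1, \<omega>\<^sub>2}"
  proof
    assume "Omega.dependent {\<omega>\<^sub>1, \<omega>\<^sub>2}"
    then obtain c \<omega> where sum: "(\<Sum>\<omega>\<in>{\<omega>\<^sub>1, \<omega>\<^sub>2}. c \<omega> *\<^sub>\<Omega> \<omega>) = 0"
      and mem: "\<omega> \<in> {\<omega>\<^sub>1, \<omega>\<^sub>2}" "c \<omega> \<noteq> 0"
      using Omega.dependent_finite[of "{\<omega>\<^sub>1, \<omega>\<^sub>2}"] by (meson finite.emptyI finite_insert)
    have eq: "c \<omega>\<^sub>1 *\<^sub>\<Omega> \<omega>\<^sub>1 + c \<omega>\<^sub>2 *\<^sub>\<Omega> \<omega>\<^sub>2 = 0" using sum ne by simp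
    have "c \<omega>\<^sub>1 * wedge \<omega>\<^sub>1 \<omega>\<^sub>2 = wedge (c \<omega>\<^sub>1 *\<^sub>\<Omega> \<omega>\<^sub>1 + c \<omega>\<^sub>2 *\<^sub>\<Omega> \<omega>\<^sub>2) \<omega>\<^sub>2"
      by (simp only: wedge_add_left wedge_scale_left wedge_self) simp
    then have 1: "c \<omega>\<^sub>1 = 0"
      unfolding eq wedge_0_left using nz by simp
    have "c \<omega>\<^sub>2 * wedge \<omega>\<^sub>2 \<omega>\<^sub>1 = wedge (c \<omega>\<^sub>1 *\<^sub>\<Omega> \<omega>\<^sub>1 + c \<omega>\<^sub>2 *\<^sub>\<Omega> \<omega>\<^sub>2) \<omega>\<^sub>1"
      by (simp only: wedge_add_left wedge_scale_left wedge_self) simp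
    then have "c \<omega>\<^sub>2 = 0"
      unfolding eq wedge_0_left wedge_commute[of \<omega>\<^sub>2 \<omega>\<^sub>1] using nz by simp
    with 1 mem show False by blast
  qed
  moreover have "Omega.span {\<omega>\<^sub>1, \<omega>\<^sub>2} = saito_module f"
  proof
    show "Omega.span {\<omega>\<^sub>1, \<omega>\<^sub>2} \<subseteq> saito_module f"
      using \<omega> saito_module_module(1,2,4) by (intro Omega.span_minimal Omega.subspaceI) auto
    show "saito_module f \<subseteq> Omega.span {\<omega>\<^sub>1, \<omega>\<^sub>2}"
    proof
      fix \<omega> assume "\<omega> \<in> saito_module f"
      then obtain p q where p: "wedge \<omega> \<omega>\<^sub>2 = f * p" and q: "wedge \<omega> \<omega>\<^sub>1 = f * q"
        using dvd_wedge_saito_module \<omega> by (meson dvdE)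
      obtain v where v: "1 = u * v" using u by (auto simp: dvd_def)
      have "f *\<^sub>\<Omega> (u *\<^sub>\<Omega> \<omega>) = wedge \<omega>\<^sub>1 \<omega>\<^sub>2 *\<^sub>\<Omega> \<omega>"
        by (simp add: u(2) form_scale_def mult_ac)
      also have "\<dots> = (f * p) *\<^sub>\<Omega> \<omega>\<^sub>1 - (f * q) *\<^sub>\<Omega> \<omega>\<^sub>2"
        unfolding cramer_form[of \<omega>\<^sub>1 \<omega>\<^sub>2 \<omega>] p q ..
      also have "\<dots> = f *\<^sub>\<Omega> (p *\<^sub>\<Omega> \<omega>\<^sub>1 - q *\<^sub>\<Omega> \<omega>\<^sub>2)"
        by (simp add: form_scale_def prod_eq_iff algebra_simps)
      finally have "f *\<^sub>\<Omega> (u *\<^sub>\<Omega> \<omega>) = f *\<^sub>\<Omega> (p *\<^sub>\<Omega> \<omega>\<^sub>1 - q *\<^sub>\<Omega> \<omega>\<^sub>2)" .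
      then have "u *\<^sub>\<Omega> \<omega> = p *\<^sub>\<Omega> \<omega>\<^sub>1 - q *\<^sub>\<Omega> \<omega>\<^sub>2"
        using form_scale_cancel[OF f_neq_0] by blast
      then have "v *\<^sub>\<Omega> (u *\<^sub>\<Omega> \<omega>) = v *\<^sub>\<Omega> (p *\<^sub>\<Omega> \<omega>\<^sub>1 - q *\<^sub>\<Omega> \<omega>\<^sub>2)" by simp
      then have "\<omega> = v *\<^sub>\<Omega> (p *\<^sub>\<Omega> \<omega>\<^sub>1 - q *\<^sub>\<Omega> \<omega>\<^sub>2)"
        using v by (simp add: mult.commute)
      moreover have "v *\<^sub>\<Omega> (p *\<^sub>\<Omega> \<omega>\<^sub>1 - q *\<^sub>\<Omega> \<omega>\<^sub>2) \<in> Omega.span {\<omega>\<^sub>1, \<omega>\<^sub>2}"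
        by (intro Omega.span_scale Omega.span_diff Omega.span_base) auto
      ultimately show "\<omega> \<in> Omega.span {\<omega>\<^sub>1, \<omega>\<^sub>2}" by simp
    qed
  qed
  ultimately show ?thesis using ne by (simp add: saito_basis_def)
qed

text \<open>A triangular basis on x = 0: \<open>\<omega>\<^sub>1\<close> has least order in its
  second coefficient, and \<open>\<omega>\<^sub>2\<close> has second coefficient zero there and
  least order in the first. They generate S(f) modulo x S(f), as x can be cancelled inside S(f), and
  then all of S(f) by Krull's theorem. It remains to compare their determinant with f.\<close>

theorem saito_module_free:
  obtains \<omega>\<^sub>1 \<omega>\<^sub>2 u where "\<omega>\<^sub>1 \<in> saito_module f" "\<omega>\<^sub>2 \<in> saito_module f"
    "is_unit u" "wedge \<omega>\<^sub>1 \<omega>\<^sub>2 = u * f"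
proof -
  let ?o = "\<lambda>h. fps_of_germ h $ 0"
  let ?S = "saito_module f"
  \<comment> \<open>The form f dy shows that a candidate for \<open>\<omega>\<^sub>1\<close> exists;
    f dx does the same for \<open>\<omega>\<^sub>2\<close> below.\<close>
  have "f *\<^sub>\<Omega> (0, 1) \<in> ?S \<and> ?o (snd (f *\<^sub>\<Omega> (0, 1))) \<noteq> 0"
    using f_slice_neq_0 saito_module_module(5)[of "(0, 1)"] by (simp add: form_scale_def)
  from ex_has_least_nat[of "\<lambda>\<omega>. \<omega> \<in> ?S \<and> ?o (snd \<omega>) \<noteq> 0", OF this, of "\<lambda>\<omega>. subdegree (?o (snd \<omega>))"]
  obtain \<omega>\<^sub>1 where 1: "\<omega>\<^sub>1 \<in> ?S" "?o (snd \<omega>\<^sub>1) \<noteq> 0"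
    "\<And>\<omega>. \<omega> \<in> ?S \<Longrightarrow> ?o (snd \<omega>) \<noteq> 0 \<Longrightarrow> subdegree (?o (snd \<omega>\<^sub>1)) \<le> subdegree (?o (snd \<omega>))"
    by blast
  have "f *\<^sub>\<Omega> (1, 0) \<in> ?S \<and> ?o (snd (f *\<^sub>\<Omega> (1, 0))) = 0 \<and> ?o (fst (f *\<^sub>\<Omega> (1, 0))) \<noteq> 0"
    using f_slice_neq_0 saito_module_module(5)[of "(1, 0)"] by (simp add: form_scale_def zero_germ.rep_eq)
  from ex_has_least_nat[of "\<lambda>\<omega>. \<omega> \<in> ?S \<and> ?o (snd \<omega>) = 0 \<and> ?o (fst \<omega>) \<noteq> 0", OF this, of "\<lambda>\<omega>. subdegree (?o (fst \<omega>))"]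
  obtain \<omega>\<^sub>2 where 2: "\<omega>\<^sub>2 \<in> ?S" "?o (snd \<omega>\<^sub>2) = 0" "?o (fst \<omega>\<^sub>2) \<noteq> 0"
    "\<And>\<omega>. \<omega> \<in> ?S \<Longrightarrow> ?o (snd \<omega>) = 0 \<Longrightarrow> ?o (fst \<omega>) \<noteq> 0 \<Longrightarrow>
       subdegree (?o (fst \<omega>\<^sub>2)) \<le> subdegree (?o (fst \<omega>))"
    by blast
  have step: "\<exists>\<alpha> \<beta> s'. s' \<in> ?S \<and> s = \<alpha> *\<^sub>\<Omega> \<omega>\<^sub>1 + \<beta> *\<^sub>\<Omega> \<omega>\<^sub>2 + germ_x *\<^sub>\<Omega> s'" if s: "s \<in> ?S" for s
  proof -
    obtain \<alpha> r where \<alpha>: "snd s = \<alpha> * snd \<omega>\<^sub>1 + germ_x * r"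
      using germ_divide_mod_x[of "snd \<omega>\<^sub>1" "snd s"] 1 s by blast
    define s1 where "s1 = s - \<alpha> *\<^sub>\<Omega> \<omega>\<^sub>1"
    have s1: "s1 \<in> ?S" "snd s1 = germ_x * r"
      using s 1(1) saito_module_module(3,4) by (auto simp: s1_def form_scale_def \<alpha>)
    then have "?o (snd s1) = 0" by (simp add: times_germ.rep_eq germ_x.rep_eq)
    then obtain \<beta> r' where \<beta>: "fst s1 = \<beta> * fst \<omega>\<^sub>2 + germ_x * r'"
      using germ_divide_mod_x[of "fst \<omega>\<^sub>2" "fst s1"] 2 s1 by blast
    obtain r'' where r'': "snd \<omega>\<^sub>2 = germ_x * r''" using germ_x_dvdI[OF 2(2)] by (auto simp: dvd_def)
    have eq: "s1 - \<beta> *\<^sub>\<Omega> \<omega>\<^sub>2 = germ_x *\<^sub>\<Omega> (r', r - \<beta> * r'')"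
      using s1(2) by (simp add: prod_eq_iff form_scale_def \<beta> r'' algebra_simps)
    then have "(r', r - \<beta> * r'') \<in> ?S"
      using saito_module_module(3,4,6) s1(1) 2(1) by metis
    moreover have "s = \<alpha> *\<^sub>\<Omega> \<omega>\<^sub>1 + \<beta> *\<^sub>\<Omega> \<omega>\<^sub>2 + germ_x *\<^sub>\<Omega> (r', r - \<beta> * r'')"
      unfolding eq[symmetric] s1_def by simp
    ultimately show ?thesis by blast
  qed
  define h where "h = wedge \<omega>\<^sub>1 \<omega>\<^sub>2"
  \<comment> \<open>The coefficient matrix is triangular on x = 0, so the slice of h is, up to sign,
    the product of two nonzero diagonal entries.\<close>
  have h0: "?o h \<noteq> 0"
    using 1(2) 2(2,3) by (simp add: h_def wedge_def minus_germ.rep_eq times_germ.rep_eq)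
  then have hnz: "h \<noteq> 0" by (auto simp: zero_germ.rep_eq)
  have gen: "\<exists>\<alpha> \<beta>. s = \<alpha> *\<^sub>\<Omega> \<omega>\<^sub>1 + \<beta> *\<^sub>\<Omega> \<omega>\<^sub>2" if s: "s \<in> ?S" for s
  proof -
    have it: "\<exists>\<alpha> \<beta> s'. s' \<in> ?S \<and> s = \<alpha> *\<^sub>\<Omega> \<omega>\<^sub>1 + \<beta> *\<^sub>\<Omega> \<omega>\<^sub>2 + (germ_x ^ k) *\<^sub>\<Omega> s'" for k
    proof (induction k)
      case 0
      then show ?case using s by (intro exI[of _ 0] exI[of _ s]) simp
    next
      case (Suc k)
      then obtain \<alpha> \<beta> s' where a: "s' \<in> ?S" "s = \<alpha> *\<^sub>\<Omega> \<omega>\<^sub>1 + \<beta> *\<^sub>\<Omega> \<omega>\<^sub>2 + (germ_x ^ k) *\<^sub>\<Omega> s'" by blast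
      from step[OF a(1)] obtain \<alpha>' \<beta>' s'' where
        b: "s'' \<in> ?S" "s' = \<alpha>' *\<^sub>\<Omega> \<omega>\<^sub>1 + \<beta>' *\<^sub>\<Omega> \<omega>\<^sub>2 + germ_x *\<^sub>\<Omega> s''" by blast
      show ?case
        using a b by (intro exI[of _ "\<alpha> + germ_x ^ k * \<alpha>'"] exI[of _ "\<beta> + germ_x ^ k * \<beta>'"] exI[of _ s''])
          (simp add: form_scale_def prod_eq_iff algebra_simps)
    qed
    \<comment> \<open>The coordinates of s are available only modulo x^k. By Cramer's rule the wedge
      products are h times the coordinates up to sign, so Krull's theorem is applied to these
      products.\<close>
    have "h dvd wedge s \<omega>\<^sub>2"
    proof (rule germ_dvd_if_dvd_mod_x_power[OF h0])
      fix k
      from it[of k] obtain \<alpha> \<beta> s' where "s = \<alpha> *\<^sub>\<Omega> \<omega>\<^sub>1 + \<beta> *\<^sub>\<Omega> \<omega>\<^sub>2 + (germ_x ^ k) *\<^sub>\<Omega> s'" by blast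
      then have "wedge s \<omega>\<^sub>2 = \<alpha> * h + germ_x ^ k * wedge s' \<omega>\<^sub>2"
        by (simp add: wedge_add_left wedge_scale_left h_def)
      then show "\<exists>q r. wedge s \<omega>\<^sub>2 = q * h + germ_x ^ k * r" by blast
    qed
    moreover have "h dvd wedge s \<omega>\<^sub>1"
    proof (rule germ_dvd_if_dvd_mod_x_power[OF h0])
      fix k
      from it[of k] obtain \<alpha> \<beta> s' where "s = \<alpha> *\<^sub>\<Omega> \<omega>\<^sub>1 + \<beta> *\<^sub>\<Omega> \<omega>\<^sub>2 + (germ_x ^ k) *\<^sub>\<Omega> s'" by blast
      then have "wedge s \<omega>\<^sub>1 = (- \<beta>) * h + germ_x ^ k * wedge s' \<omega>\<^sub>1"
        using wedge_commute[of \<omega>\<^sub>2 \<omega>\<^sub>1] by (simp add: wedge_add_left wedge_scale_left h_def)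
      then show "\<exists>q r. wedge s \<omega>\<^sub>1 = q * h + germ_x ^ k * r" by blast
    qed
    ultimately obtain p q where pq: "wedge s \<omega>\<^sub>2 = h * p" "wedge s \<omega>\<^sub>1 = h * q" by (meson dvdE)
    have "h *\<^sub>\<Omega> s = (h * p) *\<^sub>\<Omega> \<omega>\<^sub>1 - (h * q) *\<^sub>\<Omega> \<omega>\<^sub>2"
      using cramer_form[of \<omega>\<^sub>1 \<omega>\<^sub>2 s] unfolding h_def[symmetric] pq .
    also have "\<dots> = h *\<^sub>\<Omega> (p *\<^sub>\<Omega> \<omega>\<^sub>1 + (- q) *\<^sub>\<Omega> \<omega>\<^sub>2)"
      by (simp add: form_scale_def prod_eq_iff algebra_simps)
    finally show ?thesis using form_scale_cancel[OF hnz] by blast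
  qed
  obtain \<delta> where \<delta>: "h = f * \<delta>" using dvd_wedge_saito_module[OF 1(1) 2(1)] by (auto simp: h_def dvd_def)
  obtain a1 b1 where e1: "f *\<^sub>\<Omega> (1, 0) = a1 *\<^sub>\<Omega> \<omega>\<^sub>1 + b1 *\<^sub>\<Omega> \<omega>\<^sub>2"
    using gen saito_module_module(5) by blast
  obtain a2 b2 where e2: "f *\<^sub>\<Omega> (0, 1) = a2 *\<^sub>\<Omega> \<omega>\<^sub>1 + b2 *\<^sub>\<Omega> \<omega>\<^sub>2"
    using gen saito_module_module(5) by blast
  \<comment> \<open>The determinant of the matrix that expresses f dx and f dy by the generators;
    multiplied by h it gives f^2.\<close>
  define D where "D = a1 * b2 - a2 * b1"
  have c: "f = a1 * fst \<omega>\<^sub>1 + b1 * fst \<omega>\<^sub>2" "0 = a1 * snd \<omega>\<^sub>1 + b1 * snd \<omega>\<^sub>2"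
    "0 = a2 * fst \<omega>\<^sub>1 + b2 * fst \<omega>\<^sub>2" "f = a2 * snd \<omega>\<^sub>1 + b2 * snd \<omega>\<^sub>2"
    using e1 e2 by (simp_all add: form_scale_def prod_eq_iff)
  have "f * f = (a1 * fst \<omega>\<^sub>1 + b1 * fst \<omega>\<^sub>2) * (a2 * snd \<omega>\<^sub>1 + b2 * snd \<omega>\<^sub>2)
      - (a1 * snd \<omega>\<^sub>1 + b1 * snd \<omega>\<^sub>2) * (a2 * fst \<omega>\<^sub>1 + b2 * fst \<omega>\<^sub>2)"
    unfolding c(1)[symmetric] c(2)[symmetric] c(4)[symmetric] by simp
  also have "\<dots> = D * h" by (simp add: D_def h_def wedge_def algebra_simps)
  finally have "f * f = f * (D * \<delta>)" by (simp add: \<delta> mult_ac)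
  then have fD: "f = D * \<delta>" using f_neq_0 by simp
  \<comment> \<open>With D invertible, f would divide the second coefficients of both generators,
    hence that of every member of S(f), including df.\<close>
  have "\<not> is_unit D"
  proof
    assume D: "is_unit D"
    have "D * snd \<omega>\<^sub>1 = b2 * (a1 * snd \<omega>\<^sub>1 + b1 * snd \<omega>\<^sub>2) - b1 * (a2 * snd \<omega>\<^sub>1 + b2 * snd \<omega>\<^sub>2)"
      by (simp add: D_def algebra_simps)
    also have "\<dots> = - b1 * f" unfolding c(2)[symmetric] c(4)[symmetric] by simp
    finally have d1: "f dvd snd \<omega>\<^sub>1" using D by (metis dvd_mult_unit_iff' dvd_triv_right)
    have "D * snd \<omega>\<^sub>2 = a1 * (a2 * snd \<omega>\<^sub>1 + b2 * snd \<omega>\<^sub>2) - a2 * (a1 * snd \<omega>\<^sub>1 + b1 * snd \<omega>\<^sub>2)"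
      by (simp add: D_def algebra_simps)
    also have "\<dots> = a1 * f" unfolding c(2)[symmetric] c(4)[symmetric] by simp
    finally have d2: "f dvd snd \<omega>\<^sub>2" using D by (metis dvd_mult_unit_iff' dvd_triv_right)
    have "d_germ f \<in> ?S" by (simp add: saito_module_eq form_pullback_d_germ centered pullback_f)
    then obtain \<alpha> \<beta> where "d_germ f = \<alpha> *\<^sub>\<Omega> \<omega>\<^sub>1 + \<beta> *\<^sub>\<Omega> \<omega>\<^sub>2" using gen by blast
    then have "partial_y f = \<alpha> * snd \<omega>\<^sub>1 + \<beta> * snd \<omega>\<^sub>2"
      by (simp add: d_germ_def form_scale_def prod_eq_iff)
    then show False using d1 d2 not_dvd_partial_y by simp
  qed
  then have "is_unit \<delta>" using irreducibleD[OF irreducible fD] by simp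
  then show ?thesis using that[OF 1(1) 2(1), of \<delta>] \<delta> by (simp add: h_def mult.commute)
qed

end

section \<open>The conductor of the branch\<close>

abbreviation conv_fps :: "complex fps \<Rightarrow> bool" where
  "conv_fps p \<equiv> fps_conv_radius p > 0"

lemma conv_fps_add: "conv_fps p \<Longrightarrow> conv_fps q \<Longrightarrow> conv_fps (p + q)"
  using fps_conv_radius_add[of p q] by (metis less_le_trans min_less_iff_conj)

lemma conv_fps_diff: "conv_fps p \<Longrightarrow> conv_fps q \<Longrightarrow> conv_fps (p - q)"
  using fps_conv_radius_diff[of p q] by (metis less_le_trans min_less_iff_conj)

lemma conv_fps_mult: "conv_fps p \<Longrightarrow> conv_fps q \<Longrightarrow> conv_fps (p * q)"
  using fps_conv_radius_mult[of p q] by (metis less_le_trans min_less_iff_conj)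

lemma conv_fps_power: "conv_fps p \<Longrightarrow> conv_fps (p ^ n)"
  using fps_conv_radius_power[of p n] by (metis less_le_trans)

lemma conv_fps_sum: "(\<And>i. i \<in> A \<Longrightarrow> conv_fps (p i)) \<Longrightarrow> conv_fps (\<Sum>i\<in>A. p i)"
  by (induction A rule: infinite_finite_induct) (simp_all add: conv_fps_add)

lemma conv_fps_prod: "(\<And>i. i \<in> A \<Longrightarrow> conv_fps (p i)) \<Longrightarrow> conv_fps (\<Prod>i\<in>A. p i)"
  by (induction A rule: infinite_finite_induct) (simp_all add: conv_fps_mult)

lemma conv_fps_compose:
  assumes "conv_fps p" "conv_fps q" "q $ 0 = 0"
  shows "conv_fps (p oo q)"
  using has_fps_expansion_compose[OF eval_fps_has_fps_expansion[OF assms(1)] eval_fps_has_fps_expansion[OF assms(2)] assms(3)]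
  by (simp add: has_fps_expansion_def)

lemma conv_fps_divide:
  assumes "conv_fps p" "conv_fps q" "q \<noteq> 0" "fps_X ^ subdegree q dvd p"
  obtains r where "conv_fps r" "p = q * r"
proof -
  let ?q = "fps_shift (subdegree q) q" and ?p = "fps_shift (subdegree q) p"
  have q0: "?q $ 0 \<noteq> 0" using assms(3) by simp
  have q: "q = ?q * fps_X ^ subdegree q" by (rule subdegree_decompose)
  have "?p * fps_X ^ subdegree q = p"
    using assms(4) by (auto simp: dvd_def mult.commute[of "fps_X ^ _"])
  have "p = q * (?p * inverse ?q)"
  proof -
    have "(?q * fps_X ^ subdegree q) * (?p * inverse ?q) = (?p * fps_X ^ subdegree q) * (inverse ?q * ?q)"
      by (simp only: mult_ac)
    then show ?thesis
      using \<open>?p * fps_X ^ subdegree q = p\<close> inverse_mult_eq_1[OF q0] q by simp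
  qed
  moreover have "conv_fps (?p * inverse ?q)"
    using assms q0 by (intro conv_fps_mult fps_conv_radius_inverse_pos) auto
  ultimately show ?thesis by (intro that) auto
qed

text \<open>The local inverse of the holomorphic map provides convergence. Only one composite is
  read off analytically; the other follows since composition with \<tau> on the right is
  injective.\<close>

lemma conv_fps_compositional_inverse:
  assumes "conv_fps \<tau>" "\<tau> $ 0 = 0" "\<tau> $ 1 \<noteq> 0"
  obtains \<theta> where "conv_fps \<theta>" "\<theta> $ 0 = 0" "\<theta> oo \<tau> = fps_X" "\<tau> oo \<theta> = fps_X"
proof -
  let ?f = "eval_fps \<tau>"
  have f: "?f has_fps_expansion \<tau>" by (rule eval_fps_has_fps_expansion[OF assms(1)])
  obtain S where S: "open S" "0 \<in> S" "?f holomorphic_on S"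
    using has_fps_expansion_imp_holomorphic[OF f] by metis
  have f0: "?f 0 = 0" by (simp add: eval_fps_at_0 assms(2))
  have "deriv ?f 0 \<noteq> 0" using fps_nth_fps_expansion[OF f, of 1] assms(3) by simp
  from has_complex_derivative_locally_injective[OF S(3,2,1) this]
  obtain r where r: "r > 0" "ball 0 r \<subseteq> S" "inj_on ?f (ball 0 r)" by blast
  have hol: "?f holomorphic_on ball 0 r" using S r by (meson holomorphic_on_subset)
  from holomorphic_has_inverse[OF hol open_ball r(3)]
  obtain g where g: "g holomorphic_on (?f ` ball 0 r)" "\<And>z. z \<in> ball 0 r \<Longrightarrow> g (?f z) = z"
    by metis
  have "open (?f ` ball 0 r)" by (rule open_mapping_thm3[OF hol open_ball r(3)])
  moreover have "0 \<in> ?f ` ball 0 r" using f0 r(1) by (metis centre_in_ball imageI)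
  ultimately have "g analytic_on {0}" using g(1) by (meson analytic_at)
  then have gexp: "g has_fps_expansion fps_expansion g 0" by (rule analytic_at_imp_has_fps_expansion_0)
  define \<theta> where "\<theta> = fps_expansion g 0"
  have c: "conv_fps \<theta>" using gexp by (simp add: has_fps_expansion_def \<theta>_def)
  have "g 0 = 0" using g(2)[of 0] f0 r(1) by simp
  then have t0: "\<theta> $ 0 = 0" using has_fps_expansion_imp_0_eq_fps_nth_0[OF gexp] by (simp add: \<theta>_def)
  have "(g \<circ> ?f) has_fps_expansion (\<theta> oo \<tau>)"
    using has_fps_expansion_compose[OF gexp f assms(2)] by (simp add: \<theta>_def)
  moreover have "eventually (\<lambda>z. z \<in> ball (0::complex) r) (nhds 0)"
    using r(1) by (intro eventually_nhds_in_open) auto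
  then have "eventually (\<lambda>z. (g \<circ> ?f) z = z) (nhds 0)"
    by eventually_elim (use g(2) in auto)
  ultimately have "(\<lambda>z. z) has_fps_expansion (\<theta> oo \<tau>)"
    by (subst (asm) has_fps_expansion_cong[OF _ refl]) auto
  then have left: "\<theta> oo \<tau> = fps_X"
    using fps_expansion_unique_complex has_fps_expansion_fps_X by blast
  have "(\<tau> oo \<theta>) oo \<tau> = \<tau>"
    using fps_compose_assoc[OF assms(2) t0, of \<tau>] by (simp add: left)
  then have "((\<tau> oo \<theta>) - fps_X) oo \<tau> = 0"
    using assms(2) by (simp add: fps_compose_sub_distrib)
  then have "\<tau> oo \<theta> = fps_X"
    using assms by (auto simp: fps_compose_eq_0_iff)
  with c t0 left show ?thesis by (rule that)
qed

text \<open>Write x = t^m u with u(0) nonzero. The root is t r times the binomial series of exponent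
  1/m at u/u(0) - 1, where r^m = u(0).\<close>

lemma conv_fps_root:
  assumes "conv_fps x" "x \<noteq> 0" "subdegree x > 0"
  obtains \<tau> where "conv_fps \<tau>" "\<tau> $ 0 = 0" "\<tau> $ 1 \<noteq> 0" "\<tau> ^ subdegree x = x"
proof -
  define m where "m = subdegree x"
  define u where "u = fps_shift m x"
  define w where "w = fps_const (inverse (u $ 0)) * u - 1"
  define r where "r = (u $ 0) powr (1 / of_nat m)"
  have u0: "u $ 0 \<noteq> 0" using assms(2) by (simp add: u_def m_def)
  have m: "m > 0" using assms(3) by (simp add: m_def)
  have w0: "w $ 0 = 0" using u0 by (simp add: w_def)
  have u: "u = fps_const (u $ 0) * (1 + w)"
    using u0 by (simp add: w_def fps_eq_iff)
  have rm: "r ^ m = u $ 0"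
    using u0 m by (simp add: r_def powr_def exp_of_nat_mult[symmetric])
  define \<tau> where "\<tau> = fps_X * (fps_const r * (fps_binomial (1 / of_nat m) oo w))"
  have "(fps_binomial (1 / of_nat m) oo w) ^ m = fps_binomial (1 / of_nat m) ^ m oo w"
    using w0 by (simp add: fps_compose_power)
  also have "\<dots> = 1 + w"
    using m w0 by (simp add: fps_binomial_power fps_binomial_1 fps_compose_add_distrib)
  finally have "\<tau> ^ m = fps_X ^ m * u"
    using u rm by (simp add: \<tau>_def power_mult_distrib fps_const_power)
  also have "\<dots> = x"
    using subdegree_decompose[of x] by (simp add: u_def m_def mult.commute)
  finally have t: "\<tau> ^ m = x" .
  have "conv_fps w"
    unfolding w_def u_def using assms(1) by (intro conv_fps_diff conv_fps_mult) auto
  moreover have "conv_fps (fps_binomial (1 / of_nat m))"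
    using has_fps_expansion_binomial_complex[of "1 / of_nat m"] by (simp add: has_fps_expansion_def)
  ultimately have "conv_fps \<tau>"
    unfolding \<tau>_def using w0 by (intro conv_fps_mult conv_fps_compose) auto
  moreover have "\<tau> $ 0 = 0" "\<tau> $ 1 \<noteq> 0"
    using u0 m by (auto simp: \<tau>_def r_def)
  ultimately show ?thesis using t unfolding m_def by (rule that)
qed

section \<open>Series in powers of t and the action of roots of unity\<close>

lemma fps_compose_X_power:
  fixes K :: "complex fps"
  assumes "d > 0" "\<And>n. \<not> d dvd n \<Longrightarrow> K $ n = 0"
  shows "Abs_fps (\<lambda>i. K $ (d * i)) oo fps_X ^ d = K"
proof (rule fps_ext)
  fix n
  have "(Abs_fps (\<lambda>i. K $ (d * i)) oo fps_X ^ d) $ n = (\<Sum>i=0..n. if n = d * i then K $ n else 0)"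
    unfolding fps_compose_nth by (intro sum.cong refl) (auto simp flip: power_mult)
  also have "\<dots> = K $ n"
  proof (cases "d dvd n")
    case True
    then obtain k where k: "n = d * k" by (auto simp: dvd_def)
    then have "(\<Sum>i=0..n. if n = d * i then K $ n else 0) = (\<Sum>i=0..n. if i = k then K $ n else 0)"
      using assms(1) by (intro sum.cong refl) auto
    then show ?thesis using k assms(1) by simp
  next
    case False
    then have "K $ n = 0" by (rule assms(2))
    then show ?thesis by (auto intro!: sum.neutral)
  qed
  finally show "(Abs_fps (\<lambda>i. K $ (d * i)) oo fps_X ^ d) $ n = K $ n" .
qed

lemma conv_fps_every_nth:
  assumes "conv_fps K"
  shows "conv_fps (Abs_fps (\<lambda>i. K $ (d * i)))"
proof -
  obtain C R where CR: "C \<ge> 0" "R \<ge> 1" "\<And>n. norm (K $ n) \<le> C * R ^ n"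
    using fps_conv_radius_posE[OF assms] by blast
  show ?thesis
    using CR(3)[of "d * _"] CR(1,2) by (intro fps_conv_radius_posI[of C "R ^ d"]) (auto simp: power_mult)
qed

definition germ_of_x :: "complex fps \<Rightarrow> germ" where
  "germ_of_x k = germ_of_fps (Abs_fps (\<lambda>i. fps_const (k $ i)))"

lemma pullback_germ_of_x:
  assumes "conv_fps k"
  shows "pullback \<phi> (germ_of_x k) = k oo fst \<phi>"
proof (rule fps_ext)
  fix n
  obtain C R where CR: "C \<ge> 0" "R \<ge> 1" "\<And>n. norm (k $ n) \<le> C * R ^ n"
    using fps_conv_radius_posE[OF assms] by blast
  have "norm (Abs_fps (\<lambda>i. fps_const (k $ i)) $ i $ j) \<le> C * R ^ (i + j)" for i j
  proof (cases "j = 0")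
    case True
    then show ?thesis using CR(3)[of i] by simp
  next
    case False
    then show ?thesis using CR(1,2) by simp
  qed
  then have "convergent2 (Abs_fps (\<lambda>i. fps_const (k $ i)))"
    using CR by (intro convergent2I[of C R]) auto
  then have "coeff2 (germ_of_x k) i j = (if j = 0 then k $ i else 0)" for i j
    by (simp add: coeff2.rep_eq germ_of_x_def germ_of_fps_inverse)
  then have "pullback \<phi> (germ_of_x k) $ n = (\<Sum>i\<le>n. \<Sum>j\<le>n. if j = 0 then k $ i * (fst \<phi> ^ i) $ n else 0)"
    unfolding pullback_def fps_nth_Abs_fps by (intro sum.cong refl) auto
  then show "pullback \<phi> (germ_of_x k) $ n = (k oo fst \<phi>) $ n"
    by (simp add: fps_compose_nth atLeast0AtMost)
qed

lemma pullback_compose: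
  assumes "centered \<psi>" "\<tau> $ 0 = 0"
  shows "pullback (fst \<psi> oo \<tau>, snd \<psi> oo \<tau>) h = pullback \<psi> h oo \<tau>"
proof (rule fps_ext)
  fix n
  let ?p = "\<Sum>i\<le>n. \<Sum>j\<le>n. fps_const (coeff2 h i j) * (fst \<psi> ^ i * snd \<psi> ^ j)"
  have "pullback \<psi> h $ k = ?p $ k" if "k \<le> n" for k
    using that by (simp add: pullback_nth[OF assms(1), of k n n] fps_sum_nth)
  then have "(pullback \<psi> h oo \<tau>) $ n = (?p oo \<tau>) $ n"
    unfolding fps_compose_nth by (intro sum.cong refl) auto
  also have "\<dots> = pullback (fst \<psi> oo \<tau>, snd \<psi> oo \<tau>) h $ n"
    using assms(2) by (simp add: fps_compose_sum_distrib fps_compose_mult_distrib fps_compose_power pullback_def fps_sum_nth)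
  finally show "pullback (fst \<psi> oo \<tau>, snd \<psi> oo \<tau>) h $ n = (pullback \<psi> h oo \<tau>) $ n" by simp
qed

text \<open>The substitution of z t for t. For the m-th roots of unity z these are the conjugations
  of series in t over series in t^m.\<close>

definition rot :: "complex \<Rightarrow> complex fps \<Rightarrow> complex fps" where
  "rot z h = h oo (fps_const z * fps_X)"

lemma rot_nth [simp]: "rot z h $ n = z ^ n * h $ n"
  by (simp add: rot_def)

lemma rot_ring_hom [simp]:
  "rot z 0 = 0" "rot z 1 = 1" "rot z (p + q) = rot z p + rot z q" "rot z (p * q) = rot z p * rot z q"
  "rot z (- p) = - rot z p"
  by (simp_all add: rot_def fps_compose_add_distrib fps_compose_mult_distrib fps_compose_uminus)

lemma rot_rot [simp]: "rot z (rot w p) = rot (z * w) p"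
  by (rule fps_ext) (simp add: power_mult_distrib mult.assoc)

lemma rot_1 [simp]: "rot 1 p = p"
  by (rule fps_ext) simp

lemma rot_sum: "rot z (\<Sum>i\<in>A. p i) = (\<Sum>i\<in>A. rot z (p i))"
  by (induction A rule: infinite_finite_induct) simp_all

lemma conv_fps_rot: "conv_fps p \<Longrightarrow> conv_fps (rot z p)"
  unfolding rot_def by (intro conv_fps_compose conv_fps_mult) auto

lemma map_poly_rot_mult: "map_poly (rot z) (p * q) = map_poly (rot z) p * map_poly (rot z) q"
  by (rule poly_eqI) (simp add: coeff_map_poly coeff_mult rot_sum)

lemma map_poly_rot_sum: "map_poly (rot z) (\<Sum>i\<in>A. p i) = (\<Sum>i\<in>A. map_poly (rot z) (p i))"
  by (rule poly_eqI) (simp add: coeff_map_poly coeff_sum rot_sum)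

lemma map_poly_rot_prod: "map_poly (rot z) (\<Prod>i\<in>A. p i) = (\<Prod>i\<in>A. map_poly (rot z) (p i))"
  by (induction A rule: infinite_finite_induct) (simp_all add: map_poly_rot_mult map_poly_1')

lemma conv_fps_coeff_prod:
  assumes "\<And>i k. i \<in> A \<Longrightarrow> conv_fps (coeff (p i) k)"
  shows "conv_fps (coeff (\<Prod>i\<in>A. p i) k)"
  using assms
proof (induction A arbitrary: k rule: infinite_finite_induct)
  case (insert a A)
  then show ?case by (auto simp: coeff_mult intro!: conv_fps_sum conv_fps_mult)
qed (simp_all add: of_bool_def)

lemma primitive_root_of_unity:
  assumes "m > 0"
  obtains w :: complex where "w ^ m = 1" "\<forall>n. w ^ n = 1 \<longrightarrow> m dvd n"
proof
  let ?w = "exp (2 * of_real pi * \<i> / of_nat m)"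
  have pow: "?w ^ n = exp (2 * of_real pi * \<i> * of_nat n / of_nat m)" for n
    by (simp add: exp_of_nat_mult[symmetric] mult_ac)
  show "?w ^ m = 1" using complex_root_unity_eq_1[of m m] assms unfolding pow by auto
  show "\<forall>n. ?w ^ n = 1 \<longrightarrow> m dvd n"
    using complex_root_unity_eq_1[of m] assms unfolding pow by auto
qed

text \<open>
  Lagrange interpolation: \<open>\<Sum>\<^sub>z h(z t) \<Prod>\<^sub>z\<^sub>' (T - Y(z' t))\<close>, with \<open>z' \<noteq> z\<close> running over the roots of
  unity, has coefficients in the series in \<open>t\<^sup>m\<close>; only \<open>z = 1\<close> survives the substitution \<open>T = Y(t)\<close>.
\<close>

lemma pullback_lagrange:
  assumes m: "m > 0" and Y: "conv_fps Y" "Y $ 0 = 0" and h: "conv_fps h"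
  shows "\<exists>e. pullback (fps_X ^ m, Y) e = h * (\<Prod>z\<in>{z. z ^ m = 1} - {1}. Y - rot z Y)"
proof -
  define Z where "Z = {z :: complex. z ^ m = 1}"
  have fin: "finite Z" using m by (simp add: Z_def finite_roots_unity)
  define H where "H = (\<Sum>z\<in>Z. smult (rot z h) (\<Prod>z'\<in>Z - {z}. [:- rot z' Y, 1:]))"
  \<comment> \<open>Multiplication by w permutes the roots of unity and hence the summands of
    H.\<close>
  have "map_poly (rot w) H = H" if w: "w \<in> Z" for w
  proof -
    have w0: "w \<noteq> 0" using w m by (auto simp: Z_def power_0_left)
    have inj: "inj_on ((*) w) A" for A using w0 by (auto simp: inj_on_def)
    have img: "(*) w ` Z = Z"
    proof
      show "(*) w ` Z \<subseteq> Z" using w by (auto simp: Z_def power_mult_distrib)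
      show "Z \<subseteq> (*) w ` Z"
      proof
        fix z assume "z \<in> Z"
        then have "z = w * (z / w)" "z / w \<in> Z" using w w0 by (auto simp: Z_def power_divide)
        then show "z \<in> (*) w ` Z" by blast
      qed
    qed
    have "map_poly (rot w) H = (\<Sum>z\<in>Z. smult (rot (w * z) h) (\<Prod>z'\<in>Z - {z}. [:- rot (w * z') Y, 1:]))"
      unfolding H_def by (simp add: map_poly_rot_sum map_poly_smult map_poly_rot_prod map_poly_pCons)
    also have "\<dots> = (\<Sum>z\<in>Z. smult (rot (w * z) h) (\<Prod>z'\<in>Z - {w * z}. [:- rot z' Y, 1:]))"
    proof (intro sum.cong refl arg_cong2[where f = smult])
      fix z assume "z \<in> Z"
      have "(*) w ` (Z - {z}) = Z - {w * z}"
        using img inj[of UNIV] by (simp add: image_set_diff)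
      then have "(\<Prod>z'\<in>Z - {w * z}. [:- rot z' Y, 1:]) = (\<Prod>z'\<in>(*) w ` (Z - {z}). [:- rot z' Y, 1:])" by simp
      also have "\<dots> = (\<Prod>z'\<in>Z - {z}. [:- rot (w * z') Y, 1:])"
        by (subst prod.reindex[OF inj]) simp
      finally show "(\<Prod>z'\<in>Z - {z}. [:- rot (w * z') Y, 1:]) = (\<Prod>z'\<in>Z - {w * z}. [:- rot z' Y, 1:])" ..
    qed
    also have "\<dots> = (\<Sum>z\<in>(*) w ` Z. smult (rot z h) (\<Prod>z'\<in>Z - {z}. [:- rot z' Y, 1:]))"
      by (subst sum.reindex[OF inj]) simp
    finally show ?thesis by (simp add: img H_def)
  qed
  note map_poly_H = this
  have inv: "rot w (coeff H j) = coeff H j" if "w \<in> Z" for w j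
  proof -
    have "coeff (map_poly (rot w) H) j = rot w (coeff H j)"
      by (rule coeff_map_poly) (rule rot_ring_hom(1))
    then show ?thesis unfolding map_poly_H[OF that] ..
  qed
  obtain w :: complex where w: "w ^ m = 1" "\<forall>n. w ^ n = 1 \<longrightarrow> m dvd n"
    by (rule primitive_root_of_unity[OF m])
  \<comment> \<open>Invariance under a primitive m-th root of unity kills every exponent that is not
    a multiple of m.\<close>
  have supp: "coeff H j $ n = 0" if "\<not> m dvd n" for j n
  proof -
    have "w ^ n * coeff H j $ n = coeff H j $ n"
      using inv[of w j] w(1) by (simp add: Z_def fps_eq_iff)
    then show ?thesis using w(2) that by auto
  qed
  have conv: "conv_fps (coeff H j)" for j
  proof -
    have 1: "conv_fps (coeff [:- rot z Y, 1:] k)" for z k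
      using conv_fps_rot[OF Y(1)] by (auto simp: coeff_pCons split: nat.splits)
    show ?thesis
      unfolding H_def coeff_sum coeff_smult
      by (intro conv_fps_sum conv_fps_mult conv_fps_rot h conv_fps_coeff_prod 1)
  qed
  \<comment> \<open>H is turned into a germ: x replaces t^m in its coefficients and y replaces
    T.\<close>
  define e where "e = (\<Sum>j\<le>degree H. germ_of_x (Abs_fps (\<lambda>i. coeff H j $ (m * i))) * germ_y ^ j)"
  have c: "centered (fps_X ^ m, Y)" using m Y by (simp add: centered_def)
  have psum: "pullback \<psi> (\<Sum>i\<in>A. p i) = (\<Sum>i\<in>A. pullback \<psi> (p i))" for \<psi> p and A :: "nat set"
    by (induction A rule: infinite_finite_induct) (simp_all add: pullback_add)
  have "pullback (fps_X ^ m, Y) e = (\<Sum>j\<le>degree H. coeff H j * Y ^ j)"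
    unfolding e_def psum
    by (intro sum.cong refl)
      (simp add: pullback_mult[OF c] pullback_power[OF c] pullback_y[OF c]
        pullback_germ_of_x conv_fps_every_nth conv fps_compose_X_power[OF m supp])
  also have "\<dots> = poly H Y" by (simp add: poly_altdef)
  also have "\<dots> = (\<Sum>z\<in>Z. rot z h * (\<Prod>z'\<in>Z - {z}. Y - rot z' Y))"
    by (simp add: H_def poly_sum poly_prod)
  also have "\<dots> = (\<Sum>z\<in>{1}. rot z h * (\<Prod>z'\<in>Z - {z}. Y - rot z' Y))"
  proof (intro sum.mono_neutral_right ballI)
    fix z assume "z \<in> Z - {1}"
    then have "1 \<in> Z - {z}" by (auto simp: Z_def)
    then have "(\<Prod>z'\<in>Z - {z}. Y - rot z' Y) = 0" using fin by (intro prod_zero bexI[of _ 1]) auto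
    then show "rot z h * (\<Prod>z'\<in>Z - {z}. Y - rot z' Y) = 0" by simp
  qed (use fin in \<open>auto simp: Z_def\<close>)
  finally show ?thesis by (auto simp: Z_def)
qed

text \<open>If Y were invariant, it would be a series in t^d with d >= 2 the multiplicative order of
  z. As d divides m, both coordinates would factor through \<tau>^d, contrary to
  primitivity.\<close>

lemma primitive_rot_neq:
  assumes prim: "primitive_parametrization f \<phi>"
    and \<tau>: "conv_fps \<tau>" "\<tau> $ 0 = 0" "fst \<phi> = \<tau> ^ m" "snd \<phi> = Y oo \<tau>" and Y: "conv_fps Y"
    and z: "z ^ m = 1" "z \<noteq> 1" and m: "m > 0"
  shows "rot z Y \<noteq> Y"
proof
  assume eq: "rot z Y = Y"
  define d where "d = (LEAST d. d > 0 \<and> z ^ d = 1)"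
  have "m > 0 \<and> z ^ m = 1" using z m by simp
  then have d: "d > 0" "z ^ d = 1" and min: "\<And>k. k > 0 \<Longrightarrow> z ^ k = 1 \<Longrightarrow> d \<le> k"
    unfolding d_def using LeastI[of "\<lambda>d. d > 0 \<and> z ^ d = 1" m] Least_le[of "\<lambda>d. d > 0 \<and> z ^ d = 1"] by auto
  have "d \<noteq> 1" using d z by auto
  with d have d2: "d \<ge> 2" by simp
  have dvd: "d dvd n" if "z ^ n = 1" for n
  proof (rule ccontr)
    assume "\<not> d dvd n"
    then have "n mod d > 0" by (simp add: dvd_eq_mod_eq_0)
    moreover have "z ^ (n mod d) = 1"
    proof -
      have "z ^ n = z ^ (d * (n div d) + n mod d)" by simp
      then show ?thesis using that d(2) by (simp only: power_add power_mult power_one mult_1)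
    qed
    ultimately have "d \<le> n mod d" by (rule min)
    with mod_less_divisor[OF d(1), of n] show False by simp
  qed
  have "Y $ n = 0" if "\<not> d dvd n" for n
    using arg_cong[OF eq, of "\<lambda>p. p $ n"] dvd[of n] that by auto
  then have YX: "Abs_fps (\<lambda>i. Y $ (d * i)) oo fps_X ^ d = Y"
    using d(1) by (intro fps_compose_X_power) auto
  obtain k where k: "m = d * k" using dvd[OF z(1)] by (auto simp: dvd_def)
  let ?\<sigma> = "\<tau> ^ d" and ?\<zeta> = "Abs_fps (\<lambda>i. Y $ (d * i))"
  have s0: "?\<sigma> $ 0 = 0" using d(1) \<tau>(2) by simp
  have "snd \<phi> = ?\<zeta> oo ?\<sigma>"
  proof -
    have "?\<zeta> oo (fps_X ^ d oo \<tau>) = (?\<zeta> oo fps_X ^ d) oo \<tau>"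
      using \<tau>(2) d(1) by (intro fps_compose_assoc) auto
    then show ?thesis using \<tau>(2,4) by (simp add: YX fps_X_power_compose)
  qed
  moreover have "fst \<phi> = fps_X ^ k oo ?\<sigma>"
    using \<tau>(3) s0 by (simp add: fps_X_power_compose k power_mult)
  moreover have "?\<sigma> $ 1 = 0"
    using power_nth_eq_0[of \<tau> 1 d 1] \<tau>(2) d2 by simp
  moreover have "conv_fps ?\<sigma>" "conv_fps (fps_X ^ k)" "conv_fps ?\<zeta>"
    using \<tau> Y by (auto intro: conv_fps_power conv_fps_every_nth)
  ultimately have "conv_fps ?\<sigma> \<and> conv_fps (fps_X ^ k) \<and> conv_fps ?\<zeta> \<and> ?\<sigma> $ 0 = 0 \<and> ?\<sigma> $ 1 = 0 \<and>
      \<phi> = (fps_X ^ k oo ?\<sigma>, ?\<zeta> oo ?\<sigma>)"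
    using s0 by (simp add: prod_eq_iff)
  then show False
    using prim unfolding primitive_parametrization_def by blast
qed

text \<open>By interpolation, D' times any convergent series is a pullback. A pullback whose order
  reaches that of x D' has the form x D' r with r convergent, and D' r is then the pullback of the
  required k.\<close>

theorem pullback_conductor:
  assumes prim: "primitive_parametrization f \<phi>" and x: "fst \<phi> \<noteq> 0"
  obtains N where "\<And>h. fps_X ^ N dvd pullback \<phi> h \<Longrightarrow> \<exists>k. pullback \<phi> h = fst \<phi> * pullback \<phi> k"
proof -
  have \<phi>: "conv_fps (fst \<phi>)" "conv_fps (snd \<phi>)" "fst \<phi> $ 0 = 0" "snd \<phi> $ 0 = 0"
    using prim by (auto simp: primitive_parametrization_def)
  then have cen: "centered \<phi>" by (simp add: centered_def)
  define m where "m = subdegree (fst \<phi>)"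
  have m: "m > 0" using x \<phi>(3) using nth_subdegree_nonzero[OF x] unfolding m_def by (metis gr0I)
  \<comment> \<open>\<tau> is a parameter in which x becomes the pure power \<tau>^m, and \<theta>
    changes back; Y below is y(t) written in this parameter.\<close>
  obtain \<tau> where \<tau>: "conv_fps \<tau>" "\<tau> $ 0 = 0" "\<tau> $ 1 \<noteq> 0" "\<tau> ^ m = fst \<phi>"
    using conv_fps_root[OF \<phi>(1) x] m unfolding m_def by blast
  obtain \<theta> where \<theta>: "conv_fps \<theta>" "\<theta> $ 0 = 0" "\<theta> oo \<tau> = fps_X" "\<tau> oo \<theta> = fps_X"
    using conv_fps_compositional_inverse[OF \<tau>(1-3)] by blast
  have canc: "(p oo \<theta>) oo \<tau> = p" for p
    using fps_compose_assoc[OF \<tau>(2) \<theta>(2), of p] \<theta>(3) by simp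
  define Y where "Y = snd \<phi> oo \<theta>"
  have Y: "conv_fps Y" "Y $ 0 = 0" using \<phi> \<theta> by (auto simp: Y_def intro: conv_fps_compose)
  have Y\<tau>: "snd \<phi> = Y oo \<tau>" by (simp add: Y_def canc)
  define D where "D = (\<Prod>z\<in>{z. z ^ m = 1} - {1}. Y - rot z Y)"
  have "D \<noteq> 0"
  proof -
    have "Y - rot z Y \<noteq> 0" if "z ^ m = 1" "z \<noteq> 1" for z
      using primitive_rot_neq[OF prim \<tau>(1,2) \<tau>(4)[symmetric] Y\<tau> Y(1) that m] by auto
    then show ?thesis
      unfolding D_def using m by (subst prod_zero_iff) (auto simp: finite_roots_unity)
  qed
  define D' where "D' = D oo \<tau>"
  have D': "D' \<noteq> 0" "conv_fps D'"
    using \<open>D \<noteq> 0\<close> \<tau> Y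
    by (auto simp: D'_def fps_compose_eq_0_iff D_def intro!: conv_fps_compose conv_fps_prod conv_fps_diff conv_fps_rot)
  have range: "\<exists>e. pullback \<phi> e = p * D'" if "conv_fps p" for p
  proof -
    have "conv_fps (p oo \<theta>)" using that \<theta> by (intro conv_fps_compose)
    from pullback_lagrange[OF m Y this] obtain e where e: "pullback (fps_X ^ m, Y) e = (p oo \<theta>) * D"
      by (auto simp: D_def)
    have "\<phi> = (fps_X ^ m oo \<tau>, Y oo \<tau>)"
      using \<tau>(2,4) Y\<tau> by (simp add: prod_eq_iff fps_X_power_compose)
    then have "pullback \<phi> e = pullback (fps_X ^ m, Y) e oo \<tau>"
      using pullback_compose[of "(fps_X ^ m, Y)" \<tau> e] \<tau>(2) m Y(2) by (simp add: centered_def)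
    then show ?thesis using \<tau>(2) by (auto simp: e fps_compose_mult_distrib canc D'_def)
  qed
  show ?thesis
  proof (rule that)
    fix h assume h: "fps_X ^ subdegree (fst \<phi> * D') dvd pullback \<phi> h"
    obtain r where r: "conv_fps r" "pullback \<phi> h = fst \<phi> * D' * r"
      using conv_fps_divide[OF fps_conv_radius_pullback[OF cen \<phi>(1,2)] _ _ h] x D' \<phi>(1)
      by (metis conv_fps_mult mult_eq_0_iff)
    then show "\<exists>k. pullback \<phi> h = fst \<phi> * pullback \<phi> k"
      using range[OF r(1)] r(2) by (metis mult.assoc mult.commute)
  qed
qed

section \<open>Classes of forms and reduction to zero\<close>

lemma X_power_dvd_iff_t_order: "fps_X ^ N dvd (p :: complex fps) \<longleftrightarrow> enat N \<le> t_order p"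
  by (auto simp: X_power_dvd_iff t_order_def intro: subdegree_geI nth_less_subdegree_zero)

lemma pullback_nth_0: "pullback \<phi> h $ 0 = coeff2 h 0 0"
  by (simp add: pullback_def)

lemma pullback_order_0:
  assumes "coeff2 h 0 0 \<noteq> 0"
  shows "pullback \<phi> h \<noteq> 0" "subdegree (pullback \<phi> h) = 0"
proof -
  have "pullback \<phi> h $ 0 \<noteq> 0" using assms by (simp only: pullback_nth_0 not_False_eq_True)
  then show "pullback \<phi> h \<noteq> 0" "subdegree (pullback \<phi> h) = 0"
    by (metis fps_zero_nth, metis subdegree_eq_0_iff)
qed

lemma subdegree_pos: "(p :: complex fps) \<noteq> 0 \<Longrightarrow> p $ 0 = 0 \<Longrightarrow> subdegree p > 0"
  using nth_subdegree_nonzero[of p] by (metis gr0I)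

text \<open>The operator t d/dt multiplies coefficient n by n, so it preserves a positive order.
  Thanks to the factor t, the differential of a germ vanishing at 0 has the same value as the
  germ.\<close>

lemma subdegree_X_mult_deriv:
  assumes "(p :: complex fps) $ 0 = 0" "p \<noteq> 0"
  shows "fps_X * fps_deriv p \<noteq> 0" "subdegree (fps_X * fps_deriv p) = subdegree p"
proof -
  have nth: "(fps_X * fps_deriv p) $ n = of_nat n * p $ n" for n
    by (cases n) auto
  have "subdegree p \<noteq> 0" using subdegree_pos[OF assms(2,1)] by (rule gr_implies_not0)
  then have nz: "(fps_X * fps_deriv p) $ subdegree p \<noteq> 0"
    using \<open>subdegree p \<noteq> 0\<close> nth_subdegree_nonzero[OF assms(2)] unfolding nth by (metis mult_eq_0_iff of_nat_eq_0_iff)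
  then show "fps_X * fps_deriv p \<noteq> 0" by (metis fps_zero_nth)
  show "subdegree (fps_X * fps_deriv p) = subdegree p"
    by (rule subdegreeI[OF nz], unfold nth) (metis mult_eq_0_iff nth_less_subdegree_zero)
qed

lemma subdegree_mult_eqI:
  assumes "fps_X ^ N dvd (p * q :: complex fps)" "(p * q) $ N \<noteq> 0"
  shows "p \<noteq> 0" "subdegree p + subdegree q = N"
proof -
  have "p * q \<noteq> 0" using assms(2) by auto
  moreover have "subdegree (p * q) = N"
    using assms by (intro subdegreeI) (auto simp: X_power_dvd_iff)
  ultimately show "p \<noteq> 0" "subdegree p + subdegree q = N" by auto
qed

context branch
begin

text \<open>The embedding of the quotient of the 1-forms by S(f), taken on representatives. It
  determines the class of a form, and the coset operations, being unions of coinciding classes, are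
  all computed through it.\<close>

definition tp :: "form \<Rightarrow> complex fps" where
  "tp \<omega> = fps_X * form_pullback \<phi> \<omega>"

lemma tp_simps:
  "tp (\<omega> + \<eta>) = tp \<omega> + tp \<eta>" "tp (\<omega> - \<eta>) = tp \<omega> - tp \<eta>" "tp 0 = 0"
  "tp (h *\<^sub>\<Omega> \<omega>) = pullback \<phi> h * tp \<omega>" "tp (\<Sum>i\<in>A. w i) = (\<Sum>i\<in>A. tp (w i))"
  by (simp_all add: tp_def form_pullback_add form_pullback_diff form_pullback_scale centered
      form_pullback_sum sum_distrib_left algebra_simps)

lemma saito_module_iff: "\<omega> \<in> saito_module f \<longleftrightarrow> tp \<omega> = 0"
  by (simp add: saito_module_eq tp_def)

lemma mem_form_class: "\<omega>' \<in> form_class f \<omega> \<longleftrightarrow> tp \<omega>' = tp \<omega>"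
proof -
  have "\<omega>' \<in> form_class f \<omega> \<longleftrightarrow> \<omega>' - \<omega> \<in> saito_module f"
  proof
    show "\<omega>' \<in> form_class f \<omega> \<Longrightarrow> \<omega>' - \<omega> \<in> saito_module f"
      by (auto simp: form_class_def elt_set_plus_def)
    assume "\<omega>' - \<omega> \<in> saito_module f"
    then show "\<omega>' \<in> form_class f \<omega>"
      unfolding form_class_def elt_set_plus_def by (intro CollectI bexI[of _ "\<omega>' - \<omega>"]) simp
  qed
  then show ?thesis by (simp add: saito_module_iff tp_simps)
qed

lemma form_class_eq_iff: "form_class f \<omega> = form_class f \<eta> \<longleftrightarrow> tp \<omega> = tp \<eta>"
  by (metis mem_form_class set_eqI)

lemma saito_module_eq_class: "saito_module f = form_class f 0"
  by (auto simp: mem_form_class saito_module_iff tp_simps)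

lemma form_class_eq_saito_iff: "form_class f \<omega> = saito_module f \<longleftrightarrow> tp \<omega> = 0"
  by (simp add: saito_module_eq_class form_class_eq_iff tp_simps)

lemma class_scale_form_class: "class_scale f h (form_class f \<omega>) = form_class f (h *\<^sub>\<Omega> \<omega>)"
proof -
  have "form_class f (h *\<^sub>\<Omega> \<omega>') = form_class f (h *\<^sub>\<Omega> \<omega>)" if "\<omega>' \<in> form_class f \<omega>" for \<omega>'
    using that by (simp add: mem_form_class form_class_eq_iff tp_simps)
  moreover have "\<omega> \<in> form_class f \<omega>" by (simp add: mem_form_class)
  ultimately show ?thesis unfolding class_scale_def by blast
qed

lemma class_diff_form_class: "class_diff f (form_class f \<omega>) (form_class f \<eta>) = form_class f (\<omega> - \<eta>)"
proof -
  have "form_class f (\<omega>' - \<eta>') = form_class f (\<omega> - \<eta>)"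
    if "\<omega>' \<in> form_class f \<omega>" "\<eta>' \<in> form_class f \<eta>" for \<omega>' \<eta>'
    using that by (simp add: mem_form_class form_class_eq_iff tp_simps)
  moreover have "\<omega> \<in> form_class f \<omega>" "\<eta> \<in> form_class f \<eta>" by (simp_all add: mem_form_class)
  ultimately show ?thesis unfolding class_diff_def by blast
qed

lemma class_val_form_class: "class_val \<phi> (form_class f \<omega>) = t_order (tp \<omega>)"
proof -
  have "form_val \<phi> ` form_class f \<omega> = {t_order (tp \<omega>)}"
  proof
    show "form_val \<phi> ` form_class f \<omega> \<subseteq> {t_order (tp \<omega>)}"
      by (auto simp: mem_form_class form_val_eq tp_def)
    show "{t_order (tp \<omega>)} \<subseteq> form_val \<phi> ` form_class f \<omega>"
      using mem_form_class[of \<omega> \<omega>] by (auto simp: form_val_eq tp_def)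
  qed
  then show ?thesis by (simp add: class_val_def)
qed

text \<open>After M steps the remainder is \<omega> minus the terms subtracted so far and has order
  at least M, as orders increase strictly; in the t-adic limit only the sums remain. Each subtracted
  term is a difference of two successive remainders and therefore inherits divisibility by
  t^N.\<close>

lemma zero_reduction_relation:
  assumes red: "zero_reduction_coefficients f \<phi> g F s \<eta> (form_class f \<omega>) P"
    and inj: "inj_on (\<lambda>i. form_class f (\<eta> i)) {1..s}"
    and N: "fps_X ^ N dvd tp \<omega>"
  shows "(\<Sum>i=1..s. pullback \<phi> (P i) * tp (\<eta> i)) = tp \<omega>"
    and "i \<in> {1..s} \<Longrightarrow> fps_X ^ N dvd pullback \<phi> (P i) * tp (\<eta> i)"
proof -
  obtain len c \<alpha> q R where
    chain: "reduction_chain f \<phi> g F ((\<lambda>i. form_class f (\<eta> i)) ` {1..s}) len c \<alpha> q R"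
    and R0: "R 0 = form_class f \<omega>" and res: "chain_result f len R = saito_module f"
    and sums: "\<And>i. i \<in> {1..s} \<Longrightarrow> (\<lambda>n. if enat n < len \<and> q n = form_class f (\<eta> i)
                then pullback \<phi> (germ_const (c n) * f_monomial g F (\<alpha> n)) else 0) sums pullback \<phi> (P i)"
    using red unfolding zero_reduction_coefficients_def by blast
  define u where "u i n = (if enat n < len \<and> q n = form_class f (\<eta> i)
                then pullback \<phi> (germ_const (c n) * f_monomial g F (\<alpha> n)) else 0)" for i n
  define T where "T i = tp (\<eta> i)" for i
  have step: "\<exists>\<rho>'. R (Suc M) = form_class f \<rho>' \<and> t_order (tp \<rho>) < t_order (tp \<rho>') \<and>
      (\<exists>i\<in>{1..s}. tp \<rho>' = tp \<rho> - u i M * T i \<and> (\<forall>k\<in>{1..s}. k \<noteq> i \<longrightarrow> u k M = 0))"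
    if M: "enat M < len" and \<rho>: "R M = form_class f \<rho>" for M \<rho>
  proof -
    let ?h = "germ_const (c M) * f_monomial g F (\<alpha> M)"
    have rs: "reduction_step f \<phi> g F ((\<lambda>i. form_class f (\<eta> i)) ` {1..s}) (R M) (c M) (\<alpha> M) (q M) (R (Suc M))"
      using chain M by (simp add: reduction_chain_def)
    then have "q M \<in> (\<lambda>i. form_class f (\<eta> i)) ` {1..s}"
      unfolding reduction_step_def by blast
    then obtain i where i: "i \<in> {1..s}" "q M = form_class f (\<eta> i)" by blast
    have R': "R (Suc M) = form_class f (\<rho> - ?h *\<^sub>\<Omega> \<eta> i)"
      using rs unfolding reduction_step_def i(2) \<rho> class_scale_form_class class_diff_form_class by blast
    have "t_order (tp \<rho>) < t_order (tp (\<rho> - ?h *\<^sub>\<Omega> \<eta> i))"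
      using rs unfolding reduction_step_def R' \<rho> class_val_form_class by blast
    moreover have "tp (\<rho> - ?h *\<^sub>\<Omega> \<eta> i) = tp \<rho> - u i M * T i"
      by (simp add: tp_simps u_def M i T_def)
    \<comment> \<open>Distinct indices have distinct classes, so each step is charged to exactly one
      index.\<close>
    moreover have "u k M = 0" if "k \<in> {1..s}" "k \<noteq> i" for k
      using inj_onD[OF inj, of k i] that i by (auto simp: u_def)
    ultimately show ?thesis using R' i(1) by blast
  qed
  \<comment> \<open>Finite and infinite chains are treated alike: past the end of a finite chain the
    remainder stays 0 and all u vanish.\<close>
  have claim: "\<exists>\<rho>. fps_X ^ N dvd tp \<rho> \<and> fps_X ^ M dvd tp \<rho> \<and>
      tp \<rho> = tp \<omega> - (\<Sum>i=1..s. (\<Sum>n<M. u i n) * T i) \<and>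
      (enat M \<le> len \<longrightarrow> R M = form_class f \<rho>) \<and> (len \<le> enat M \<longrightarrow> tp \<rho> = 0) \<and>
      (\<forall>i\<in>{1..s}. \<forall>n<M. fps_X ^ N dvd u i n * T i)" for M
  proof (induction M)
    case 0
    have "tp \<omega> = 0" if "len \<le> enat 0"
    proof -
      have "len = enat 0" using that by (simp flip: zero_enat_def)
      then show ?thesis using res R0 by (simp add: chain_result_def form_class_eq_saito_iff)
    qed
    then show ?case using N R0 by (intro exI[of _ \<omega>]) auto
  next
    case (Suc M)
    then obtain \<rho> where \<rho>: "fps_X ^ N dvd tp \<rho>" "fps_X ^ M dvd tp \<rho>"
      "tp \<rho> = tp \<omega> - (\<Sum>i=1..s. (\<Sum>n<M. u i n) * T i)"
      "enat M \<le> len \<Longrightarrow> R M = form_class f \<rho>" "len \<le> enat M \<Longrightarrow> tp \<rho> = 0"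
      "\<And>i n. i \<in> {1..s} \<Longrightarrow> n < M \<Longrightarrow> fps_X ^ N dvd u i n * T i"
      by blast
    show ?case
    proof (cases "enat M < len")
      case True
      from step[OF True \<rho>(4)] True obtain \<rho>' i where \<rho>': "R (Suc M) = form_class f \<rho>'"
        "t_order (tp \<rho>) < t_order (tp \<rho>')" and i: "i \<in> {1..s}" "tp \<rho>' = tp \<rho> - u i M * T i"
        "\<And>k. k \<in> {1..s} \<Longrightarrow> k \<noteq> i \<Longrightarrow> u k M = 0"
        by (metis less_imp_le)
      have "(\<Sum>k=1..s. u k M * T k) = (\<Sum>k\<in>{i}. u k M * T k)"
        using i by (intro sum.mono_neutral_right) auto
      then have eq: "tp \<rho>' = tp \<omega> - (\<Sum>i=1..s. (\<Sum>n<Suc M. u i n) * T i)"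
        using \<rho>(3) i(2) by (simp add: distrib_right sum.distrib)
      have N': "fps_X ^ N dvd tp \<rho>'"
        using \<rho>(1) \<rho>'(2) by (auto simp: X_power_dvd_iff_t_order)
      have M': "fps_X ^ Suc M dvd tp \<rho>'"
        using \<rho>(2) \<rho>'(2) unfolding X_power_dvd_iff_t_order Suc_ile_eq by (rule le_less_trans)
      have zero: "tp \<rho>' = 0" if "len \<le> enat (Suc M)"
      proof -
        have "len = enat (Suc M)" using that True by (metis Suc_ile_eq antisym)
        then show ?thesis using res \<rho>'(1) by (simp add: chain_result_def form_class_eq_saito_iff)
      qed
      have d: "fps_X ^ N dvd u k M * T k" if "k \<in> {1..s}" for k
      proof (cases "k = i")
        case True
        have "u k M * T k = tp \<rho> - tp \<rho>'" using i(2) True by simp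
        then show ?thesis using \<rho>(1) N' by simp
      next
        case False
        then show ?thesis using i(3) that by simp
      qed
      show ?thesis
        using N' M' eq \<rho>'(1) zero d \<rho>(6) by (intro exI[of _ \<rho>']) (auto simp: less_Suc_eq simp del: sum.lessThan_Suc)
    next
      case False
      then have len: "len \<le> enat M" by simp
      have u0: "u i M = 0" for i using False by (simp add: u_def)
      have "R (Suc M) = form_class f \<rho>" if "enat (Suc M) \<le> len"
        using that len by (metis Suc_ile_eq leD)
      then show ?thesis
        using \<rho> \<rho>(5)[OF len] u0 by (intro exI[of _ \<rho>]) (auto simp: less_Suc_eq)
    qed
  qed
  \<comment> \<open>M is taken so large that the coefficients up to m of all s partial sums have
    reached their limits, and beyond m, so that the remainder does not touch them.\<close>
  have ev: "\<exists>M>m. \<forall>i\<in>{1..s}. \<forall>k\<le>m. (\<Sum>n<M. u i n) $ k = pullback \<phi> (P i) $ k" for m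
  proof -
    have "\<forall>\<^sub>F M in sequentially. (\<Sum>n<M. u i n) $ k = pullback \<phi> (P i) $ k" if "i \<in> {1..s}" for i k
      using sums[OF that] unfolding sums_def tendsto_fps_iff u_def by blast
    then have "\<forall>\<^sub>F M in sequentially. \<forall>i\<in>{1..s}. \<forall>k\<in>{..m}. (\<Sum>n<M. u i n) $ k = pullback \<phi> (P i) $ k"
      by (auto simp: eventually_ball_finite_distrib)
    moreover have "\<forall>\<^sub>F M in sequentially. M > m" by (rule eventually_gt_at_top)
    ultimately have "\<forall>\<^sub>F M in sequentially. M > m \<and>
        (\<forall>i\<in>{1..s}. \<forall>k\<in>{..m}. (\<Sum>n<M. u i n) $ k = pullback \<phi> (P i) $ k)"
      by eventually_elim blast
    then show ?thesis by (auto dest!: eventually_happens)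
  qed
  show "fps_X ^ N dvd pullback \<phi> (P i) * tp (\<eta> i)" if i: "i \<in> {1..s}"
    unfolding X_power_dvd_iff
  proof (intro allI impI)
    fix m assume m: "m < N"
    from ev[of m] obtain M where M: "\<And>k. k \<le> m \<Longrightarrow> (\<Sum>n<M. u i n) $ k = pullback \<phi> (P i) $ k"
      using i by blast
    have "fps_X ^ N dvd (\<Sum>n<M. u i n) * T i"
      unfolding sum_distrib_right using claim[of M] i by (intro dvd_sum) auto
    then have "((\<Sum>n<M. u i n) * T i) $ m = 0" using m by (simp add: X_power_dvd_iff)
    moreover have "((\<Sum>n<M. u i n) * T i) $ m = (pullback \<phi> (P i) * T i) $ m"
      by (intro fps_mult_nth_cong M) auto
    ultimately show "(pullback \<phi> (P i) * tp (\<eta> i)) $ m = 0" by (simp add: T_def)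
  qed
  show "(\<Sum>i=1..s. pullback \<phi> (P i) * tp (\<eta> i)) = tp \<omega>"
  proof (rule fps_ext)
    fix m
    from ev[of m] obtain M where M: "M > m"
      "\<And>i k. i \<in> {1..s} \<Longrightarrow> k \<le> m \<Longrightarrow> (\<Sum>n<M. u i n) $ k = pullback \<phi> (P i) $ k"
      by blast
    obtain \<rho> where \<rho>: "fps_X ^ M dvd tp \<rho>" "tp \<rho> = tp \<omega> - (\<Sum>i=1..s. (\<Sum>n<M. u i n) * T i)"
      using claim[of M] by blast
    have "(\<Sum>i=1..s. pullback \<phi> (P i) * tp (\<eta> i)) $ m = (\<Sum>i=1..s. (\<Sum>n<M. u i n) * T i) $ m"
      unfolding fps_sum_nth using M(2) by (intro sum.cong refl fps_mult_nth_cong) (auto simp: T_def)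
    also have "(\<Sum>i=1..s. (\<Sum>n<M. u i n) * T i) = tp \<omega> - tp \<rho>" using \<rho>(2) by simp
    also have "(tp \<omega> - tp \<rho>) $ m = tp \<omega> $ m" using \<rho>(1) M(1) by (simp add: X_power_dvd_iff)
    finally show "(\<Sum>i=1..s. pullback \<phi> (P i) * tp (\<eta> i)) $ m = tp \<omega> $ m" .
  qed
qed

text \<open>Along the branch A x' = - B y'. With m < n the orders of x(t) and y(t), a unit A would
  give the left side order m, which is too small for the right. A unit B would force A to have order
  n - m < n; monomials containing y do not reach that far, so the order is a multiple of m, although
  m does not divide n.\<close>

lemma saito_module_in_maximal_ideal:
  assumes val: "subdegree (fst \<phi>) < subdegree (snd \<phi>)" "\<not> subdegree (fst \<phi>) dvd subdegree (snd \<phi>)"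
    and \<omega>: "\<omega> \<in> saito_module f"
  shows "coeff2 (fst \<omega>) 0 0 = 0" "coeff2 (snd \<omega>) 0 0 = 0"
proof -
  let ?A = "pullback \<phi> (fst \<omega>)" and ?B = "pullback \<phi> (snd \<omega>)"
  let ?x = "fps_X * fps_deriv (fst \<phi>)" and ?y = "fps_X * fps_deriv (snd \<phi>)"
  define m n where "m = subdegree (fst \<phi>)" and "n = subdegree (snd \<phi>)"
  have nz: "snd \<phi> \<noteq> 0" using val by auto
  have m: "m > 0" using centered subdegree_pos[OF x_neq_0] by (simp only: m_def centered_def)
  have c: "fst \<phi> $ 0 = 0 \<and> snd \<phi> $ 0 = 0" using centered by (simp only: centered_def)
  have x: "?x \<noteq> 0" "subdegree ?x = m"
    unfolding m_def by (rule subdegree_X_mult_deriv[OF conjunct1[OF c] x_neq_0])+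
  have y: "?y \<noteq> 0" "subdegree ?y = n"
    unfolding n_def by (rule subdegree_X_mult_deriv[OF conjunct2[OF c] nz])+
  have eq: "?A * ?x = - (?B * ?y)"
    using \<omega> by (simp add: saito_module_iff tp_def form_pullback_def eq_neg_iff_add_eq_0 algebra_simps)
  show A0: "coeff2 (fst \<omega>) 0 0 = 0"
  proof (rule ccontr)
    assume "coeff2 (fst \<omega>) 0 0 \<noteq> 0"
    then have "?A \<noteq> 0" "subdegree ?A = 0" by (rule pullback_order_0)+
    then have "subdegree (?A * ?x) = m" "?A * ?x \<noteq> 0" using x by auto
    then have "?B \<noteq> 0" "subdegree (?B * ?y) = m" unfolding eq by auto
    then show False using y val by (auto simp: m_def n_def)
  qed
  show "coeff2 (snd \<omega>) 0 0 = 0"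
  proof (rule ccontr)
    assume "coeff2 (snd \<omega>) 0 0 \<noteq> 0"
    then have "?B \<noteq> 0" "subdegree ?B = 0" by (rule pullback_order_0)+
    then have "subdegree (?B * ?y) = n" "?B * ?y \<noteq> 0" using y by auto
    moreover have "subdegree (?A * ?x) = subdegree (?B * ?y)" "?A * ?x = 0 \<longleftrightarrow> ?B * ?y = 0"
      unfolding eq by auto
    ultimately have Anz: "?A \<noteq> 0" and sum: "subdegree ?A + m = n" using x by auto
    define k where "k = subdegree ?A"
    define a where "a = Abs_fps (\<lambda>i. coeff2 (fst \<omega>) i 0)"
    have A_eq: "?A $ l = (a oo fst \<phi>) $ l" if l: "l \<le> k" for l
    proof -
      have "coeff2 (fst \<omega>) i j * (fst \<phi> ^ i * snd \<phi> ^ j) $ l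
          = (if j = 0 then coeff2 (fst \<omega>) i 0 * (fst \<phi> ^ i) $ l else 0)" for i j
      proof (cases "j = 0")
        case False
        have "fps_X ^ n dvd snd \<phi>" unfolding n_def X_power_dvd_iff by (blast intro: nth_less_subdegree_zero)
        then have "fps_X ^ n dvd fst \<phi> ^ i * snd \<phi> ^ j"
          using dvd_trans[OF _ dvd_power[of j "snd \<phi>"]] False by (intro dvd_mult) blast
        moreover have "l < n" using l sum m by (simp add: k_def)
        ultimately have "(fst \<phi> ^ i * snd \<phi> ^ j) $ l = 0" by (simp add: X_power_dvd_iff)
        then show ?thesis using False by simp
      qed simp
      then show ?thesis by (simp add: pullback_def fps_compose_nth a_def atLeast0AtMost)
    qed
    have "subdegree (a oo fst \<phi>) = k"
    proof (rule subdegreeI)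
      show "(a oo fst \<phi>) $ k \<noteq> 0"
        using nth_subdegree_nonzero[OF Anz, folded k_def] unfolding A_eq[OF order_refl] .
      show "(a oo fst \<phi>) $ l = 0" if "l < k" for l
        unfolding A_eq[OF less_imp_le[OF that], symmetric]
        by (rule nth_less_subdegree_zero) (use that in \<open>simp only: k_def\<close>)
    qed
    then have "m dvd k" using centered by (auto simp: m_def centered_def)
    then have "m dvd n" using sum by (auto simp: k_def)
    then show False using val by (simp add: m_def n_def)
  qed
qed

end

section \<open>Syzygies of the standard basis\<close>

text \<open>The last three assumptions follow from the geometry of the branch and from the start of
  the algorithm; stating them here separates the syzygy argument from their proofs.\<close>

locale reduced_standard_basis = branch f \<phi>
  for f :: germ and \<phi> :: param +
  fixes g :: nat and v :: "nat \<Rightarrow> nat" and F :: "nat \<Rightarrow> germ" and s :: nat and \<eta> :: "nat \<Rightarrow> form"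
    and n :: "nat \<Rightarrow> nat \<Rightarrow> nat"
    and \<alpha> \<beta> :: "nat \<Rightarrow> nat \<Rightarrow> nat \<Rightarrow> nat \<Rightarrow> nat"
    and a b :: "nat \<Rightarrow> nat \<Rightarrow> nat \<Rightarrow> complex"
    and Q E :: "nat \<Rightarrow> nat \<Rightarrow> nat \<Rightarrow> nat \<Rightarrow> germ"
  assumes v_inj: "inj_on v {..g}"
    and semigroup: "submonoid_gen (v ` {..g}) = value_semigroup \<phi>"
    and val_F: "i \<le> g \<Longrightarrow> germ_val \<phi> (F i) = enat (v i)"
    and \<eta>_inj: "inj_on (\<lambda>i. form_class f (\<eta> i)) {1..s}"
    and \<eta>_nonzero: "i \<in> {1..s} \<Longrightarrow> tp (\<eta> i) \<noteq> 0"
    and solutions: "j \<in> {1..s} \<Longrightarrow> k \<in> {1..s} \<Longrightarrow>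
           minimal_solutions g v (class_val \<phi> (form_class f (\<eta> j))) (class_val \<phi> (form_class f (\<eta> k)))
             = (\<lambda>l. (\<alpha> j k l, \<beta> j k l)) ` {1..n j k}"
    and S_process: "j \<in> {1..s} \<Longrightarrow> k \<in> {1..s} \<Longrightarrow> l \<in> {1..n j k} \<Longrightarrow>
           minimal_S_process f \<phi> g v F
             (a j k l) (\<alpha> j k l) (form_class f (\<eta> j)) (b j k l) (\<beta> j k l) (form_class f (\<eta> k))"
    and reduction: "j \<in> {1..s} \<Longrightarrow> k \<in> {1..s} \<Longrightarrow> l \<in> {1..n j k} \<Longrightarrow>
           zero_reduction_coefficients f \<phi> g F s \<eta>
             (S_element f g F (a j k l) (\<alpha> j k l) (form_class f (\<eta> j))
                              (b j k l) (\<beta> j k l) (form_class f (\<eta> k)))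
             (\<lambda>i. Q i j k l)"
    and E_cong: "i \<in> {1..s} \<Longrightarrow> j \<in> {1..s} \<Longrightarrow> k \<in> {1..s} \<Longrightarrow> l \<in> {1..n j k} \<Longrightarrow>
           f dvd E i j k l - (Q i j k l
             - (if i = j then germ_const (a j k l) * f_monomial g F (\<alpha> j k l) else 0)
             + (if i = k then germ_const (b j k l) * f_monomial g F (\<beta> j k l) else 0))"
    and \<eta>_generate: "\<exists>h. \<omega> = (\<Sum>i=1..s. h i *\<^sub>\<Omega> \<eta> i)"
    and conductor: "\<exists>N. \<forall>h. fps_X ^ N dvd pullback \<phi> h \<longrightarrow> (\<exists>k. pullback \<phi> h = fst \<phi> * pullback \<phi> k)"
    and in_maximal_ideal: "\<omega> \<in> saito_module f \<Longrightarrow> coeff2 (fst \<omega>) 0 0 = 0 \<and> coeff2 (snd \<omega>) 0 0 = 0"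
begin

definition G :: "form set" where
  "G = {\<Sum>i=1..s. E i j k l *\<^sub>\<Omega> \<eta> i | j k l. j \<in> {1..s} \<and> k \<in> {1..s} \<and> l \<in> {1..n j k}}"

definition weight :: "(nat \<Rightarrow> nat) \<Rightarrow> nat" where
  "weight \<gamma> = (\<Sum>i\<le>g. \<gamma> i * v i)"

definition order_of :: "nat \<Rightarrow> nat" where
  "order_of i = subdegree (tp (\<eta> i))"

definition relation :: "(nat \<Rightarrow> germ) \<Rightarrow> bool" where
  "relation h \<longleftrightarrow> (\<Sum>i=1..s. pullback \<phi> (h i) * tp (\<eta> i)) = 0"

text \<open>The order is that of the product, not of the coefficient alone. In this weighting the
  two monomial terms of a minimal S-process have equal order, and the summands of a relation can be
  compared.\<close>

definition order_ge :: "nat \<Rightarrow> (nat \<Rightarrow> germ) \<Rightarrow> bool" where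
  "order_ge N h \<longleftrightarrow> (\<forall>i\<in>{1..s}. fps_X ^ N dvd pullback \<phi> (h i) * tp (\<eta> i))"

definition leading_indices :: "nat \<Rightarrow> (nat \<Rightarrow> germ) \<Rightarrow> nat set" where
  "leading_indices N h = {i\<in>{1..s}. (pullback \<phi> (h i) * tp (\<eta> i)) $ N \<noteq> 0}"

lemma relation_iff: "relation h \<longleftrightarrow> (\<Sum>i=1..s. h i *\<^sub>\<Omega> \<eta> i) \<in> saito_module f"
  by (simp add: relation_def saito_module_iff tp_simps)

lemma class_val_\<eta>: "i \<in> {1..s} \<Longrightarrow> class_val \<phi> (form_class f (\<eta> i)) = enat (order_of i)"
  using \<eta>_nonzero by (simp add: class_val_form_class t_order_def order_of_def)

section \<open>Monomials and the equation of values\<close>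

lemma pullback_f_monomial:
  "pullback \<phi> (f_monomial g F \<gamma>) \<noteq> 0" "subdegree (pullback \<phi> (f_monomial g F \<gamma>)) = weight \<gamma>"
proof -
  have F: "pullback \<phi> (F i) \<noteq> 0" "subdegree (pullback \<phi> (F i)) = v i" if "i \<le> g" for i
    using val_F[OF that] by (auto simp: germ_val_def t_order_def split: if_splits)
  have eq: "pullback \<phi> (f_monomial g F \<gamma>) = (\<Prod>i\<le>g. pullback \<phi> (F i) ^ \<gamma> i)"
    by (simp add: f_monomial_def pullback_prod pullback_power centered)
  show "pullback \<phi> (f_monomial g F \<gamma>) \<noteq> 0"
    unfolding eq using F by simp
  show "subdegree (pullback \<phi> (f_monomial g F \<gamma>)) = weight \<gamma>"
    unfolding eq weight_def using F by (subst subdegree_prod) auto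
qed

lemma weight_add: "weight (\<lambda>i. \<gamma> i + \<delta> i) = weight \<gamma> + weight \<delta>"
  by (simp add: weight_def distrib_right sum.distrib)

text \<open>Multiplicities indexed by values become exponents through injectivity of v. They vanish
  beyond g, as solutions of the value equation must.\<close>

lemma subdegree_in_semigroup:
  assumes "pullback \<phi> h \<noteq> 0"
  obtains \<gamma> where "weight \<gamma> = subdegree (pullback \<phi> h)" "\<And>i. i > g \<Longrightarrow> \<gamma> i = 0"
proof -
  have "subdegree (pullback \<phi> h) \<in> value_semigroup \<phi>"
    using assms by (auto simp: value_semigroup_def germ_val_def t_order_def)
  then obtain c where c: "subdegree (pullback \<phi> h) = (\<Sum>w\<in>v ` {..g}. c w * w)"
    unfolding semigroup[symmetric] submonoid_gen_def by blast
  also have "\<dots> = weight (\<lambda>i. if i \<le> g then c (v i) else 0)"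
    unfolding weight_def using v_inj by (subst sum.reindex) auto
  finally show ?thesis by (intro that[of "\<lambda>i. if i \<le> g then c (v i) else 0"]) auto
qed

lemma value_solutions_iff:
  "(\<gamma>, \<delta>) \<in> value_solutions g v (enat p) (enat q) \<longleftrightarrow>
     (\<forall>i>g. \<gamma> i = 0 \<and> \<delta> i = 0) \<and> weight \<gamma> + p = weight \<delta> + q"
  by (simp add: value_solutions_def weight_def)

lemma value_solutions_support:
  "(\<gamma>, \<delta>) \<in> value_solutions g v p q \<Longrightarrow> i > g \<Longrightarrow> \<gamma> i = 0 \<and> \<delta> i = 0"
  by (simp add: value_solutions_def)

text \<open>Solutions vanish beyond g, so the total degree is a finite sum that detects every strict
  decrease; a solution of least total degree below the given one is minimal.\<close>

lemma minimal_solution_below: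
  assumes "(\<gamma>, \<delta>) \<in> value_solutions g v p q"
  obtains \<gamma>' \<delta>' where "(\<gamma>', \<delta>') \<in> minimal_solutions g v p q" "\<gamma>' \<le> \<gamma>" "\<delta>' \<le> \<delta>"
proof -
  define V where "V = value_solutions g v p q"
  let ?A = "\<lambda>(\<gamma>', \<delta>'). (\<gamma>', \<delta>') \<in> V \<and> \<gamma>' \<le> \<gamma> \<and> \<delta>' \<le> \<delta>"
  let ?size = "\<lambda>(\<gamma>' :: nat \<Rightarrow> nat, \<delta>' :: nat \<Rightarrow> nat). \<Sum>i\<le>g. \<gamma>' i + \<delta>' i"
  have "?A (\<gamma>, \<delta>)" using assms by (simp add: V_def)
  from ex_has_least_nat[of ?A, OF this, of ?size]
  obtain p' where p': "?A p'" "\<forall>y. ?A y \<longrightarrow> ?size p' \<le> ?size y"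
    by (elim exE conjE) (rule that)
  obtain \<gamma>' \<delta>' where p'_eq: "p' = (\<gamma>', \<delta>')" by (cases p')
  have A: "(\<gamma>', \<delta>') \<in> V" "\<gamma>' \<le> \<gamma>" "\<delta>' \<le> \<delta>"
    using p'(1) by (simp_all add: p'_eq)
  have least: "(\<gamma>'', \<delta>'') \<in> V \<Longrightarrow> \<gamma>'' \<le> \<gamma> \<Longrightarrow> \<delta>'' \<le> \<delta> \<Longrightarrow>
        (\<Sum>i\<le>g. \<gamma>' i + \<delta>' i) \<le> (\<Sum>i\<le>g. \<gamma>'' i + \<delta>'' i)" for \<gamma>'' \<delta>''
    using p'(2)[rule_format, of "(\<gamma>'', \<delta>'')"] by (simp add: p'_eq)
  have "\<gamma>'' = \<gamma>' \<and> \<delta>'' = \<delta>'" if B: "(\<gamma>'', \<delta>'') \<in> V" "\<gamma>'' \<le> \<gamma>'" "\<delta>'' \<le> \<delta>'" for \<gamma>'' \<delta>''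
  proof (rule ccontr)
    assume "\<not> (\<gamma>'' = \<gamma>' \<and> \<delta>'' = \<delta>')"
    then obtain i where i: "\<gamma>'' i \<noteq> \<gamma>' i \<or> \<delta>'' i \<noteq> \<delta>' i" by (auto simp: fun_eq_iff)
    have le: "\<gamma>'' i \<le> \<gamma>' i" "\<delta>'' i \<le> \<delta>' i" for i using B by (auto simp: le_fun_def)
    have "i \<le> g"
    proof (rule ccontr)
      assume "\<not> i \<le> g"
      then show False
        using i value_solutions_support[OF A(1)[unfolded V_def], of i]
          value_solutions_support[OF B(1)[unfolded V_def], of i] by simp
    qed
    then have "(\<Sum>i\<le>g. \<gamma>'' i + \<delta>'' i) < (\<Sum>i\<le>g. \<gamma>' i + \<delta>' i)"
      using le i le[of i] by (intro sum_strict_mono_ex1 ballI bexI[of _ i] add_mono) (auto intro: le_neq_implies_less add_less_le_mono add_le_less_mono)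
    moreover have "\<gamma>'' \<le> \<gamma>" "\<delta>'' \<le> \<delta>" using A B by (auto intro: order_trans)
    ultimately show False using least[OF B(1)] by simp
  qed
  then have "(\<gamma>', \<delta>') \<in> minimal_solutions g v p q"
    using A by (auto simp: minimal_solutions_def V_def)
  then show ?thesis using A that by blast
qed

section \<open>The syzygy of one minimal S-process\<close>

context
  fixes j k l
  assumes jkl: "j \<in> {1..s}" "k \<in> {1..s}" "l \<in> {1..n j k}"
begin

lemma minimal_solution_jkl: "weight (\<alpha> j k l) + order_of j = weight (\<beta> j k l) + order_of k"
proof -
  have "(\<alpha> j k l, \<beta> j k l) \<in> value_solutions g v (enat (order_of j)) (enat (order_of k))"
    using solutions[OF jkl(1,2)] jkl by (auto simp: minimal_solutions_def class_val_\<eta>)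
  then show ?thesis by (simp add: value_solutions_iff)
qed

definition S_form :: form where
  "S_form = (germ_const (a j k l) * f_monomial g F (\<alpha> j k l)) *\<^sub>\<Omega> \<eta> j
          - (germ_const (b j k l) * f_monomial g F (\<beta> j k l)) *\<^sub>\<Omega> \<eta> k"

lemma S_element_eq:
  "S_element f g F (a j k l) (\<alpha> j k l) (form_class f (\<eta> j)) (b j k l) (\<beta> j k l) (form_class f (\<eta> k))
     = form_class f S_form"
  by (simp add: S_element_def S_form_def class_scale_form_class class_diff_form_class)

text \<open>\<open>Suc\<close> records the strict rise of the value when the two leading terms
  cancel; a vanishing S-process has infinite order and is covered too.\<close>

lemma S_form_order: "fps_X ^ Suc (weight (\<alpha> j k l) + order_of j) dvd tp S_form"
proof -
  have "tp S_form = 0 \<or> t_order (tp (f_monomial g F (\<alpha> j k l) *\<^sub>\<Omega> \<eta> j)) < t_order (tp S_form)"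
    using S_process[OF jkl]
    by (simp add: minimal_S_process_def S_element_eq form_class_eq_saito_iff class_scale_form_class class_val_form_class)
  moreover have "t_order (tp (f_monomial g F (\<alpha> j k l) *\<^sub>\<Omega> \<eta> j)) = enat (weight (\<alpha> j k l) + order_of j)"
    using pullback_f_monomial \<eta>_nonzero jkl by (simp add: tp_simps t_order_def order_of_def)
  ultimately show ?thesis
    unfolding X_power_dvd_iff_t_order by (auto simp: Suc_ile_eq t_order_def)
qed

lemma Q_relation: "(\<Sum>i=1..s. pullback \<phi> (Q i j k l) * tp (\<eta> i)) = tp S_form"
  using zero_reduction_relation(1)[OF reduction[OF jkl, unfolded S_element_eq] \<eta>_inj S_form_order] .

lemma Q_order:
  "i \<in> {1..s} \<Longrightarrow> fps_X ^ Suc (weight (\<alpha> j k l) + order_of j) dvd pullback \<phi> (Q i j k l) * tp (\<eta> i)"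
  using zero_reduction_relation(2)[OF reduction[OF jkl, unfolded S_element_eq] \<eta>_inj S_form_order] .

lemma pullback_E:
  assumes "i \<in> {1..s}"
  shows "pullback \<phi> (E i j k l) = pullback \<phi> (Q i j k l)
    - (if i = j then fps_const (a j k l) * pullback \<phi> (f_monomial g F (\<alpha> j k l)) else 0)
    + (if i = k then fps_const (b j k l) * pullback \<phi> (f_monomial g F (\<beta> j k l)) else 0)"
  using E_cong[OF assms jkl] unfolding pullback_eq_0_iff[symmetric]
  by (auto simp: pullback_diff pullback_add pullback_mult pullback_const centered split: if_splits)

text \<open>The combination given by the Q equals the S-process, and the two correction terms remove
  it again. The case distinctions add up correctly for j = k as well.\<close>

lemma E_relation: "relation (\<lambda>i. E i j k l)"
proof -
  have "(\<Sum>i=1..s. pullback \<phi> (E i j k l) * tp (\<eta> i))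
      = (\<Sum>i=1..s. pullback \<phi> (Q i j k l) * tp (\<eta> i)
          - (if i = j then fps_const (a j k l) * pullback \<phi> (f_monomial g F (\<alpha> j k l)) * tp (\<eta> j) else 0)
          + (if i = k then fps_const (b j k l) * pullback \<phi> (f_monomial g F (\<beta> j k l)) * tp (\<eta> k) else 0))"
    by (intro sum.cong refl) (auto simp: pullback_E algebra_simps)
  also have "\<dots> = 0"
    using jkl by (simp add: sum.distrib sum_subtractf Q_relation[unfolded One_nat_def] S_form_def tp_simps pullback_mult pullback_const centered)
  finally show ?thesis by (simp add: relation_def)
qed

end

lemma G_subset: "G \<subseteq> saito_module f"
  using E_relation by (auto simp: G_def relation_iff)

text \<open>
  Any two indices of equal leading order give a solution of the value equation, which lies above a
  minimal one; a multiple of the corresponding syzygy cancels the leading term at \<open>j\<close>, changes the one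
  at \<open>k\<close>, and affects the other indices only in higher order.
\<close>

lemma cancel_leading_term:
  assumes h: "relation h" "order_ge N h" and jk: "j \<in> leading_indices N h" "k \<in> leading_indices N h" "j \<noteq> k"
  obtains h' where "relation h'" "order_ge N h'" "leading_indices N h' \<subset> leading_indices N h"
    "(\<Sum>i=1..s. h i *\<^sub>\<Omega> \<eta> i) - (\<Sum>i=1..s. h' i *\<^sub>\<Omega> \<eta> i) \<in> Omega.span G"
proof -
  let ?u = "\<lambda>i. pullback \<phi> (h i) * tp (\<eta> i)"
  have mem: "j \<in> {1..s}" "k \<in> {1..s}" and lead: "?u j $ N \<noteq> 0" "?u k $ N \<noteq> 0"
    using jk by (auto simp: leading_indices_def)
  have dvd: "fps_X ^ N dvd ?u i" if "i \<in> {1..s}" for i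
    using h(2) that by (simp add: order_ge_def)
  have hj: "pullback \<phi> (h j) \<noteq> 0" "subdegree (pullback \<phi> (h j)) + order_of j = N"
    using subdegree_mult_eqI[OF dvd[OF mem(1)] lead(1)] by (auto simp: order_of_def)
  have hk: "pullback \<phi> (h k) \<noteq> 0" "subdegree (pullback \<phi> (h k)) + order_of k = N"
    using subdegree_mult_eqI[OF dvd[OF mem(2)] lead(2)] by (auto simp: order_of_def)
  obtain \<gamma> where \<gamma>: "weight \<gamma> = subdegree (pullback \<phi> (h j))" "\<And>i. i > g \<Longrightarrow> \<gamma> i = 0"
    using subdegree_in_semigroup[OF hj(1)] by blast
  obtain \<delta> where \<delta>: "weight \<delta> = subdegree (pullback \<phi> (h k))" "\<And>i. i > g \<Longrightarrow> \<delta> i = 0"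
    using subdegree_in_semigroup[OF hk(1)] by blast
  have "(\<gamma>, \<delta>) \<in> value_solutions g v (enat (order_of j)) (enat (order_of k))"
    using \<gamma> \<delta> hj hk by (simp add: value_solutions_iff)
  then obtain \<gamma>' \<delta>' where min: "(\<gamma>', \<delta>') \<in> minimal_solutions g v (enat (order_of j)) (enat (order_of k))"
    and le: "\<gamma>' \<le> \<gamma>"
    by (rule minimal_solution_below)
  then obtain l where l: "l \<in> {1..n j k}" "\<gamma>' = \<alpha> j k l"
    using solutions[OF mem] unfolding class_val_\<eta>[OF mem(1)] class_val_\<eta>[OF mem(2)] by auto
  \<comment> \<open>The monomial with exponent \<epsilon> fills the gap between the minimal solution
    and the given one; multiplied by it, the syzygy has its monomial terms exactly in order
    N.\<close>
  define \<epsilon> where "\<epsilon> i = \<gamma> i - \<gamma>' i" for i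
  have "\<gamma> = (\<lambda>i. \<epsilon> i + \<alpha> j k l i)" using le by (auto simp: \<epsilon>_def l(2) le_fun_def)
  then have "weight \<gamma> = weight \<epsilon> + weight (\<alpha> j k l)" by (simp add: weight_add)
  then have N: "weight \<epsilon> + weight (\<alpha> j k l) + order_of j = N" using \<gamma> hj by simp
  have N': "weight \<epsilon> + weight (\<beta> j k l) + order_of k = N"
    using minimal_solution_jkl[OF mem l(1)] N by simp
  define M where "M = pullback \<phi> (f_monomial g F \<epsilon>)"
  have M: "M \<noteq> 0" "subdegree M = weight \<epsilon>" by (auto simp: M_def pullback_f_monomial)
  have M_dvd: "fps_X ^ weight \<epsilon> dvd M"
    unfolding X_power_dvd_iff M(2)[symmetric] by (blast intro: nth_less_subdegree_zero)
  let ?A = "pullback \<phi> (f_monomial g F (\<alpha> j k l))" and ?B = "pullback \<phi> (f_monomial g F (\<beta> j k l))"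
  define w where "w i = M * pullback \<phi> (E i j k l) * tp (\<eta> i)" for i
  have Q: "fps_X ^ Suc N dvd M * (pullback \<phi> (Q i j k l) * tp (\<eta> i))" if "i \<in> {1..s}" for i
  proof -
    have "Suc N = weight \<epsilon> + Suc (weight (\<alpha> j k l) + order_of j)" using N by simp
    then show ?thesis using mult_dvd_mono[OF M_dvd Q_order[OF mem l(1) that]] by (simp only: power_add)
  qed
  have w_other: "fps_X ^ Suc N dvd w i" if "i \<in> {1..s}" "i \<noteq> j" "i \<noteq> k" for i
    using Q[OF that(1)] that by (simp add: w_def pullback_E[OF mem l(1) that(1)] mult.assoc)
  have w_j: "w j = M * (pullback \<phi> (Q j j k l) * tp (\<eta> j)) - fps_const (a j k l) * (M * ?A * tp (\<eta> j))"
    using jk(3) by (simp add: w_def pullback_E[OF mem l(1) mem(1)] algebra_simps)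
  have w_k: "w k = M * (pullback \<phi> (Q k j k l) * tp (\<eta> k)) + fps_const (b j k l) * (M * ?B * tp (\<eta> k))"
    using jk(3) by (simp add: w_def pullback_E[OF mem l(1) mem(2)] algebra_simps)
  have MA: "M * ?A * tp (\<eta> j) \<noteq> 0" "subdegree (M * ?A * tp (\<eta> j)) = N"
    using M pullback_f_monomial \<eta>_nonzero[OF mem(1)] N by (auto simp: order_of_def)
  have MB: "subdegree (M * ?B * tp (\<eta> k)) = N"
    using M pullback_f_monomial \<eta>_nonzero[OF mem(2)] N' by (auto simp: order_of_def)
  have "a j k l \<noteq> 0" using S_process[OF mem l(1)] by (simp add: minimal_S_process_def)
  moreover have "(M * ?A * tp (\<eta> j)) $ N \<noteq> 0"
    using nth_subdegree_nonzero[OF MA(1)] unfolding MA(2) .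
  moreover have "(M * (pullback \<phi> (Q j j k l) * tp (\<eta> j))) $ N = 0"
    using Q[OF mem(1)] unfolding X_power_dvd_iff by blast
  ultimately have wjN: "w j $ N \<noteq> 0" unfolding w_j by simp
  have Q_N: "fps_X ^ N dvd M * (pullback \<phi> (Q i j k l) * tp (\<eta> i))" if "i \<in> {1..s}" for i
    using Q[OF that] by (auto simp: X_power_dvd_iff simp del: power_Suc)
  have "fps_X ^ N dvd M * ?A * tp (\<eta> j)"
    unfolding X_power_dvd_iff using nth_less_subdegree_zero MA(2) by blast
  then have w_dvd_j: "fps_X ^ N dvd w j"
    unfolding w_j using Q_N[OF mem(1)] by (meson dvd_diff dvd_mult)
  have "fps_X ^ N dvd M * ?B * tp (\<eta> k)"
    unfolding X_power_dvd_iff using nth_less_subdegree_zero MB by blast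
  then have w_dvd_k: "fps_X ^ N dvd w k"
    unfolding w_k using Q_N[OF mem(2)] by (meson dvd_add dvd_mult)
  have w_dvd: "fps_X ^ N dvd w i" if "i \<in> {1..s}" for i
  proof (cases "i = j \<or> i = k")
    case True
    then show ?thesis using w_dvd_j w_dvd_k by blast
  next
    case False
    then show ?thesis using w_other[OF that] by (auto simp: X_power_dvd_iff simp del: power_Suc)
  qed
  \<comment> \<open>At j only the monomial with factor a has order N, and a is nonzero, so the
    division is legitimate; c is chosen to cancel the leading coefficient of h at j.\<close>
  define c where "c = - (?u j $ N / w j $ N)"
  define r where "r = germ_const c * f_monomial g F \<epsilon>"
  define h' where "h' i = h i + r * E i j k l" for i
  have r: "pullback \<phi> r = fps_const c * M"
    by (simp add: r_def M_def pullback_mult pullback_const centered)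
  have u': "pullback \<phi> (h' i) * tp (\<eta> i) = ?u i + fps_const c * w i" for i
    by (simp add: h'_def pullback_add pullback_mult centered r w_def algebra_simps)
  have "(\<Sum>i=1..s. w i) = M * (\<Sum>i=1..s. pullback \<phi> (E i j k l) * tp (\<eta> i))"
    by (simp add: w_def sum_distrib_left mult.assoc)
  then have "(\<Sum>i=1..s. w i) = 0"
    using E_relation[OF mem l(1)] by (simp add: relation_def)
  then have rel: "relation h'"
    using h(1) by (simp add: relation_def u' sum.distrib flip: sum_distrib_left)
  have ord: "order_ge N h'"
    unfolding order_ge_def u' by (intro ballI dvd_add[OF dvd dvd_mult[OF w_dvd]])
  have sub: "leading_indices N h' \<subseteq> leading_indices N h - {j}"
  proof
    fix i assume i: "i \<in> leading_indices N h'"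
    then have i_s: "i \<in> {1..s}" and iN: "(?u i + fps_const c * w i) $ N \<noteq> 0"
      by (auto simp: leading_indices_def u')
    have "i \<noteq> j" using iN wjN by (auto simp: c_def)
    moreover have "i \<in> leading_indices N h"
    proof (cases "i = k")
      case True
      then show ?thesis using jk by simp
    next
      case False
      then have "w i $ N = 0"
        using w_other[OF i_s \<open>i \<noteq> j\<close>] unfolding X_power_dvd_iff by blast
      then show ?thesis using iN i_s by (simp add: leading_indices_def)
    qed
    ultimately show "i \<in> leading_indices N h - {j}" by simp
  qed
  have "(\<Sum>i=1..s. E i j k l *\<^sub>\<Omega> \<eta> i) \<in> G"
    unfolding G_def using mem l(1) by blast
  then have "(- r) *\<^sub>\<Omega> (\<Sum>i=1..s. E i j k l *\<^sub>\<Omega> \<eta> i) \<in> Omega.span G"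
    by (intro Omega.span_scale Omega.span_base)
  moreover have "(\<Sum>i=1..s. h i *\<^sub>\<Omega> \<eta> i) - (\<Sum>i=1..s. h' i *\<^sub>\<Omega> \<eta> i)
      = (- r) *\<^sub>\<Omega> (\<Sum>i=1..s. E i j k l *\<^sub>\<Omega> \<eta> i)"
    by (simp add: h'_def Omega.scale_left_distrib sum.distrib Omega.scale_sum_right sum_negf)
  ultimately have "(\<Sum>i=1..s. h i *\<^sub>\<Omega> \<eta> i) - (\<Sum>i=1..s. h' i *\<^sub>\<Omega> \<eta> i) \<in> Omega.span G" by simp
  with rel ord show ?thesis using sub jk(1) by (intro that[of h']) auto
qed

text \<open>The coefficients of order N of a relation add up to zero, so there is never exactly one
  leading index. As long as two exist, one of them can be removed.\<close>

lemma raise_order: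
  assumes "relation h" "order_ge N h"
  obtains h' where "relation h'" "order_ge (Suc N) h'"
    "(\<Sum>i=1..s. h i *\<^sub>\<Omega> \<eta> i) - (\<Sum>i=1..s. h' i *\<^sub>\<Omega> \<eta> i) \<in> Omega.span G"
proof -
  have "\<exists>h'. relation h' \<and> order_ge (Suc N) h' \<and>
    (\<Sum>i=1..s. h i *\<^sub>\<Omega> \<eta> i) - (\<Sum>i=1..s. h' i *\<^sub>\<Omega> \<eta> i) \<in> Omega.span G"
    using assms
  proof (induction "card (leading_indices N h)" arbitrary: h rule: less_induct)
    case less
    have fin: "finite (leading_indices N h)" by (simp add: leading_indices_def)
    show ?case
    proof (cases "leading_indices N h = {}")
      case True
      have "fps_X ^ Suc N dvd pullback \<phi> (h i) * tp (\<eta> i)" if i: "i \<in> {1..s}" for i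
        unfolding X_power_dvd_iff
      proof (intro allI impI)
        fix m assume "m < Suc N"
        then consider "m < N" | "m = N" by linarith
        then show "(pullback \<phi> (h i) * tp (\<eta> i)) $ m = 0"
          using less.prems(2) True i by cases (auto simp: order_ge_def X_power_dvd_iff leading_indices_def)
      qed
      then have "order_ge (Suc N) h" by (simp add: order_ge_def)
      then show ?thesis using less.prems(1) by (intro exI[of _ h]) (simp add: Omega.span_zero)
    next
      case False
      then obtain j where j: "j \<in> leading_indices N h" by blast
      have "\<exists>k\<in>leading_indices N h. k \<noteq> j"
      proof (rule ccontr)
        assume no: "\<not> ?thesis"
        have "0 = (\<Sum>i=1..s. pullback \<phi> (h i) * tp (\<eta> i)) $ N"
          using less.prems(1) by (simp add: relation_def)
        also have "\<dots> = (\<Sum>i\<in>{j}. (pullback \<phi> (h i) * tp (\<eta> i)) $ N)"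
          unfolding fps_sum_nth using j no by (intro sum.mono_neutral_right) (auto simp: leading_indices_def)
        finally show False using j by (simp add: leading_indices_def)
      qed
      then obtain k where k: "k \<in> leading_indices N h" "j \<noteq> k" by blast
      obtain h1 where h1: "relation h1" "order_ge N h1" "leading_indices N h1 \<subset> leading_indices N h"
        "(\<Sum>i=1..s. h i *\<^sub>\<Omega> \<eta> i) - (\<Sum>i=1..s. h1 i *\<^sub>\<Omega> \<eta> i) \<in> Omega.span G"
        by (rule cancel_leading_term[OF less.prems j k])
      from less.hyps[OF psubset_card_mono[OF fin h1(3)] h1(1,2)] obtain h' where
        h': "relation h'" "order_ge (Suc N) h'"
          "(\<Sum>i=1..s. h1 i *\<^sub>\<Omega> \<eta> i) - (\<Sum>i=1..s. h' i *\<^sub>\<Omega> \<eta> i) \<in> Omega.span G"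
        by blast
      have "(\<Sum>i=1..s. h i *\<^sub>\<Omega> \<eta> i) - (\<Sum>i=1..s. h' i *\<^sub>\<Omega> \<eta> i) \<in> Omega.span G"
        using Omega.span_add[OF h1(4) h'(3)] by simp
      with h' show ?thesis by blast
    qed
  qed
  then show ?thesis using that by blast
qed

lemma raise_order_arbitrarily:
  assumes "relation h"
  obtains h' where "relation h'" "order_ge N h'"
    "(\<Sum>i=1..s. h i *\<^sub>\<Omega> \<eta> i) - (\<Sum>i=1..s. h' i *\<^sub>\<Omega> \<eta> i) \<in> Omega.span G"
proof -
  have "\<exists>h'. relation h' \<and> order_ge N h' \<and>
    (\<Sum>i=1..s. h i *\<^sub>\<Omega> \<eta> i) - (\<Sum>i=1..s. h' i *\<^sub>\<Omega> \<eta> i) \<in> Omega.span G"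
  proof (induction N)
    case 0
    then show ?case using assms by (intro exI[of _ h]) (simp add: order_ge_def Omega.span_zero)
  next
    case (Suc N)
    then obtain h1 where h1: "relation h1" "order_ge N h1"
      "(\<Sum>i=1..s. h i *\<^sub>\<Omega> \<eta> i) - (\<Sum>i=1..s. h1 i *\<^sub>\<Omega> \<eta> i) \<in> Omega.span G" by blast
    obtain h' where h': "relation h'" "order_ge (Suc N) h'"
      "(\<Sum>i=1..s. h1 i *\<^sub>\<Omega> \<eta> i) - (\<Sum>i=1..s. h' i *\<^sub>\<Omega> \<eta> i) \<in> Omega.span G"
      by (rule raise_order[OF h1(1,2)])
    have "(\<Sum>i=1..s. h i *\<^sub>\<Omega> \<eta> i) - (\<Sum>i=1..s. h' i *\<^sub>\<Omega> \<eta> i) \<in> Omega.span G"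
      using Omega.span_add[OF h1(3) h'(3)] by simp
    with h' show ?case by blast
  qed
  then show ?thesis using that by blast
qed

lemma saito_module_decompose:
  assumes \<omega>: "\<omega> \<in> saito_module f"
  obtains \<gamma> \<omega>' \<zeta> where "\<gamma> \<in> Omega.span G" "\<omega>' \<in> saito_module f"
    "\<omega> = \<gamma> + germ_x *\<^sub>\<Omega> \<omega>' + f *\<^sub>\<Omega> \<zeta>"
proof -
  obtain h where h: "\<omega> = (\<Sum>i=1..s. h i *\<^sub>\<Omega> \<eta> i)" using \<eta>_generate by blast
  from conductor obtain N where
    N: "\<forall>h. fps_X ^ N dvd pullback \<phi> h \<longrightarrow> (\<exists>k. pullback \<phi> h = fst \<phi> * pullback \<phi> k)" ..
  \<comment> \<open>After the order of \<open>\<eta> i\<close> is taken off, order K of a product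
    leaves order at least N for its coefficient, for all i at once.\<close>
  define K where "K = N + (\<Sum>i=1..s. order_of i)"
  have "relation h" using \<omega> by (simp add: relation_iff h)
  then obtain h' where h': "relation h'" "order_ge K h'"
    "(\<Sum>i=1..s. h i *\<^sub>\<Omega> \<eta> i) - (\<Sum>i=1..s. h' i *\<^sub>\<Omega> \<eta> i) \<in> Omega.span G"
    by (rule raise_order_arbitrarily)
  have "\<exists>k m. h' i = germ_x * k + f * m" if i: "i \<in> {1..s}" for i
  proof -
    have "fps_X ^ N dvd pullback \<phi> (h' i)"
    proof (cases "pullback \<phi> (h' i) = 0")
      case False
      have "enat K \<le> t_order (pullback \<phi> (h' i) * tp (\<eta> i))"
        using h'(2) i by (simp add: order_ge_def flip: X_power_dvd_iff_t_order)
      then have "K \<le> subdegree (pullback \<phi> (h' i)) + order_of i"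
        using False \<eta>_nonzero[OF i] by (simp add: t_order_def order_of_def)
      moreover have "order_of i \<le> (\<Sum>i=1..s. order_of i)"
        using i by (intro member_le_sum) auto
      ultimately have "N \<le> subdegree (pullback \<phi> (h' i))" by (simp add: K_def)
      then show ?thesis using False by (simp add: X_power_dvd_iff_t_order t_order_def)
    qed simp
    then obtain k where "pullback \<phi> (h' i) = fst \<phi> * pullback \<phi> k" using N by blast
    then have "pullback \<phi> (h' i - germ_x * k) = 0"
      by (simp add: pullback_diff pullback_mult pullback_x centered)
    then obtain m where "h' i - germ_x * k = f * m" by (auto simp: pullback_eq_0_iff dvd_def)
    then have "h' i = germ_x * k + f * m" by (simp add: algebra_simps)
    then show ?thesis by blast
  qed
  then obtain k m where km: "\<And>i. i \<in> {1..s} \<Longrightarrow> h' i = germ_x * k i + f * m i" by metis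
  let ?\<omega>' = "\<Sum>i=1..s. k i *\<^sub>\<Omega> \<eta> i" and ?\<zeta> = "\<Sum>i=1..s. m i *\<^sub>\<Omega> \<eta> i"
  have eq: "(\<Sum>i=1..s. h' i *\<^sub>\<Omega> \<eta> i) = germ_x *\<^sub>\<Omega> ?\<omega>' + f *\<^sub>\<Omega> ?\<zeta>"
    using km by (simp add: Omega.scale_left_distrib sum.distrib Omega.scale_sum_right)
  have "(\<Sum>i=1..s. h' i *\<^sub>\<Omega> \<eta> i) \<in> saito_module f" using h'(1) by (simp add: relation_iff)
  \<comment> \<open>Every multiple of f lies in S(f), so x times \<open>?\<omega>'\<close> does too,
    and x cancels.\<close>
  then have "germ_x *\<^sub>\<Omega> ?\<omega>' + f *\<^sub>\<Omega> ?\<zeta> - f *\<^sub>\<Omega> ?\<zeta> \<in> saito_module f"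
    unfolding eq by (intro saito_module_module(3,5))
  then have "?\<omega>' \<in> saito_module f" by (simp add: saito_module_module(6))
  moreover have "\<omega> = (\<omega> - (\<Sum>i=1..s. h' i *\<^sub>\<Omega> \<eta> i)) + germ_x *\<^sub>\<Omega> ?\<omega>' + f *\<^sub>\<Omega> ?\<zeta>"
    using eq by (simp add: add.assoc)
  ultimately show ?thesis using h'(3) unfolding h[symmetric] by (intro that)
qed

text \<open>On S(f), wedge / f evaluated at the origin is an alternating pairing, and degenerate
  pairs are those on which it vanishes. The cofactor is quantified because the wedge of arbitrary
  forms need not be a multiple of f.\<close>

definition degenerate :: "form \<Rightarrow> form \<Rightarrow> bool" where
  "degenerate \<omega> \<omega>' \<longleftrightarrow> (\<exists>d. wedge \<omega> \<omega>' = f * d \<and> coeff2 d 0 0 = 0)"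

lemma degenerate_commute: "degenerate \<omega> \<omega>' \<Longrightarrow> degenerate \<omega>' \<omega>"
proof -
  assume "degenerate \<omega> \<omega>'"
  then obtain d where "wedge \<omega> \<omega>' = f * d" "coeff2 d 0 0 = 0" by (auto simp: degenerate_def)
  then have "wedge \<omega>' \<omega> = f * (- d)" "coeff2 (- d) 0 0 = 0"
    by (simp_all add: wedge_commute[of \<omega>'] coeff2.rep_eq uminus_germ.rep_eq)
  then show ?thesis unfolding degenerate_def by blast
qed

lemma degenerate_add: "degenerate \<omega> \<zeta> \<Longrightarrow> degenerate \<omega>' \<zeta> \<Longrightarrow> degenerate (\<omega> + \<omega>') \<zeta>"
proof -
  assume "degenerate \<omega> \<zeta>" "degenerate \<omega>' \<zeta>"
  then obtain d d' where "wedge \<omega> \<zeta> = f * d" "coeff2 d 0 0 = 0" "wedge \<omega>' \<zeta> = f * d'" "coeff2 d' 0 0 = 0"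
    by (auto simp: degenerate_def)
  then have "wedge (\<omega> + \<omega>') \<zeta> = f * (d + d')" "coeff2 (d + d') 0 0 = 0"
    by (simp_all add: wedge_add_left distrib_left coeff2.rep_eq plus_germ.rep_eq)
  then show ?thesis unfolding degenerate_def by blast
qed

lemma degenerate_scale: "degenerate \<omega> \<zeta> \<Longrightarrow> degenerate (h *\<^sub>\<Omega> \<omega>) \<zeta>"
proof -
  assume "degenerate \<omega> \<zeta>"
  then obtain d where "wedge \<omega> \<zeta> = f * d" "coeff2 d 0 0 = 0" by (auto simp: degenerate_def)
  then have "wedge (h *\<^sub>\<Omega> \<omega>) \<zeta> = f * (h * d)" "coeff2 (h * d) 0 0 = 0"
    by (simp_all add: wedge_scale_left mult_ac coeff2_mult_0_0)
  then show ?thesis unfolding degenerate_def by blast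
qed

lemma degenerate_span:
  assumes "\<And>\<omega>. \<omega> \<in> A \<Longrightarrow> degenerate \<omega> \<zeta>" "\<omega> \<in> Omega.span A"
  shows "degenerate \<omega> \<zeta>"
proof -
  have "degenerate 0 \<zeta>"
    unfolding degenerate_def wedge_0_left by (intro exI[of _ 0]) (simp add: coeff2.rep_eq zero_germ.rep_eq)
  then have "Omega.subspace {\<omega>. degenerate \<omega> \<zeta>}"
    by (intro Omega.subspaceI) (auto simp: degenerate_add degenerate_scale)
  then have "Omega.span A \<subseteq> {\<omega>. degenerate \<omega> \<zeta>}"
    using assms(1) by (intro Omega.span_minimal) auto
  then show ?thesis using assms(2) by blast
qed

text \<open>The factor f is already split off, and the remaining wedge vanishes at the origin for
  arbitrary \<zeta> because both coefficients of \<omega> do.\<close>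

lemma degenerate_f:
  assumes "\<omega> \<in> saito_module f"
  shows "degenerate (f *\<^sub>\<Omega> \<zeta>) \<omega>"
proof -
  have "coeff2 (wedge \<zeta> \<omega>) 0 0 = 0"
    using in_maximal_ideal[OF assms]
    by (simp add: wedge_def coeff2.rep_eq minus_germ.rep_eq times_germ.rep_eq)
  then show ?thesis unfolding degenerate_def wedge_scale_left by blast
qed

lemma degenerate_x:
  assumes "\<omega> \<in> saito_module f" "\<omega>' \<in> saito_module f"
  shows "degenerate (germ_x *\<^sub>\<Omega> \<omega>) \<omega>'"
proof -
  obtain d where "wedge \<omega> \<omega>' = f * d" using dvd_wedge_saito_module[OF assms] by (auto simp: dvd_def)
  then have "wedge (germ_x *\<^sub>\<Omega> \<omega>) \<omega>' = f * (germ_x * d)" "coeff2 (germ_x * d) 0 0 = 0"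
    by (simp_all add: wedge_scale_left mult_ac coeff2_mult_0_0) (simp add: coeff2.rep_eq germ_x.rep_eq)
  then show ?thesis unfolding degenerate_def by blast
qed

lemma exists_nondegenerate_pair: "\<exists>\<omega>\<in>G. \<exists>\<omega>'\<in>G. \<not> degenerate \<omega> \<omega>'"
proof (rule ccontr)
  assume "\<not> ?thesis"
  then have deg: "degenerate \<omega> \<omega>'" if "\<omega> \<in> G" "\<omega>' \<in> G" for \<omega> \<omega>' using that by blast
  have span_sub: "Omega.span G \<subseteq> saito_module f"
    using G_subset saito_module_module(1,2,4) by (intro Omega.span_minimal Omega.subspaceI) auto
  have extend: "degenerate \<omega> \<omega>'" if \<omega>: "\<omega> \<in> saito_module f" and \<omega>': "\<omega>' \<in> saito_module f"
    and G: "\<And>\<gamma>. \<gamma> \<in> G \<Longrightarrow> degenerate \<gamma> \<omega>'" for \<omega> \<omega>'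
  proof -
    obtain \<gamma> \<omega>\<^sub>1 \<zeta> where d: "\<gamma> \<in> Omega.span G" "\<omega>\<^sub>1 \<in> saito_module f" "\<omega> = \<gamma> + germ_x *\<^sub>\<Omega> \<omega>\<^sub>1 + f *\<^sub>\<Omega> \<zeta>"
      by (rule saito_module_decompose[OF \<omega>])
    show ?thesis
      unfolding d(3)
      by (intro degenerate_add degenerate_x[OF d(2) \<omega>'] degenerate_f[OF \<omega>'] degenerate_span[OF G d(1)])
  qed
  \<comment> \<open>The decomposition works in one argument only. It is applied to \<omega>' against
    each member of G, and after an exchange of arguments to \<omega> against \<omega>'.\<close>
  have all: "degenerate \<omega> \<omega>'" if "\<omega> \<in> saito_module f" "\<omega>' \<in> saito_module f" for \<omega> \<omega>'
  proof (rule extend[OF that])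
    fix \<gamma> assume \<gamma>: "\<gamma> \<in> G"
    have "degenerate \<omega>' \<gamma>"
      by (rule extend[OF that(2)]) (use \<gamma> G_subset deg in auto)
    then show "degenerate \<gamma> \<omega>'" by (rule degenerate_commute)
  qed
  obtain \<omega>\<^sub>1 \<omega>\<^sub>2 u where u: "\<omega>\<^sub>1 \<in> saito_module f" "\<omega>\<^sub>2 \<in> saito_module f"
    "is_unit u" "wedge \<omega>\<^sub>1 \<omega>\<^sub>2 = u * f"
    by (rule saito_module_free)
  from all[OF u(1,2)] obtain d where d: "u * f = f * d" "coeff2 d 0 0 = 0"
    by (auto simp: degenerate_def u(4))
  have "u = d" using d(1) f_neq_0 by (simp add: mult.commute)
  then show False using u(3) d(2) by (simp add: germ_is_unit_iff)
qed

theorem saito_basis_in_G: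
  "Omega.span G = saito_module f"
  "\<exists>\<omega>\<^sub>1\<in>G. \<exists>\<omega>\<^sub>2\<in>G. (\<exists>u. is_unit u \<and> wedge \<omega>\<^sub>1 \<omega>\<^sub>2 = u * f) \<and> saito_basis f \<omega>\<^sub>1 \<omega>\<^sub>2"
proof -
  obtain \<omega>\<^sub>1 \<omega>\<^sub>2 where \<omega>: "\<omega>\<^sub>1 \<in> G" "\<omega>\<^sub>2 \<in> G" "\<not> degenerate \<omega>\<^sub>1 \<omega>\<^sub>2"
    using exists_nondegenerate_pair by blast
  have mem: "\<omega>\<^sub>1 \<in> saito_module f" "\<omega>\<^sub>2 \<in> saito_module f" using \<omega> G_subset by auto
  obtain d where d: "wedge \<omega>\<^sub>1 \<omega>\<^sub>2 = f * d" using dvd_wedge_saito_module[OF mem] by (auto simp: dvd_def)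
  then have "coeff2 d 0 0 \<noteq> 0" using \<omega>(3) by (auto simp: degenerate_def)
  then have u: "is_unit d" by (simp add: germ_is_unit_iff)
  have eq: "wedge \<omega>\<^sub>1 \<omega>\<^sub>2 = d * f" using d by (simp add: mult.commute)
  have basis: "saito_basis f \<omega>\<^sub>1 \<omega>\<^sub>2" by (rule saito_basisI[OF mem u eq])
  show "\<exists>\<omega>\<^sub>1\<in>G. \<exists>\<omega>\<^sub>2\<in>G. (\<exists>u. is_unit u \<and> wedge \<omega>\<^sub>1 \<omega>\<^sub>2 = u * f) \<and> saito_basis f \<omega>\<^sub>1 \<omega>\<^sub>2"
    using \<omega> u eq basis by blast
  show "Omega.span G = saito_module f"
  proof
    show "Omega.span G \<subseteq> saito_module f"
      using G_subset saito_module_module(1,2,4) by (intro Omega.span_minimal Omega.subspaceI) auto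
    have "Omega.span {\<omega>\<^sub>1, \<omega>\<^sub>2} \<subseteq> Omega.span G" using \<omega> by (intro Omega.span_mono) auto
    then show "saito_module f \<subseteq> Omega.span G" using basis by (simp add: saito_basis_def)
  qed
qed

end

section \<open>The output of the algorithm\<close>

text \<open>Rounds only enlarge the set, so the classes of dx and dy occur in the output; this is
  what makes its representatives generate all forms.\<close>

lemma algorithm_state_start:
  "algorithm_state f \<phi> g v F B \<Longrightarrow> i \<le> g \<Longrightarrow> form_class f (d_germ (F i)) \<in> B"
  by (induction rule: algorithm_state.induct) (auto simp: algorithm_round_def)

lemma algorithm_state_nonzero:
  assumes "algorithm_state f \<phi> g v F B" "\<And>i. i \<le> g \<Longrightarrow> form_class f (d_germ (F i)) \<noteq> saito_module f"
  shows "saito_module f \<notin> B"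
  using assms by (induction rule: algorithm_state.induct) (auto simp: algorithm_round_def)

lemma d_germ_x: "d_germ germ_x = (1, 0)"
proof -
  have "partial_x germ_x = 1" "partial_y germ_x = 0"
    by (rule germ_eqI, simp add: partial_x.rep_eq partial_y.rep_eq germ_x.rep_eq one_germ.rep_eq zero_germ.rep_eq fps_eq_iff fps_X_def)+
  then show ?thesis by (simp add: d_germ_def)
qed

lemma d_germ_y: "d_germ germ_y = (0, 1)"
proof -
  have "partial_x germ_y = 0" "partial_y germ_y = 1"
    by (rule germ_eqI, simp add: partial_x.rep_eq partial_y.rep_eq germ_y.rep_eq one_germ.rep_eq zero_germ.rep_eq fps_eq_iff fps_X_def)+
  then show ?thesis by (simp add: d_germ_def)
qed

lemma forms_generated_by_unit_wedge:
  assumes "is_unit (wedge \<omega>\<^sub>1 \<omega>\<^sub>2)"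
  obtains p q where "\<omega> = p *\<^sub>\<Omega> \<omega>\<^sub>1 + q *\<^sub>\<Omega> \<omega>\<^sub>2"
proof -
  obtain v where v: "1 = wedge \<omega>\<^sub>1 \<omega>\<^sub>2 * v" using assms by (auto simp: dvd_def)
  have "\<omega> = v *\<^sub>\<Omega> (wedge \<omega>\<^sub>1 \<omega>\<^sub>2 *\<^sub>\<Omega> \<omega>)" using v by (simp add: mult.commute)
  also have "\<dots> = (v * wedge \<omega> \<omega>\<^sub>2) *\<^sub>\<Omega> \<omega>\<^sub>1 + (- (v * wedge \<omega> \<omega>\<^sub>1)) *\<^sub>\<Omega> \<omega>\<^sub>2"
    unfolding cramer_form[of \<omega>\<^sub>1 \<omega>\<^sub>2 \<omega>] by (simp add: form_scale_def prod_eq_iff algebra_simps)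
  finally show ?thesis by (rule that)
qed

theorem mainTheorem2:
  fixes f :: germ and \<phi> :: param
    and g :: nat and v :: "nat \<Rightarrow> nat" and F :: "nat \<Rightarrow> germ"
    and B :: "form_class set" and s :: nat and \<eta> :: "nat \<Rightarrow> form"
    and n :: "nat \<Rightarrow> nat \<Rightarrow> nat"
    and \<alpha> \<beta> :: "nat \<Rightarrow> nat \<Rightarrow> nat \<Rightarrow> nat \<Rightarrow> nat"
    and a b :: "nat \<Rightarrow> nat \<Rightarrow> nat \<Rightarrow> complex"
    and Q E :: "nat \<Rightarrow> nat \<Rightarrow> nat \<Rightarrow> nat \<Rightarrow> germ"
  defines "G \<equiv> {\<Sum>i=1..s. E i j k l *\<^sub>\<Omega> \<eta> i | j k l. j \<in> {1..s} \<and> k \<in> {1..s} \<and> l \<in> {1..n j k}}"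
  assumes "irreducible f" and "multiplicity_at_0 f > 1"
    and "primitive_parametrization f \<phi>"
    and "g \<ge> 1" and "strict_mono_on {..g} v"
    and "minimally_generated (v ` {..g}) (value_semigroup \<phi>)"
    and "germ_val \<phi> germ_x = enat (v 0)" and "v 0 = multiplicity_at_0 f"
    and "germ_val \<phi> germ_y = enat (v 1)" and "\<not> v 0 dvd v 1"
    and "F 0 = germ_x" and "F 1 = germ_y" and "\<And>i. i \<le> g \<Longrightarrow> germ_val \<phi> (F i) = enat (v i)"
    and "algorithm_output f \<phi> g v F B"
    and "bij_betw (\<lambda>i. form_class f (\<eta> i)) {1..s} B"
    and "\<And>j k. j \<in> {1..s} \<Longrightarrow> k \<in> {1..s} \<Longrightarrow>
           bij_betw (\<lambda>l. (\<alpha> j k l, \<beta> j k l)) {1..n j k}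
             (minimal_solutions g v (class_val \<phi> (form_class f (\<eta> j))) (class_val \<phi> (form_class f (\<eta> k))))"
    and "\<And>j k l. j \<in> {1..s} \<Longrightarrow> k \<in> {1..s} \<Longrightarrow> l \<in> {1..n j k} \<Longrightarrow>
           minimal_S_process f \<phi> g v F
             (a j k l) (\<alpha> j k l) (form_class f (\<eta> j)) (b j k l) (\<beta> j k l) (form_class f (\<eta> k))"
    and "\<And>j k l. j \<in> {1..s} \<Longrightarrow> k \<in> {1..s} \<Longrightarrow> l \<in> {1..n j k} \<Longrightarrow>
           zero_reduction_coefficients f \<phi> g F s \<eta>
             (S_element f g F (a j k l) (\<alpha> j k l) (form_class f (\<eta> j))
                              (b j k l) (\<beta> j k l) (form_class f (\<eta> k)))
             (\<lambda>i. Q i j k l)"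
    and "\<And>i j k l. i \<in> {1..s} \<Longrightarrow> j \<in> {1..s} \<Longrightarrow> k \<in> {1..s} \<Longrightarrow> l \<in> {1..n j k} \<Longrightarrow>
           f dvd E i j k l - (Q i j k l
             - (if i = j then germ_const (a j k l) * f_monomial g F (\<alpha> j k l) else 0)
             + (if i = k then germ_const (b j k l) * f_monomial g F (\<beta> j k l) else 0))"
  shows "Omega.span G = saito_module f \<and>
         (\<exists>\<omega>\<^sub>1\<in>G. \<exists>\<omega>\<^sub>2\<in>G. (\<exists>u. is_unit u \<and> wedge \<omega>\<^sub>1 \<omega>\<^sub>2 = u * f) \<and> saito_basis f \<omega>\<^sub>1 \<omega>\<^sub>2)"
proof -
  have cen: "centered \<phi>" and pf: "pullback \<phi> f = 0"
    using assms(4) by (auto simp: primitive_parametrization_def centered_def)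
  have x: "fst \<phi> \<noteq> 0" "subdegree (fst \<phi>) = v 0"
    using assms(8) by (auto simp: germ_val_def t_order_def pullback_x[OF cen] split: if_splits)
  have y: "snd \<phi> \<noteq> 0" "subdegree (snd \<phi>) = v 1"
    using assms(10) by (auto simp: germ_val_def t_order_def pullback_y[OF cen] split: if_splits)
  interpret branch f \<phi>
    by standard (use assms(2) cen x pf in auto)
  have v01: "v 0 < v 1"
    using assms(5,6) by (auto simp: strict_mono_on_def)
  have v_pos: "v i > 0" if "i \<le> g" for i
  proof -
    have "v 0 > 0" using subdegree_pos[OF x(1)] cen x(2) by (simp add: centered_def)
    moreover have "v 0 \<le> v i"
      using assms(6) that by (cases "i = 0") (auto simp: strict_mono_on_def intro: less_imp_le)
    ultimately show ?thesis by simp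
  qed
  have max: "coeff2 (fst \<omega>) 0 0 = 0 \<and> coeff2 (snd \<omega>) 0 0 = 0" if "\<omega> \<in> saito_module f" for \<omega>
    using saito_module_in_maximal_ideal[OF _ _ that] v01 assms(11) x y by simp
  \<comment> \<open>Since v i is positive, t d/dt does not kill the pullback of F i.\<close>
  have start: "form_class f (d_germ (F i)) \<noteq> saito_module f" if "i \<le> g" for i
  proof -
    have F: "pullback \<phi> (F i) \<noteq> 0" "subdegree (pullback \<phi> (F i)) = v i"
      using assms(14)[OF that] by (auto simp: germ_val_def t_order_def split: if_splits)
    have "pullback \<phi> (F i) $ 0 = 0"
      by (rule nth_less_subdegree_zero) (simp only: F(2) v_pos[OF that])
    then have "tp (d_germ (F i)) \<noteq> 0"
      using subdegree_X_mult_deriv(1) F(1) by (simp add: tp_def form_pullback_d_germ cen)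
    then show ?thesis by (simp add: form_class_eq_saito_iff)
  qed
  have state: "algorithm_state f \<phi> g v F B" using assms(15) by (simp add: algorithm_output_def)
  have B: "B = (\<lambda>i. form_class f (\<eta> i)) ` {1..s}" using assms(16) by (simp add: bij_betw_def)
  have nonzero: "tp (\<eta> i) \<noteq> 0" if "i \<in> {1..s}" for i
    using algorithm_state_nonzero[OF state start] that unfolding B
    by (metis form_class_eq_saito_iff imageI)
  have gen: "\<exists>h. \<omega> = (\<Sum>i=1..s. h i *\<^sub>\<Omega> \<eta> i)" for \<omega>
  proof -
    have "form_class f (1, 0) \<in> B"
      using algorithm_state_start[OF state, of 0] unfolding assms(12) d_germ_x by simp
    then obtain i where i: "i \<in> {1..s}" "form_class f (1, 0) = form_class f (\<eta> i)"
      unfolding B by (elim imageE) (rule that)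
    have "form_class f (0, 1) \<in> B"
      using algorithm_state_start[OF state assms(5)] unfolding assms(13) d_germ_y .
    then obtain j where j: "j \<in> {1..s}" "form_class f (0, 1) = form_class f (\<eta> j)"
      unfolding B by (elim imageE) (rule that)
    \<comment> \<open>\<open>\<eta> i\<close> and \<open>\<eta> j\<close> are dx and dy only up to
      S(f). Members of S(f) vanish at the origin, so the determinant there is still 1 and its germ
      is a unit.\<close>
    have "\<eta> i - (1, 0) \<in> saito_module f" "\<eta> j - (0, 1) \<in> saito_module f"
      using i(2) j(2) by (auto simp: form_class_eq_iff saito_module_iff tp_simps)
    from max[OF this(1)] max[OF this(2)]
    have "coeff2 (fst (\<eta> i)) 0 0 = 1" "coeff2 (snd (\<eta> i)) 0 0 = 0"
      "coeff2 (fst (\<eta> j)) 0 0 = 0" "coeff2 (snd (\<eta> j)) 0 0 = 1"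
      by (simp_all add: coeff2.rep_eq minus_germ.rep_eq one_germ.rep_eq zero_germ.rep_eq)
    then have "is_unit (wedge (\<eta> i) (\<eta> j))"
      by (simp add: germ_is_unit_iff wedge_def coeff2.rep_eq minus_germ.rep_eq times_germ.rep_eq)
    then obtain p q where pq: "\<omega> = p *\<^sub>\<Omega> \<eta> i + q *\<^sub>\<Omega> \<eta> j"
      by (rule forms_generated_by_unit_wedge)
    \<comment> \<open>Two separate conditionals are added, so i and j need not be compared.\<close>
    let ?h = "\<lambda>k. (if k = i then p else 0) + (if k = j then q else 0)"
    have "(\<Sum>k=1..s. ?h k *\<^sub>\<Omega> \<eta> k)
        = (\<Sum>k=1..s. (if k = i then p *\<^sub>\<Omega> \<eta> k else 0) + (if k = j then q *\<^sub>\<Omega> \<eta> k else 0))"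
      by (intro sum.cong refl) (auto simp: Omega.scale_left_distrib)
    also have "\<dots> = \<omega>"
      using i(1) j(1) by (simp add: sum.distrib pq)
    finally show ?thesis by (intro exI[of _ ?h]) (rule sym)
  qed
  have cond: "\<exists>N. \<forall>h. fps_X ^ N dvd pullback \<phi> h \<longrightarrow> (\<exists>k. pullback \<phi> h = fst \<phi> * pullback \<phi> k)"
    by (rule pullback_conductor[OF assms(4) x(1)]) blast
  interpret R: reduced_standard_basis f \<phi> g v F s \<eta> n \<alpha> \<beta> a b Q E
  proof unfold_locales
    show "inj_on v {..g}" using assms(6) by (rule strict_mono_on_imp_inj_on)
    show "submonoid_gen (v ` {..g}) = value_semigroup \<phi>"
      using assms(7) by (simp add: minimally_generated_def)
    show "inj_on (\<lambda>i. form_class f (\<eta> i)) {1..s}" using assms(16) by (simp add: bij_betw_def)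
    show "minimal_solutions g v (class_val \<phi> (form_class f (\<eta> j))) (class_val \<phi> (form_class f (\<eta> k)))
             = (\<lambda>l. (\<alpha> j k l, \<beta> j k l)) ` {1..n j k}" if "j \<in> {1..s}" "k \<in> {1..s}" for j k
      using assms(17)[OF that] by (simp add: bij_betw_def)
  qed (fact assms(14) nonzero assms(18) assms(19) assms(20) gen cond max)+
  show ?thesis
    using R.saito_basis_in_G unfolding R.G_def G_def by blast
qed

end
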